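(* For each integer $k\ge2$ there exists a finite $M=M(k)$ such that, for every $\tau\in\Gamma_k$, every entropy maximizer at $\tau$ for the $k$-star model is $m$-podal for some $m\le M$.
   Context: A graphon is a symmetric measurable function $g:[0,1]^2\to[0,1]$, with degree function $d_g(x)=\int_0^1 g(x,y)\,dy$. For $j\ge1$ the $j$-star density is $t_j(g)=\int_0^1 d_g(x)^j\,dx$. The Shannon entropy is $\mathcal S(g)=\frac12\int_{[0,1]^2}S(g(x,y))\,dx\,dy$ with $S(w)=-w\ln w-(1-w)\ln(1-w)$. For fixed $k\ge2$, $\Gamma_k=\{(t_1(g),t_k(g)) : g\text{ a graphon}\}$. An entropy maximizer at $\tau\in\Gamma_k$ is a graphon $g$ with $(t_1(g),t_k(g))=\tau$ such that $\mathcal S(g)\ge\mathcal S(h)$ for every graphon $h$ with $(t_1(h),t_k(h))=\tau$. A graphon is $m$-podal if there is a partition of $[0,1]$ into at most $m$ measurable sets $V_1,\dots,V_p$ such that $g$ is almost everywhere constant on each $V_i\times V_j$. *)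

theory Defs
  imports "HOL-Analysis.Analysis"
begin

definition unit_sq :: "(real \<times> real) set" where
  "unit_sq = {0..1} \<times> {0..1}"

definition graphon :: "(real \<Rightarrow> real \<Rightarrow> real) \<Rightarrow> bool" where
  "graphon g \<longleftrightarrow>
     (\<lambda>(x, y). g x y) \<in> borel_measurable (restrict_space (lborel \<Otimes>\<^sub>M lborel) unit_sq) \<and>
     (\<forall>x\<in>{0..1}. \<forall>y\<in>{0..1}. g x y = g y x \<and> 0 \<le> g x y \<and> g x y \<le> 1)"

definition degree :: "(real \<Rightarrow> real \<Rightarrow> real) \<Rightarrow> real \<Rightarrow> real" where
  "degree g x = (LINT y:{0..1}|lborel. g x y)"

definition star_density :: "nat \<Rightarrow> (real \<Rightarrow> real \<Rightarrow> real) \<Rightarrow> real" where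
  "star_density j g = (LINT x:{0..1}|lborel. (degree g x) ^ j)"

text \<open>Note: in Isabelle \<open>ln 0 = 0\<close>, so \<open>S 0 = S 1 = 0\<close> as per the convention \<open>0 ln 0 = 0\<close>.\<close>

definition S_ent :: "real \<Rightarrow> real" where
  "S_ent w = - w * ln w - (1 - w) * ln (1 - w)"

definition entropy :: "(real \<Rightarrow> real \<Rightarrow> real) \<Rightarrow> real" where
  "entropy g = 1/2 * (LINT p:unit_sq|(lborel \<Otimes>\<^sub>M lborel). S_ent (g (fst p) (snd p)))"

definition Gamma :: "nat \<Rightarrow> (real \<times> real) set" where
  "Gamma k = {(star_density 1 g, star_density k g) | g. graphon g}"

definition entropy_maximizer :: "nat \<Rightarrow> real \<times> real \<Rightarrow> (real \<Rightarrow> real \<Rightarrow> real) \<Rightarrow> bool" where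
  "entropy_maximizer k \<tau> g \<longleftrightarrow>
     graphon g \<and> (star_density 1 g, star_density k g) = \<tau> \<and>
     (\<forall>h. graphon h \<and> (star_density 1 h, star_density k h) = \<tau> \<longrightarrow> entropy h \<le> entropy g)"

definition podal :: "nat \<Rightarrow> (real \<Rightarrow> real \<Rightarrow> real) \<Rightarrow> bool" where
  "podal m g \<longleftrightarrow>
     (\<exists>p \<le> m. \<exists>V :: nat \<Rightarrow> real set.
        (\<forall>i<p. V i \<in> sets lborel) \<and>
        (\<Union>i<p. V i) = {0..1} \<and>
        (\<forall>i<p. \<forall>j<p. i \<noteq> j \<longrightarrow> V i \<inter> V j = {}) \<and>
        (\<forall>i<p. \<forall>j<p. \<exists>c. AE z in (lborel \<Otimes>\<^sub>M lborel).
            z \<in> V i \<times> V j \<longrightarrow> g (fst z) (snd z) = c))"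

end

theory Submission
  imports Defs "HOL-Probability.Probability"
begin

text \<open>
  Write \<open>d\<close> for the degree function of a maximizer \<open>g\<close> and \<open>D(x, y) = d(x)^(k - 1) + d(y)^(k - 1)\<close>. If \<open>d\<close> takes
  finitely many values, averaging \<open>g\<close> over the blocks of equal degree preserves the degrees, so strict
  concavity of the entropy makes \<open>g\<close> constant on the blocks. Hence it suffices that the distribution of \<open>d\<close>
  has at most eight points in its support.

  If \<open>g\<close> has values in \<open>{0, 1}\<close> on a set of positive measure, the infinite slope of \<open>S\<close> there pays for any
  first-order correction, so \<open>tk\<close> cannot be increased at fixed \<open>t1\<close>. Thus \<open>g\<close> is a threshold function of \<open>D\<close>,
  and shifting mass inside two pairs of degree classes, for which \<open>t1\<close> is linear and \<open>tk\<close> strictly convex,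
  excludes eight degrees.

  Otherwise \<open>g = 1 / (1 + exp (- A))\<close> with \<open>A = \<alpha> + \<beta> D\<close> and \<open>\<beta> > 0\<close>. Changing the masses of the degree classes
  by a signed density \<open>v\<close> gives a second variation of the Lagrangian of at least half of \<open>\<integral>\<integral> v v ln (1 + exp A)\<close>.
  This kernel is \<open>ln (1 + X Y)\<close> with \<open>X = exp (\<alpha> / 2 + \<beta> d(x)^(k - 1))\<close>, which is sign regular: on any nine
  distinct points it is positive on a five-dimensional space, whatever \<open>\<alpha>\<close> and \<open>\<beta>\<close>, and that leaves room for
  the four linear constraints on \<open>v\<close>. Uniformity in \<open>\<tau>\<close> comes from this scale invariance.
\<close>

section \<open>Powers and entropy\<close>

text \<open>The obstacle is that variations meet the constraints only approximately, and that
  \<open>S\<close> has no derivative where \<open>g\<close> is 0 or 1. Both are handled by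
  \<open>maximizer_penalty\<close>: if \<open>t1 ^ k < tk\<close>, a competitor whose excess in
  \<open>tk\<close> dominates its error in \<open>t1\<close> can be repaired at an entropy cost
  linear in that excess. The condition is one-sided, so convexity of the power helps: a perturbation
  that is neutral to first order does not lower \<open>tk\<close>. At equality in Jensen's
  inequality \<open>t1 ^ k \<le> tk\<close> there is no room for repair, but the degree is constant.
  The kernel arises because \<open>ln (1 + exp t)\<close> is the convex conjugate of
  \<open>- S\<close>, so that entropy plus multiplier terms collapse to it. The counts:
  \<open>2 * 4 + 1\<close> nodes carry \<open>4 + 1\<close> positive directions, one more than the
  four constraints, namely total mass, first-order \<open>t1\<close>, first-order \<open>tk\<close>
  and first-order entropy. In the zero-one case three degrees on either side of the diagonal
  threshold and one on it give seven. The support may a priori be infinite, so degrees are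
  represented by small neighbourhoods, and every strict inequality must survive that
  blurring.\<close>

lemma power_above_tangent:
  fixes a b :: real
  assumes "0 \<le> a" "0 \<le> b"
  shows "a ^ k + real k * a ^ (k - 1) * (b - a) \<le> b ^ k"
proof (induction k)
  case 0
  then show ?case by simp
next
  case (Suc k)
  show ?case
  proof (cases k)
    case 0
    then show ?thesis by simp
  next
    case (Suc j)
    have "0 \<le> (b - a) * (b ^ k - a ^ k)"
    proof (cases "a \<le> b")
      case True
      then show ?thesis using assms by (intro mult_nonneg_nonneg) (auto intro: power_mono)
    next
      case False
      then show ?thesis using assms by (intro mult_nonpos_nonpos) (auto intro: power_mono)
    qed
    moreover have "a * (a ^ k + real k * a ^ (k - 1) * (b - a)) \<le> a * b ^ k"
      using Suc.IH assms by (intro mult_left_mono) auto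
    ultimately show ?thesis using Suc by (simp add: algebra_simps)
  qed
qed

lemma power_above_tangent_strict:
  fixes a b :: real
  assumes "0 \<le> a" "0 \<le> b" "a \<noteq> b" "2 \<le> k"
  shows "a ^ k + real k * a ^ (k - 1) * (b - a) < b ^ k"
proof -
  obtain j where k: "k = Suc j" and j: "1 \<le> j" using assms(4) by (cases k) auto
  have "0 < (b - a) * (b ^ j - a ^ j)"
  proof (cases "a < b")
    case True
    then show ?thesis using assms j by (intro mult_pos_pos) (auto intro: power_strict_mono)
  next
    case False
    then have "b < a" using assms by auto
    then show ?thesis using assms j by (intro mult_neg_neg) (auto intro: power_strict_mono)
  qed
  moreover have "a * (a ^ j + real j * a ^ (j - 1) * (b - a)) \<le> a * b ^ j"
    using power_above_tangent[of a b j] assms by (intro mult_left_mono) auto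
  ultimately show ?thesis using k j by (cases j) (auto simp: algebra_simps)
qed

lemma power_lipschitz_unit:
  fixes a b :: real
  assumes "\<bar>a\<bar> \<le> 1" "\<bar>b\<bar> \<le> 1"
  shows "\<bar>a ^ k - b ^ k\<bar> \<le> real k * \<bar>a - b\<bar>"
proof (induction k)
  case 0
  then show ?case by simp
next
  case (Suc k)
  have "a ^ Suc k - b ^ Suc k = a * (a ^ k - b ^ k) + (a - b) * b ^ k"
    by (simp add: algebra_simps)
  then have "\<bar>a ^ Suc k - b ^ Suc k\<bar> \<le> \<bar>a\<bar> * \<bar>a ^ k - b ^ k\<bar> + \<bar>a - b\<bar> * \<bar>b ^ k\<bar>"
    by (metis abs_mult abs_triangle_ineq)
  also have "\<dots> \<le> 1 * \<bar>a ^ k - b ^ k\<bar> + \<bar>a - b\<bar> * 1"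
    using assms by (intro add_mono mult_mono) (auto simp: power_abs power_le_one)
  also have "\<dots> \<le> real (Suc k) * \<bar>a - b\<bar>"
    using Suc by (simp add: algebra_simps)
  finally show ?case .
qed

text \<open>The constant must be uniform in \<open>d\<close> and \<open>h\<close>, because both will
  be functions of the vertex and the estimate is integrated. In the induction the remainder for
  \<open>Suc k\<close> is \<open>d + h\<close> times the one for \<open>k\<close>, plus a quadratic
  term.\<close>

lemma power_taylor2:
  "\<exists>C\<ge>0. \<forall>d h :: real. \<bar>d\<bar> \<le> 1 \<longrightarrow> \<bar>h\<bar> \<le> 1 \<longrightarrow>
     \<bar>(d + h) ^ k - d ^ k - real k * d ^ (k - 1) * h\<bar> \<le> C * h\<^sup>2"
proof (induction k)
  case 0
  then show ?case by (auto intro!: exI[of _ 0])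
next
  case (Suc k)
  then obtain C where C: "C \<ge> 0" and *: "\<And>d h :: real. \<bar>d\<bar> \<le> 1 \<Longrightarrow> \<bar>h\<bar> \<le> 1 \<Longrightarrow>
     \<bar>(d + h) ^ k - d ^ k - real k * d ^ (k - 1) * h\<bar> \<le> C * h\<^sup>2" by auto
  show ?case
  proof (intro exI[of _ "2 * C + real k"] conjI allI impI)
    fix d h :: real assume d: "\<bar>d\<bar> \<le> 1" and h: "\<bar>h\<bar> \<le> 1"
    let ?r = "(d + h) ^ k - d ^ k - real k * d ^ (k - 1) * h"
    have "real k * (d * d ^ (k - 1)) = real k * d ^ k" by (cases k) auto
    then have "(d + h) ^ Suc k - d ^ Suc k - real (Suc k) * d ^ (Suc k - 1) * h =
        (d + h) * ?r + real k * d ^ (k - 1) * h\<^sup>2"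
      by (simp add: algebra_simps power2_eq_square)
    also have "\<bar>\<dots>\<bar> \<le> \<bar>d + h\<bar> * \<bar>?r\<bar> + real k * \<bar>d ^ (k - 1)\<bar> * h\<^sup>2"
      by (rule order_trans[OF abs_triangle_ineq]) (simp add: abs_mult)
    also have "\<dots> \<le> 2 * (C * h\<^sup>2) + real k * 1 * h\<^sup>2"
      using d h *[OF d h] by (intro add_mono mult_mono) (auto simp: power_abs power_le_one)
    finally show "\<bar>(d + h) ^ Suc k - d ^ Suc k - real (Suc k) * d ^ (Suc k - 1) * h\<bar> \<le> (2 * C + real k) * h\<^sup>2"
      by (simp add: algebra_simps)
  qed (use C in auto)
qed

lemma power_taylor3:
  "\<exists>C\<ge>0. \<forall>d h :: real. \<bar>d\<bar> \<le> 1 \<longrightarrow> \<bar>h\<bar> \<le> 1 \<longrightarrow>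
     \<bar>(d + h) ^ k - d ^ k - real k * d ^ (k - 1) * h - real k * real (k - 1) / 2 * d ^ (k - 2) * h\<^sup>2\<bar> \<le> C * \<bar>h\<bar> ^ 3"
proof (induction k)
  case 0
  then show ?case by (auto intro!: exI[of _ 0])
next
  case (Suc k)
  then obtain C where C: "C \<ge> 0" and *: "\<And>d h :: real. \<bar>d\<bar> \<le> 1 \<Longrightarrow> \<bar>h\<bar> \<le> 1 \<Longrightarrow>
     \<bar>(d + h) ^ k - d ^ k - real k * d ^ (k - 1) * h - real k * real (k - 1) / 2 * d ^ (k - 2) * h\<^sup>2\<bar> \<le> C * \<bar>h\<bar> ^ 3" by auto
  show ?case
  proof (intro exI[of _ "2 * C + real k * real (k - 1) / 2"] conjI allI impI)
    fix d h :: real assume d: "\<bar>d\<bar> \<le> 1" and h: "\<bar>h\<bar> \<le> 1"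
    let ?r = "(d + h) ^ k - d ^ k - real k * d ^ (k - 1) * h - real k * real (k - 1) / 2 * d ^ (k - 2) * h\<^sup>2"
    let ?c = "real k * real (k - 1) / 2"
    \<comment> \<open>Truncated exponents: the powers alone disagree for \<open>k = 0\<close> here,
      and for \<open>k \<le> 1\<close> in the next fact, but exactly then the coefficient
      vanishes.\<close>
    have 1: "real k * (d * d ^ (k - 1)) = real k * d ^ k" by (cases k) auto
    have 2: "?c * (d * d ^ (k - 2)) = ?c * d ^ (k - 1)"
      by (cases k; cases "k - 1") auto
    have 3: "real k + ?c = real (Suc k) * real (Suc k - 1) / 2"
      by (cases k) (auto simp: field_simps)
    have "(d + h) ^ Suc k = (d + h) * (d ^ k + real k * d ^ (k - 1) * h + ?c * d ^ (k - 2) * h\<^sup>2 + ?r)"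
      by simp
    also have "\<dots> = (d + h) * ?r + d ^ Suc k + (real k * (d * d ^ (k - 1)) + d ^ k) * h
        + (?c * (d * d ^ (k - 2)) + real k * d ^ (k - 1)) * h\<^sup>2 + ?c * d ^ (k - 2) * h ^ 3"
      by (simp add: algebra_simps power2_eq_square power3_eq_cube)
    also have "\<dots> = (d + h) * ?r + d ^ Suc k + real (Suc k) * d ^ k * h
        + real (Suc k) * real (Suc k - 1) / 2 * d ^ (k - 1) * h\<^sup>2 + ?c * d ^ (k - 2) * h ^ 3"
      unfolding 1 2 3[symmetric] by (simp add: algebra_simps)
    finally have "(d + h) ^ Suc k - d ^ Suc k - real (Suc k) * d ^ (Suc k - 1) * h
        - real (Suc k) * real (Suc k - 1) / 2 * d ^ (Suc k - 2) * h\<^sup>2 = (d + h) * ?r + ?c * d ^ (k - 2) * h ^ 3"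
      by (simp add: numeral_2_eq_2)
    also have "\<bar>\<dots>\<bar> \<le> \<bar>d + h\<bar> * \<bar>?r\<bar> + ?c * \<bar>d ^ (k - 2)\<bar> * \<bar>h\<bar> ^ 3"
      by (rule order_trans[OF abs_triangle_ineq]) (simp add: abs_mult power_abs)
    also have "\<dots> \<le> 2 * (C * \<bar>h\<bar> ^ 3) + ?c * 1 * \<bar>h\<bar> ^ 3"
      using d h *[OF d h] abs_triangle_ineq[of d h]
      by (intro add_mono mult_mono) (auto simp: power_abs power_le_one simp del: abs_triangle_ineq)
    finally show "\<bar>(d + h) ^ Suc k - d ^ Suc k - real (Suc k) * d ^ (Suc k - 1) * h
        - real (Suc k) * real (Suc k - 1) / 2 * d ^ (Suc k - 2) * h\<^sup>2\<bar> \<le> (2 * C + ?c) * \<bar>h\<bar> ^ 3"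
      by (simp add: algebra_simps)
  qed (use C in auto)
qed

section \<open>Entropy of a single edge probability\<close>

lemma S_ent_0 [simp]: "S_ent 0 = 0" and S_ent_1 [simp]: "S_ent 1 = 0"
  by (simp_all add: S_ent_def)

lemma S_ent_reflect: "S_ent (1 - w) = S_ent w"
  by (simp add: S_ent_def algebra_simps)

lemma S_ent_measurable [measurable]: "S_ent \<in> borel_measurable borel"
  unfolding S_ent_def[abs_def] by measurable

text \<open>Gibbs' inequality: the right-hand side is the tangent of \<open>S_ent\<close> at
  \<open>c\<close>, and the difference is a relative entropy. It serves in place of derivatives of
  \<open>S_ent\<close>, since \<open>w\<close> may be 0 or 1, where the slope is infinite.\<close>

lemma S_ent_gibbs_strict:
  assumes "0 \<le> w" "w \<le> 1" "0 < c" "c < 1" "w \<noteq> c"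
  shows "S_ent w < - w * ln c - (1 - w) * ln (1 - c)"
proof -
  \<comment> \<open>This is \<open>ln t \<le> t - 1\<close> at \<open>t = v / u\<close>. The linear
    terms \<open>v - u\<close> for \<open>w\<close> and for \<open>1 - w\<close> cancel.\<close>
  have key: "u * ln v \<le> u * ln u + (v - u) \<and> (u \<noteq> v \<longrightarrow> u * ln v < u * ln u + (v - u))"
    if "0 \<le> u" "0 < v" for u v :: real
  proof (cases "u = 0")
    case True then show ?thesis using that by auto
  next
    case False
    then have u: "0 < u" using that by auto
    have le: "ln (v / u) \<le> v / u - 1" using u that by (intro ln_le_minus_one) auto
    have lt: "ln (v / u) < v / u - 1" if "u \<noteq> v"
      using ln_eq_minus_one[of "v / u"] le u \<open>0 < v\<close> that by fastforce
    have eq: "u * (ln v - ln u) = u * ln (v / u)" "u * (v / u - 1) = v - u"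
      using u that by (auto simp: ln_div field_simps)
    show ?thesis using mult_left_mono[OF le, of u] mult_strict_left_mono[OF lt, of u] u eq
      by (auto simp: algebra_simps)
  qed
  show ?thesis unfolding S_ent_def
    using key[of w c] key[of "1 - w" "1 - c"] assms by auto
qed

lemma S_ent_gibbs:
  assumes "0 \<le> w" "w \<le> 1" "0 < c" "c < 1"
  shows "S_ent w \<le> - w * ln c - (1 - w) * ln (1 - c)"
  using S_ent_gibbs_strict[OF assms] by (cases "w = c") (auto simp: S_ent_def)

lemma S_ent_nonneg: "0 \<le> w \<Longrightarrow> w \<le> 1 \<Longrightarrow> 0 \<le> S_ent w"
proof -
  assume "0 \<le> w" "w \<le> 1"
  then have "w * ln w \<le> 0" "(1 - w) * ln (1 - w) \<le> 0"
    by (auto intro!: mult_nonneg_nonpos simp: ln_le_zero_iff[symmetric])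
       (metis diff_ge_0_iff_ge ln_le_zero_iff diff_le_self le_less ln_0 order_refl less_numeral_extra(1) diff_left_mono diff_zero)+
  then show ?thesis by (simp add: S_ent_def)
qed

lemma S_ent_le_1: "0 \<le> w \<Longrightarrow> w \<le> 1 \<Longrightarrow> S_ent w \<le> 1"
proof -
  assume "0 \<le> w" "w \<le> 1"
  then have "S_ent w \<le> - w * ln (1/2) - (1 - w) * ln (1/2)"
    using S_ent_gibbs[of w "1/2"] by auto
  also have "\<dots> = ln 2" by (simp add: ln_div algebra_simps)
  also have "\<dots> \<le> 1" using ln_2_less_1 by simp
  finally show ?thesis .
qed

lemma S_ent_concave:
  assumes "0 \<le> u" "u \<le> 1" "0 \<le> v" "v \<le> 1" "0 \<le> t" "t \<le> 1"
  shows "(1 - t) * S_ent u + t * S_ent v \<le> S_ent ((1 - t) * u + t * v)"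
proof -
  let ?c = "(1 - t) * u + t * v"
  have c: "0 \<le> ?c" "?c \<le> 1"
    using assms convex_bound_le[of u 1 v "1 - t" t] by (auto intro: add_nonneg_nonneg)
  \<comment> \<open>At the ends there is no tangent, but a convex combination equals 0 or 1 only if
    every point with positive weight does.\<close>
  consider "?c = 0" | "?c = 1" | "0 < ?c" "?c < 1" using c by linarith
  then show ?thesis
  proof cases
    case 1
    then have "(1 - t) * u = 0" "t * v = 0"
      using assms by (simp_all add: add_nonneg_eq_0_iff)
    then show ?thesis by auto
  next
    case 2
    then have "(1 - t) * (1 - u) + t * (1 - v) = 0" by (simp add: algebra_simps)
    then have "(1 - t) * (1 - u) = 0 \<and> t * (1 - v) = 0"
      using assms by (subst (asm) add_nonneg_eq_0_iff) auto
    then show ?thesis by auto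
  next
    case 3
    have "(1 - t) * S_ent u + t * S_ent v \<le>
       (1 - t) * (- u * ln ?c - (1 - u) * ln (1 - ?c)) + t * (- v * ln ?c - (1 - v) * ln (1 - ?c))"
      using assms 3 by (intro add_mono mult_left_mono S_ent_gibbs) auto
    also have "\<dots> = S_ent ?c" unfolding S_ent_def by (simp add: algebra_simps)
    finally show ?thesis .
  qed
qed

text \<open>Quantifies the infinite slope at 0; all gains of order \<open>e * ln (1 / e)\<close>
  come from here.\<close>

lemma S_ent_ge_xlogx: "0 < w \<Longrightarrow> w \<le> 1 \<Longrightarrow> w * ln (1 / w) \<le> S_ent w"
proof -
  assume "0 < w" "w \<le> 1"
  then have "(1 - w) * ln (1 - w) \<le> 0"
    by (cases "w = 1") (auto intro!: mult_nonneg_nonpos)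
  then show ?thesis using \<open>0 < w\<close> by (simp add: S_ent_def ln_div)
qed

text \<open>Concavity at \<open>w + h\<close> bounds \<open>S (w + h)\<close> from below by \<open>S w + h * S' (w + h)\<close>, and \<open>ln\<close> is
  Lipschitz at distance \<open>h \<le> w / 2\<close> from \<open>w\<close>.\<close>

lemma S_ent_taylor_lower:
  assumes w: "0 < w" "w < 1" and h: "\<bar>h\<bar> \<le> w / 2" "\<bar>h\<bar> \<le> (1 - w) / 2"
  shows "S_ent w + h * ln ((1 - w) / w) - 2 * h\<^sup>2 / (w * (1 - w)) \<le> S_ent (w + h)"
proof -
  have key: "s * (ln (u + s) - ln u) \<le> 2 * s\<^sup>2 / u" if "0 < u" "\<bar>s\<bar> \<le> u / 2" for u s :: real
  proof -
    have us: "0 < u + s" using that by (auto simp: abs_le_iff)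
    show ?thesis
    proof (cases "0 \<le> s")
      case True
      have "ln (u + s) - ln u = ln ((u + s) / u)" using us that by (simp add: ln_div)
      also have "\<dots> \<le> (u + s) / u - 1" using us that by (intro ln_le_minus_one) auto
      also have "\<dots> = s / u" using that by (simp add: field_simps)
      finally have "s * (ln (u + s) - ln u) \<le> s * (s / u)" using True by (rule mult_left_mono)
      also have "\<dots> \<le> 2 * s\<^sup>2 / u" using that by (simp add: power2_eq_square divide_right_mono)
      finally show ?thesis .
    next
      case False
      have "ln u - ln (u + s) = ln (u / (u + s))" using us that by (simp add: ln_div)
      also have "\<dots> \<le> u / (u + s) - 1" using us that by (intro ln_le_minus_one) auto
      also have "\<dots> = - s / (u + s)" using us by (simp add: field_simps)
      also have "\<dots> \<le> - s / (u / 2)" using that False us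
        by (intro divide_left_mono mult_pos_pos) (auto simp: abs_le_iff)
      finally have "- s * (ln u - ln (u + s)) \<le> - s * (- s / (u / 2))" using False by (intro mult_left_mono) auto
      also have "\<dots> = 2 * s\<^sup>2 / u" using that by (simp add: power2_eq_square)
      finally show ?thesis by (simp add: algebra_simps)
    qed
  qed
  have split: "2 * h\<^sup>2 / w + 2 * h\<^sup>2 / (1 - w) = 2 * h\<^sup>2 / (w * (1 - w))"
    using w by (simp add: field_simps)
  have wh: "0 < w + h" "w + h < 1" using assms by (auto simp: abs_le_iff)
  have "S_ent w \<le> - w * ln (w + h) - (1 - w) * ln (1 - (w + h))"
    using S_ent_gibbs[of w "w + h"] wh w by auto
  also have "\<dots> = S_ent (w + h) - h * ln ((1 - w) / w) + h * (ln (w + h) - ln w) + (- h) * (ln ((1 - w) + (- h)) - ln (1 - w))"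
    using w by (simp add: S_ent_def ln_div algebra_simps)
  also have "\<dots> \<le> S_ent (w + h) - h * ln ((1 - w) / w) + 2 * h\<^sup>2 / w + 2 * h\<^sup>2 / (1 - w)"
    using key[of w h] key[of "1 - w" "- h"] assms by auto
  finally show ?thesis using split by linarith
qed

text \<open>Since \<open>S'(w) = ln ((1 - w) / w) = - t\<close> at the logistic value,
  \<open>w\<close> maximizes \<open>S w + t * w\<close>, and the right-hand side is the value of the
  conjugate. This turns the Lagrangian of the second variation into the kernel
  \<open>ln (1 + exp A)\<close>.\<close>

lemma S_ent_logistic:
  assumes "w = 1 / (1 + exp (- t))"
  shows "S_ent w + t * w = ln (1 + exp t)"
proof -
  have p: "0 < 1 + exp (- t)" "0 < 1 + exp t" by (auto intro: add_pos_pos)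
  have 1: "1 - w = 1 / (1 + exp t)"
    using p unfolding assms by (simp add: field_simps exp_minus)
  have "ln w = - ln (1 + exp (- t))" using p by (simp add: assms ln_div)
  moreover have "1 + exp (- t) = (1 + exp t) / exp t" by (simp add: field_simps exp_minus)
  ultimately have 2: "ln w = t - ln (1 + exp t)" using p by (simp add: ln_div)
  have 3: "ln (1 - w) = - ln (1 + exp t)" using p by (simp add: 1 ln_div)
  show ?thesis unfolding S_ent_def 2 3 by (simp add: algebra_simps)
qed

section \<open>The kernel \<open>ln (1 + x * y)\<close>\<close>

text \<open>Elimination by induction on the number of equations: the last one is trivial or removes
  the unknown at a pivot. That \<open>c\<close> vanishes from \<open>n\<close> on will make the test
  vectors of the kernel triangular.\<close>

lemma homogeneous_system_nontrivial:
  fixes A :: "nat \<Rightarrow> nat \<Rightarrow> real"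
  assumes "m < n"
  shows "\<exists>c. (\<exists>j<n. c j \<noteq> 0) \<and> (\<forall>j\<ge>n. c j = 0) \<and> (\<forall>i<m. (\<Sum>j<n. A i j * c j) = 0)"
  using assms
proof (induction m arbitrary: A n)
  case 0
  then show ?case by (intro exI[of _ "\<lambda>j. if j < n then 1 else 0"]) auto
next
  case (Suc m)
  show ?case
  proof (cases "\<forall>j<n. A m j = 0")
    case True
    obtain c where "\<exists>j<n. c j \<noteq> 0" "\<forall>j\<ge>n. c j = 0" "\<forall>i<m. (\<Sum>j<n. A i j * c j) = 0"
      using Suc.IH[of n A] Suc.prems by auto
    moreover have "(\<Sum>j<n. A m j * c j) = 0" using True by auto
    ultimately show ?thesis by (auto simp: less_Suc_eq)
  next
    case False
    then obtain l where l: "l < n" "A m l \<noteq> 0" by auto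
    obtain n' where n: "n = Suc n'" using Suc.prems by (cases n) auto
    \<comment> \<open>\<open>\<pi>\<close> enumerates the unknowns other than the pivot \<open>l\<close>\<close>
    define \<pi> where "\<pi> j = (if j < l then j else Suc j)" for j
    have inj: "inj_on \<pi> {..<n'}" by (auto simp: inj_on_def \<pi>_def split: if_splits)
    have img: "\<pi> ` {..<n'} = {..<n} - {l}"
    proof
      show "\<pi> ` {..<n'} \<subseteq> {..<n} - {l}" using l n by (auto simp: \<pi>_def)
      show "{..<n} - {l} \<subseteq> \<pi> ` {..<n'}"
      proof
        fix j assume j: "j \<in> {..<n} - {l}"
        show "j \<in> \<pi> ` {..<n'}"
        proof (cases "j < l")
          case True then show ?thesis using l n j by (intro image_eqI[of _ _ j]) (auto simp: \<pi>_def)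
        next
          case False then show ?thesis using l n j by (intro image_eqI[of _ _ "j - 1"]) (auto simp: \<pi>_def)
        qed
      qed
    qed
    obtain c' where c': "\<exists>j<n'. c' j \<noteq> 0"
      "\<forall>i<m. (\<Sum>j<n'. (A i (\<pi> j) - A i l * A m (\<pi> j) / A m l) * c' j) = 0"
      using Suc.IH[of n' "\<lambda>i j. A i (\<pi> j) - A i l * A m (\<pi> j) / A m l"] Suc.prems n by auto
    define s where "s = (\<Sum>j<n'. A m (\<pi> j) * c' j)"
    define c where "c j = (if j = l then - s / A m l else if j < n then c' (the_inv_into {..<n'} \<pi> j) else 0)" for j
    have c\<pi>: "c (\<pi> j) = c' j" if "j < n'" for j
    proof -
      have "\<pi> j \<in> {..<n} - {l}" using img that by blast
      then show ?thesis using the_inv_into_f_f[OF inj, of j] that by (simp add: c_def)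
    qed
    have sum: "(\<Sum>j<n. A i j * c j) = (\<Sum>j<n'. A i (\<pi> j) * c' j) - A i l * s / A m l" for i
    proof -
      have "(\<Sum>j<n. A i j * c j) = A i l * c l + (\<Sum>j\<in>{..<n} - {l}. A i j * c j)"
        using l by (simp add: sum.remove)
      also have "(\<Sum>j\<in>{..<n} - {l}. A i j * c j) = (\<Sum>j<n'. A i (\<pi> j) * c (\<pi> j))"
        unfolding img[symmetric] using inj by (simp add: sum.reindex)
      also have "\<dots> = (\<Sum>j<n'. A i (\<pi> j) * c' j)" using c\<pi> by simp
      finally show ?thesis by (simp add: c_def)
    qed
    have "(\<Sum>j<n. A i j * c j) = 0" if "i < Suc m" for i
    proof (cases "i = m")
      case True then show ?thesis using l by (simp add: sum s_def)
    next
      case False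
      then have "(\<Sum>j<n'. (A i (\<pi> j) - A i l * A m (\<pi> j) / A m l) * c' j) = 0" using c'(2) that by auto
      then show ?thesis unfolding sum s_def
        by (simp add: algebra_simps sum_subtractf sum_distrib_left sum_divide_distrib)
    qed
    moreover have "\<exists>j<n. c j \<noteq> 0"
    proof -
      obtain j where j: "j < n'" "c' j \<noteq> 0" using c' by auto
      then have "\<pi> j < n" using img by blast
      then show ?thesis using c\<pi>[OF j(1)] j by metis
    qed
    moreover have "\<forall>j\<ge>n. c j = 0" using l by (auto simp: c_def)
    ultimately show ?thesis by blast
  qed
qed

text \<open>Rolle on each of the \<open>n\<close> gaps; the bound \<open>r < z n\<close> shows that
  the zero from a later gap is new. Differentiability is asked only on the half-line where
  \<open>1 + x i * y\<close> stays positive.\<close>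

lemma rolle_count:
  fixes f f' :: "real \<Rightarrow> real" and z :: "nat \<Rightarrow> real"
  assumes "\<And>y. 0 \<le> y \<Longrightarrow> (f has_real_derivative f' y) (at y)"
    and "z 0 = 0" "\<And>i. i < n \<Longrightarrow> z i < z (Suc i)" "\<And>i. i \<le> n \<Longrightarrow> f (z i) = 0"
  shows "\<exists>R. finite R \<and> card R = n \<and> (\<forall>r\<in>R. 0 < r \<and> r < z n \<and> f' r = 0)"
  using assms(3,4)
proof (induction n)
  case 0
  then show ?case by (intro exI[of _ "{}"]) auto
next
  case (Suc n)
  then obtain R where R: "finite R" "card R = n" "\<forall>r\<in>R. 0 < r \<and> r < z n \<and> f' r = 0" by auto
  have mono: "0 \<le> z i" if "i \<le> Suc n" for i
    using that
  proof (induction i)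
    case 0
    then show ?case using assms(2) by simp
  next
    case (Suc i)
    then have "z i < z (Suc i)" using Suc.prems \<open>\<And>i. i < Suc n \<Longrightarrow> z i < z (Suc i)\<close> by simp
    then show ?case using Suc by simp
  qed
  have "\<exists>r>z n. r < z (Suc n) \<and> (f has_real_derivative 0) (at r)"
  proof (rule Rolle)
    show "z n < z (Suc n)" "f (z n) = f (z (Suc n))" using Suc.prems by auto
    have d: "(f has_real_derivative f' y) (at y)" if "z n \<le> y" for y
      using assms(1) mono[of n] that by auto
    show "continuous_on {z n..z (Suc n)} f"
      using d by (intro DERIV_continuous_on) (auto intro: has_field_derivative_at_within)
    show "f differentiable (at x)" if "z n < x" "x < z (Suc n)" for x
      using d[of x] that by (auto simp: real_differentiable_def)
  qed
  then obtain r where r: "z n < r" "r < z (Suc n)" "(f has_real_derivative 0) (at r)" by auto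
  then have "f' r = 0" using assms(1)[of r] mono[of n] DERIV_unique by fastforce
  moreover have "r \<notin> R" using R(3) r(1) by fastforce
  moreover have "0 \<le> z n" "z n < z (Suc n)" using mono[of n] Suc.prems(1)[of n] by auto
  ultimately show ?case using R r
    by (intro exI[of _ "insert r R"]) fastforce
qed

text \<open>If \<open>f y = (\<Sum>i\<le>n. w i * ln (1 + x i * y))\<close> vanishes at \<open>0\<close> and at \<open>n\<close> positive points, then Rolle produces
  \<open>n\<close> positive zeros of \<open>f'\<close>, a polynomial of degree at most \<open>n\<close> over a positive denominator; these are all
  its zeros. Its sign beyond them is therefore \<open>(-1) ^ n\<close> times its sign at \<open>-1 / x n\<close>, where only the last
  summand survives.\<close>

lemma log_kernel_last_value_sign:
  fixes x w :: "nat \<Rightarrow> real"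
  assumes x0: "0 < x 0" and xm: "\<And>i. i < n \<Longrightarrow> x i < x (Suc i)"
    and w: "\<exists>i\<le>n. w i \<noteq> 0" and z: "\<And>j. j < n \<Longrightarrow> (\<Sum>i\<le>n. w i * ln (1 + x i * x j)) = 0"
  shows "0 < (- 1) ^ n * (w n * (\<Sum>i\<le>n. w i * ln (1 + x i * x n)))"
proof -
  have xlt: "x i < x j" if "i < j" "j \<le> n" for i j
    using that
  proof (induction j)
    case 0
    then show ?case by simp
  next
    case (Suc j)
    then show ?case using xm[of j] by (cases "i = j") auto
  qed
  have xpos: "0 < x i" if "i \<le> n" for i
    using xlt[of 0 i] x0 that by (cases i) auto
  define f where "f y = (\<Sum>i\<le>n. w i * ln (1 + x i * y))" for y
  \<comment> \<open>\<open>P / Q\<close> is the derivative of \<open>f\<close> over a common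
    denominator. As a polynomial, \<open>P\<close> can also be evaluated at the poles
    \<open>- 1 / x l\<close>, where \<open>f\<close> itself is singular.\<close>
  define P where "P = (\<Sum>i\<le>n. smult (w i * x i) (\<Prod>j\<in>{..n} - {i}. [:1, x j:]))"
  define Q where "Q y = (\<Prod>j\<le>n. 1 + x j * y)" for y
  have Qpos: "0 < Q y" if "0 \<le> y" for y
    unfolding Q_def
  proof (intro prod_pos)
    fix j assume "j \<in> {..n}"
    then have "0 \<le> x j * y" using xpos[of j] that by simp
    then show "0 < 1 + x j * y" by linarith
  qed
  have polyP: "poly P y = (\<Sum>i\<le>n. w i * x i * (\<Prod>j\<in>{..n} - {i}. 1 + x j * y))" for y
    by (simp add: P_def poly_sum poly_prod algebra_simps)
  have deg: "Polynomial.degree P \<le> n"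
    unfolding P_def
  proof (rule degree_sum_le)
    fix i assume "i \<in> {..n}"
    have "Polynomial.degree (\<Prod>j\<in>{..n} - {i}. [:1, x j:]) \<le> (\<Sum>j\<in>{..n} - {i}. Polynomial.degree [:1, x j:])"
      using degree_prod_sum_le[of "{..n} - {i}" "\<lambda>j. [:1, x j:]"] by (simp add: o_def)
    also have "\<dots> \<le> (\<Sum>j\<in>{..n} - {i}. 1)" by (intro sum_mono) auto
    also have "\<dots> = n" using \<open>i \<in> {..n}\<close> by simp
    finally show "Polynomial.degree (smult (w i * x i) (\<Prod>j\<in>{..n} - {i}. [:1, x j:])) \<le> n"
      using degree_smult_le order_trans by blast
  qed auto
  have df: "(f has_real_derivative poly P y / Q y) (at y)" if "0 \<le> y" for y
  proof -
    have pos: "0 < 1 + x i * y" if "i \<le> n" for i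
      using mult_nonneg_nonneg[of "x i" y] xpos[OF that] \<open>0 \<le> y\<close> by linarith
    have "(f has_real_derivative (\<Sum>i\<le>n. w i * (x i / (1 + x i * y)))) (at y)"
      unfolding f_def using pos
      by (intro DERIV_sum derivative_eq_intros) (auto intro!: derivative_eq_intros simp: field_simps)
    also have "(\<Sum>i\<le>n. w i * (x i / (1 + x i * y))) = poly P y / Q y"
      unfolding polyP sum_divide_distrib
    proof (intro sum.cong refl)
      fix i assume i: "i \<in> {..n}"
      have "Q y = (1 + x i * y) * (\<Prod>j\<in>{..n} - {i}. 1 + x j * y)"
        unfolding Q_def using i by (simp add: prod.remove)
      moreover have "(\<Prod>j\<in>{..n} - {i}. 1 + x j * y) \<noteq> 0" using pos by (auto simp: less_imp_neq[symmetric])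
      ultimately show "w i * (x i / (1 + x i * y)) = w i * x i * (\<Prod>j\<in>{..n} - {i}. 1 + x j * y) / Q y"
        using pos[of i] i by simp
    qed
    finally show ?thesis .
  qed
  \<comment> \<open>The zero at 0, from \<open>ln 1 = 0\<close>, is put before the \<open>n\<close>
    given ones; the resulting \<open>n + 1\<close> zeros have \<open>n\<close> gaps.
    \<open>z (Suc n) = x n\<close> is the point whose sign is wanted.\<close>
  define z where "z i = (case i of 0 \<Rightarrow> 0 | Suc j \<Rightarrow> x j)" for i
  have "\<exists>R. finite R \<and> card R = n \<and> (\<forall>r\<in>R. 0 < r \<and> r < z n \<and> poly P r / Q r = 0)"
  proof (rule rolle_count[OF df])
    show "z 0 = 0" by (simp add: z_def)
    show "z i < z (Suc i)" if "i < n" for i using that x0 xm by (auto simp: z_def split: nat.splits)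
    show "f (z i) = 0" if "i \<le> n" for i using that assms(4) by (auto simp: z_def f_def split: nat.splits)
  qed
  then obtain R where R: "finite R" "card R = n" and R0: "\<And>r. r \<in> R \<Longrightarrow> 0 < r \<and> r < z n \<and> poly P r = 0"
    using Qpos by (metis divide_eq_0_iff less_imp_le less_irrefl)
  \<comment> \<open>At \<open>- 1 / x l\<close> every summand except the one for \<open>l\<close>
    contains the factor \<open>1 + x l * (- 1 / x l) = 0\<close>. This gives both
    \<open>P \<noteq> 0\<close> and the sign of \<open>P\<close> at \<open>y0\<close>.\<close>
  have at_node: "poly P (- 1 / x l) = w l * x l * (\<Prod>j\<in>{..n} - {l}. 1 - x j / x l)" if "l \<le> n" for l
  proof -
    have "poly P (- 1 / x l) = (\<Sum>i\<in>{l}. w i * x i * (\<Prod>j\<in>{..n} - {i}. 1 + x j * (- 1 / x l)))"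
      unfolding polyP
    proof (rule sum.mono_neutral_right)
      show "\<forall>i\<in>{..n} - {l}. w i * x i * (\<Prod>j\<in>{..n} - {i}. 1 + x j * (- 1 / x l)) = 0"
        using that xpos[OF that] by (auto intro!: prod_zero bexI[of _ l])
    qed (use that in auto)
    then show ?thesis by simp
  qed
  have "P \<noteq> 0"
  proof
    assume "P = 0"
    obtain l where l: "l \<le> n" "w l \<noteq> 0" using w by auto
    have "(\<Prod>j\<in>{..n} - {l}. 1 - x j / x l) = 0" using at_node[OF l(1)] \<open>P = 0\<close> l xpos[OF l(1)] by simp
    then obtain j where j: "j \<in> {..n} - {l}" "1 - x j / x l = 0"
      by (subst (asm) prod_zero_iff) auto
    then have "x j = x l" using xpos[OF l(1)] by simp
    moreover have "j < l \<or> l < j" using j by auto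
    ultimately show False using xlt[of j l] xlt[of l j] l j(1) by force
  qed
  define y0 where "y0 = - 1 / x n"
  have y0: "y0 < 0" using xpos[of n] by (simp add: y0_def)
  \<comment> \<open>The polynomial with roots \<open>R\<close> and the right value at
    \<open>y0\<close>. It agrees with \<open>P\<close> at \<open>n + 1\<close> points, and both have
    degree at most \<open>n\<close>.\<close>
  define q where "q = smult (poly P y0 / (\<Prod>r\<in>R. y0 - r)) (\<Prod>r\<in>R. [:- r, 1:])"
  have nz: "(\<Prod>r\<in>R. y0 - r) \<noteq> 0"
  proof -
    have "y0 - r \<noteq> 0" if "r \<in> R" for r using R0[OF that] y0 by linarith
    then show ?thesis using R by (simp add: prod_zero_iff)
  qed
  have "P = q"
  proof (rule poly_eqI_degree[of "insert y0 R"])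
    have y0R: "y0 \<notin> R" using R0 y0 by force
    show "poly P r = poly q r" if "r \<in> insert y0 R" for r
      using that R R0 nz by (auto simp: q_def poly_prod prod_zero_iff)
    show "card (insert y0 R) > Polynomial.degree P" using R deg y0R by simp
    have "Polynomial.degree (\<Prod>r\<in>R. [:- r, 1:]) \<le> (\<Sum>r\<in>R. Polynomial.degree [:- r, 1::real:])"
      using degree_prod_sum_le[of R "\<lambda>r. [:- r, 1:]"] R by (simp add: o_def)
    also have "\<dots> = n" using R by simp
    finally show "card (insert y0 R) > Polynomial.degree q"
      using R y0R degree_smult_le[of _ "\<Prod>r\<in>R. [:- r, 1:]"] unfolding q_def
      by (simp add: le_imp_less_Suc order_trans)
  qed
  then have Pq: "poly P y * (\<Prod>r\<in>R. y0 - r) = poly P y0 * (\<Prod>r\<in>R. y - r)" for y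
  proof -
    have "poly q y * (\<Prod>r\<in>R. y0 - r) = poly P y0 * (\<Prod>r\<in>R. y - r)"
      using nz by (simp add: q_def poly_prod)
    then show ?thesis using arg_cong[OF \<open>P = q\<close>, of "\<lambda>p. poly p y"] by (simp only:)
  qed
  have signprod: "(\<Prod>r\<in>R. y0 - r) = (- 1) ^ n * (\<Prod>r\<in>R. r - y0)"
  proof -
    have "(\<Prod>r\<in>R. y0 - r) = (\<Prod>r\<in>R. (- 1) * (r - y0))" by (intro prod.cong) auto
    also have "\<dots> = (- 1) ^ n * (\<Prod>r\<in>R. r - y0)" unfolding prod.distrib using R by simp
    finally show ?thesis .
  qed
  have "z n < z (Suc n)" using x0 xm by (auto simp: z_def split: nat.splits)
  moreover have zn: "0 \<le> z n" using xpos by (auto simp: z_def less_imp_le split: nat.splits)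
  \<comment> \<open>The mean value theorem from the last zero \<open>z n\<close> to
    \<open>x n\<close> reduces the sign of \<open>f (x n)\<close> to that of \<open>P\<close> at
    \<open>\<xi>\<close>, which lies beyond all roots in \<open>R\<close>.\<close>
  ultimately obtain \<xi> where \<xi>: "z n < \<xi>" "\<xi> < z (Suc n)" "f (z (Suc n)) - f (z n) = (z (Suc n) - z n) * (poly P \<xi> / Q \<xi>)"
    using MVT2[of "z n" "z (Suc n)" f "\<lambda>y. poly P y / Q y"] df by auto
  have fz: "f (z n) = 0" using assms(4) by (auto simp: z_def f_def split: nat.splits)
  have A: "0 < (\<Prod>r\<in>R. r - y0)" "0 < (\<Prod>r\<in>R. \<xi> - r)"
    by (intro prod_pos; use R0 y0 \<xi> in force)+
  have "poly P y0 \<noteq> 0" 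
  proof
    assume "poly P y0 = 0"
    then have "q = 0" unfolding q_def by simp
    then show False using \<open>P \<noteq> 0\<close> \<open>P = q\<close> by simp
  qed
  have pp: "0 < (\<Prod>j\<in>{..n} - {n}. 1 - x j / x n)"
    using xpos xlt[of _ n] by (intro prod_pos) auto
  have Py0: "poly P y0 = w n * (x n * (\<Prod>j\<in>{..n} - {n}. 1 - x j / x n))"
    unfolding y0_def using at_node[of n] by simp
  have wn: "w n \<noteq> 0" using Py0 \<open>poly P y0 \<noteq> 0\<close> by auto
  define K where "K = x n * (\<Prod>j\<in>{..n} - {n}. 1 - x j / x n) * (\<Prod>r\<in>R. \<xi> - r) / (\<Prod>r\<in>R. r - y0)"
  have K: "0 < K" unfolding K_def using pp A xpos[of n] by auto
  have "(- 1) ^ n * poly P \<xi> * (\<Prod>r\<in>R. r - y0) = w n * (x n * (\<Prod>j\<in>{..n} - {n}. 1 - x j / x n)) * (\<Prod>r\<in>R. \<xi> - r)"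
    using Pq[of \<xi>] unfolding signprod Py0 by (simp add: algebra_simps)
  then have "(- 1) ^ n * poly P \<xi> = w n * K" using A unfolding K_def by (simp add: field_simps)
  moreover have "(- 1) ^ n * (w n * f (x n)) = (z (Suc n) - z n) / Q \<xi> * w n * ((- 1) ^ n * poly P \<xi>)"
    using \<xi>(3) fz by (simp add: z_def)
  ultimately have "(- 1) ^ n * (w n * f (x n)) = (z (Suc n) - z n) / Q \<xi> * K * (w n)\<^sup>2"
    by (simp add: power2_eq_square)
  also have "\<dots> > 0" using K wn \<open>z n < z (Suc n)\<close> Qpos[of \<xi>] zn \<xi> by auto
  finally show ?thesis by (simp add: f_def)
qed

text \<open>\<open>W j\<close> lives on the nodes \<open>0, ..., 2 * j\<close>, and its image under
  the kernel vanishes at the nodes below \<open>2 * j\<close>. Hence different \<open>W j\<close>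
  are orthogonal for the kernel form, and \<open>B j j\<close> is a single product whose sign is
  \<open>(- 1) ^ (2 * j)\<close>. Only even top indices give the positive sign, which is why
  \<open>2 * m + 1\<close> nodes yield \<open>m + 1\<close> directions.\<close>

lemma log_kernel_positive_subspace:
  fixes x :: "nat \<Rightarrow> real"
  assumes x0: "0 < x 0" and xm: "\<And>i. i < 2 * m \<Longrightarrow> x i < x (Suc i)"
  shows "\<exists>(W :: nat \<Rightarrow> nat \<Rightarrow> real) q. 0 < q \<and> (\<forall>c :: nat \<Rightarrow> real.
     q * (\<Sum>j\<le>m. (c j)\<^sup>2) \<le> (\<Sum>i\<le>2*m. \<Sum>l\<le>2*m. (\<Sum>j\<le>m. c j * W j i) * (\<Sum>j\<le>m. c j * W j l) * ln (1 + x i * x l)))"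
proof -
  let ?k = "\<lambda>i l. ln (1 + x i * x l)"
  have "\<exists>w. (\<exists>i\<le>2*j. w i \<noteq> 0) \<and> (\<forall>i>2*j. w i = 0) \<and> (\<forall>l<2*j. (\<Sum>i\<le>2*j. w i * ?k i l) = 0)" for j
  proof -
    obtain w :: "nat \<Rightarrow> real" where w: "\<exists>i<Suc (2*j). w i \<noteq> 0" "\<forall>i\<ge>Suc (2*j). w i = 0"
      "\<forall>l<2*j. (\<Sum>i<Suc (2*j). ?k i l * w i) = 0"
      using homogeneous_system_nontrivial[of "2*j" "Suc (2*j)" "\<lambda>l i. ?k i l"] by auto
    have "(\<Sum>i\<le>2*j. w i * ?k i l) = (\<Sum>i<Suc (2*j). ?k i l * w i)" for l
      unfolding lessThan_Suc_atMost by (intro sum.cong refl) (rule mult.commute)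
    then show ?thesis using w by (intro exI[of _ w]) (auto simp: less_Suc_eq_le Suc_le_eq)
  qed
  then have "\<exists>W. \<forall>j. (\<exists>i\<le>2*j. W j i \<noteq> 0) \<and> (\<forall>i>2*j. W j i = 0) \<and> (\<forall>l<2*j. (\<Sum>i\<le>2*j. W j i * ?k i l) = 0)"
    by (intro choice allI)
  then obtain W :: "nat \<Rightarrow> nat \<Rightarrow> real" where W: "\<And>j. \<exists>i\<le>2*j. W j i \<noteq> 0" "\<And>j i. i > 2*j \<Longrightarrow> W j i = 0"
    "\<And>j l. l < 2*j \<Longrightarrow> (\<Sum>i\<le>2*j. W j i * ?k i l) = 0" by blast
  define F where "F j l = (\<Sum>i\<le>2*m. W j i * ?k i l)" for j l
  have F: "F j l = (\<Sum>i\<le>2*j. W j i * ?k i l)" if "j \<le> m" for j l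
    unfolding F_def using that W(2) by (intro sum.mono_neutral_right) auto
  define B where "B j j' = (\<Sum>l\<le>2*m. W j l * F j' l)" for j j'
  have Bsym: "B j j' = B j' j" for j j'
    unfolding B_def F_def sum_distrib_left
    by (subst sum.swap) (auto intro!: sum.cong simp: mult_ac)
  have B0: "B j j' = 0" if "j < j'" "j' \<le> m" for j j'
    unfolding B_def
  proof (intro sum.neutral ballI)
    fix l show "W j l * F j' l = 0"
      using W(2)[of j l] W(3)[of l j'] F[OF that(2)] that by (cases "l > 2 * j") auto
  qed
  have Bne: "B j j' = 0" if "j \<noteq> j'" "j \<le> m" "j' \<le> m" for j j'
    using B0[of j j'] B0[of j' j] Bsym[of j j'] that by (cases j j' rule: linorder_cases) auto
  have Bpos: "0 < B j j" if "j \<le> m" for j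
  proof -
    \<comment> \<open>For \<open>l < 2 * j\<close> the factor \<open>F j l\<close> vanishes, for
      \<open>l > 2 * j\<close> the factor \<open>W j l\<close> does.\<close>
    have "B j j = (\<Sum>l\<in>{2*j}. W j l * F j l)"
      unfolding B_def
    proof (rule sum.mono_neutral_right)
      show "\<forall>l\<in>{..2*m} - {2*j}. W j l * F j l = 0"
      proof
        fix l assume "l \<in> {..2*m} - {2*j}"
        then consider "l < 2*j" | "l > 2*j" by fastforce
        then show "W j l * F j l = 0" using W(2)[of j l] W(3)[of l j] F[OF that] by cases auto
      qed
    qed (use that in auto)
    then show ?thesis
      using log_kernel_last_value_sign[of x "2*j" "W j"] W(1,3) x0 xm that F[OF that] by simp
  qed
  define q where "q = Min ((\<lambda>j. B j j) ` {..m})"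
  have "0 < q" unfolding q_def using Bpos by (subst Min_gr_iff) auto
  moreover have "q * (\<Sum>j\<le>m. (c j)\<^sup>2) \<le> (\<Sum>i\<le>2*m. \<Sum>l\<le>2*m. (\<Sum>j\<le>m. c j * W j i) * (\<Sum>j\<le>m. c j * W j l) * ?k i l)"
    for c :: "nat \<Rightarrow> real"
  proof -
    have "q * (\<Sum>j\<le>m. (c j)\<^sup>2) \<le> (\<Sum>j\<le>m. (c j)\<^sup>2 * B j j)"
      unfolding sum_distrib_left
    proof (rule sum_mono)
      fix j assume "j \<in> {..m}"
      then have "q \<le> B j j" by (auto simp: q_def)
      then show "q * (c j)\<^sup>2 \<le> (c j)\<^sup>2 * B j j"
        using mult_right_mono[of q "B j j" "(c j)\<^sup>2"] by (simp add: mult.commute)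
    qed
    also have "\<dots> = (\<Sum>j\<le>m. \<Sum>j'\<le>m. c j * c j' * B j j')"
    proof (intro sum.cong refl)
      fix j assume "j \<in> {..m}"
      then show "(c j)\<^sup>2 * B j j = (\<Sum>j'\<le>m. c j * c j' * B j j')"
        using Bne by (subst sum.mono_neutral_right[where S = "{j}"]) (auto simp: power2_eq_square)
    qed
    also have "\<dots> = (\<Sum>(j,j')\<in>{..m}\<times>{..m}. \<Sum>(l,i)\<in>{..2*m}\<times>{..2*m}. (c j * W j l) * (c j' * W j' i) * ?k i l)"
      by (simp add: sum.cartesian_product[symmetric] B_def F_def sum_distrib_left mult_ac)
    also have "\<dots> = (\<Sum>(l,i)\<in>{..2*m}\<times>{..2*m}. \<Sum>(j,j')\<in>{..m}\<times>{..m}. (c j * W j l) * (c j' * W j' i) * ?k i l)"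
      unfolding case_prod_unfold by (rule sum.swap)
    also have "\<dots> = (\<Sum>l\<le>2*m. \<Sum>i\<le>2*m. (\<Sum>j\<le>m. c j * W j l) * (\<Sum>j\<le>m. c j * W j i) * ?k i l)"
      unfolding sum_product unfolding sum_distrib_right by (simp add: sum.cartesian_product[symmetric])
    also have "\<dots> = (\<Sum>l\<le>2*m. \<Sum>i\<le>2*m. (\<Sum>j\<le>m. c j * W j l) * (\<Sum>j\<le>m. c j * W j i) * ?k l i)"
      by (simp add: mult.commute)
    finally show ?thesis .
  qed
  ultimately show ?thesis by blast
qed

section \<open>Graphons on the unit square\<close>

text \<open>A probability space in place of set integrals over the line: bounded functions become
  integrable, constants integrate to themselves, and product-measure lemmas apply without
  indicators.\<close>

definition unitM :: "real measure" where
  "unitM = restrict_space lborel {0..1}"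

abbreviation squareM :: "(real \<times> real) measure" where
  "squareM \<equiv> unitM \<Otimes>\<^sub>M unitM"

lemma space_unitM [simp]: "space unitM = {0..1}"
  by (simp add: unitM_def space_restrict_space)

lemma space_squareM [simp]: "space squareM = {0..1} \<times> {0..1}"
  by (simp add: space_pair_measure)

lemma prob_space_unitM: "prob_space unitM"
  unfolding unitM_def by (intro prob_spaceI) (simp add: space_restrict_space emeasure_restrict_space)

interpretation unitM: prob_space unitM
  by (rule prob_space_unitM)

interpretation squareM: pair_prob_space unitM unitM ..

lemma squareM_eq: "squareM = restrict_space (lborel \<Otimes>\<^sub>M lborel) unit_sq"
proof (rule pair_measure_eqI)
  have S: "unit_sq \<in> sets (lborel \<Otimes>\<^sub>M lborel)" unfolding unit_sq_def by (intro pair_measureI) auto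
  show "sets squareM = sets (restrict_space (lborel \<Otimes>\<^sub>M lborel) unit_sq)"
  proof
    \<comment> \<open>Each inclusion between the two sigma-algebras is measurability of the identity
      in one direction.\<close>
    have "id \<in> restrict_space (lborel \<Otimes>\<^sub>M lborel) unit_sq \<rightarrow>\<^sub>M squareM"
    proof (rule measurable_pair)
      have 1: "fst \<in> restrict_space (lborel \<Otimes>\<^sub>M lborel) unit_sq \<rightarrow>\<^sub>M unitM"
        unfolding unitM_def by (intro measurable_restrict_space2 measurable_restrict_space1 measurable_fst)
           (auto simp: space_restrict_space space_pair_measure unit_sq_def)
      have 2: "snd \<in> restrict_space (lborel \<Otimes>\<^sub>M lborel) unit_sq \<rightarrow>\<^sub>M unitM"
        unfolding unitM_def by (intro measurable_restrict_space2 measurable_restrict_space1 measurable_snd)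
           (auto simp: space_restrict_space space_pair_measure unit_sq_def)
      show "fst \<circ> id \<in> restrict_space (lborel \<Otimes>\<^sub>M lborel) unit_sq \<rightarrow>\<^sub>M unitM"
        "snd \<circ> id \<in> restrict_space (lborel \<Otimes>\<^sub>M lborel) unit_sq \<rightarrow>\<^sub>M unitM"
        using 1 2 by simp_all
    qed
    then show "sets squareM \<subseteq> sets (restrict_space (lborel \<Otimes>\<^sub>M lborel) unit_sq)"
      using measurable_sets[of id "restrict_space (lborel \<Otimes>\<^sub>M lborel) unit_sq" squareM] sets.sets_into_space[of _ squareM]
      by (fastforce simp: space_restrict_space space_pair_measure unit_sq_def Int_absorb2)
  next
    have "fst \<in> squareM \<rightarrow>\<^sub>M lborel" "snd \<in> squareM \<rightarrow>\<^sub>M lborel"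
      unfolding unitM_def by (auto intro!: measurable_fst'' measurable_snd'' measurable_restrict_space1)
    then have "id \<in> squareM \<rightarrow>\<^sub>M lborel \<Otimes>\<^sub>M lborel"
      by (intro measurable_pair) simp_all
    then have "id \<in> squareM \<rightarrow>\<^sub>M restrict_space (lborel \<Otimes>\<^sub>M lborel) unit_sq"
      by (intro measurable_restrict_space2) (auto simp: unit_sq_def)
    then show "sets (restrict_space (lborel \<Otimes>\<^sub>M lborel) unit_sq) \<subseteq> sets squareM"
      using measurable_sets[of id squareM "restrict_space (lborel \<Otimes>\<^sub>M lborel) unit_sq"]
        sets.sets_into_space[of _ "restrict_space (lborel \<Otimes>\<^sub>M lborel) unit_sq"]
      by (fastforce simp: space_restrict_space unit_sq_def Int_absorb2)
  qed
  fix A B assume "A \<in> sets unitM" "B \<in> sets unitM"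
  then have AB: "A \<in> sets lborel" "A \<subseteq> {0..1}" "B \<in> sets lborel" "B \<subseteq> {0..1}"
    unfolding unitM_def by (auto simp: sets_restrict_space_iff)
  then show "emeasure unitM A * emeasure unitM B = emeasure (restrict_space (lborel \<Otimes>\<^sub>M lborel) unit_sq) (A \<times> B)"
    using S by (subst emeasure_restrict_space)
      (auto simp: unitM_def emeasure_restrict_space unit_sq_def lborel.emeasure_pair_measure_Times)
qed (unfold_locales)

text \<open>A class closed under all operations used below and contained in the integrable functions
  of a finite measure, so that integrability becomes a syntactic check. The bound holds everywhere
  rather than almost everywhere, so sections inherit it.\<close>

definition bm :: "'a measure \<Rightarrow> ('a \<Rightarrow> real) \<Rightarrow> bool" where
  "bm M f \<longleftrightarrow> f \<in> borel_measurable M \<and> (\<exists>C. \<forall>x\<in>space M. \<bar>f x\<bar> \<le> C)"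

lemma bmI: "f \<in> borel_measurable M \<Longrightarrow> (\<And>x. x \<in> space M \<Longrightarrow> \<bar>f x\<bar> \<le> C) \<Longrightarrow> bm M f"
  by (auto simp: bm_def)

lemma bm_measurable: "bm M f \<Longrightarrow> f \<in> borel_measurable M"
  by (auto simp: bm_def)

lemma bm_bound: assumes "bm M f" obtains C where "0 \<le> C" "\<And>x. x \<in> space M \<Longrightarrow> \<bar>f x\<bar> \<le> C"
proof -
  obtain C where "\<forall>x\<in>space M. \<bar>f x\<bar> \<le> C" using assms by (auto simp: bm_def)
  then show ?thesis by (intro that[of "max C 0"]) auto
qed

lemma bm_const: "bm M (\<lambda>x. c)"
  by (auto simp: bm_def)

lemma bm_add: assumes "bm M f" "bm M g" shows "bm M (\<lambda>x. f x + g x)"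
proof -
  obtain C D where "\<And>x. x \<in> space M \<Longrightarrow> \<bar>f x\<bar> \<le> C" "\<And>x. x \<in> space M \<Longrightarrow> \<bar>g x\<bar> \<le> D"
    using assms by (metis bm_bound)
  then show ?thesis using assms
    by (intro bmI[of _ _ "C + D"]) (auto simp: bm_def intro: order_trans[OF abs_triangle_ineq add_mono])
qed

lemma bm_mult: assumes "bm M f" "bm M g" shows "bm M (\<lambda>x. f x * g x)"
proof -
  obtain C D where "0 \<le> C" "\<And>x. x \<in> space M \<Longrightarrow> \<bar>f x\<bar> \<le> C" "\<And>x. x \<in> space M \<Longrightarrow> \<bar>g x\<bar> \<le> D"
    using assms by (metis bm_bound)
  then show ?thesis using assms
    by (intro bmI[of _ _ "C * D"]) (auto simp: bm_def abs_mult intro: mult_mono)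
qed

lemma bm_uminus: "bm M f \<Longrightarrow> bm M (\<lambda>x. - f x)"
  using bm_mult[OF bm_const[of M "- 1"]] by simp

lemma bm_diff: "bm M f \<Longrightarrow> bm M g \<Longrightarrow> bm M (\<lambda>x. f x - g x)"
  using bm_add[OF _ bm_uminus, of M f g] by simp

lemma bm_divide: "bm M f \<Longrightarrow> bm M (\<lambda>x. f x / c)"
  using bm_mult[OF _ bm_const[of M "inverse c"], of f] by (simp add: field_simps)

lemma bm_power: "bm M f \<Longrightarrow> bm M (\<lambda>x. f x ^ n)"
  by (induction n) (auto intro: bm_mult bm_const)

lemma bm_sum: "(\<And>i. i \<in> A \<Longrightarrow> bm M (f i)) \<Longrightarrow> bm M (\<lambda>x. \<Sum>i\<in>A. f i x)"
  by (induction A rule: infinite_finite_induct) (auto intro: bm_add bm_const)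

lemma bm_indicator: "A \<in> sets M \<Longrightarrow> bm M (\<lambda>x. indicator A x)"
  by (intro bmI[of _ _ 1]) (auto simp: indicator_def)

lemma bm_fst: "bm unitM f \<Longrightarrow> bm squareM (\<lambda>p. f (fst p))"
  by (auto simp: bm_def intro!: measurable_compose[OF measurable_fst])

lemma bm_snd: "bm unitM f \<Longrightarrow> bm squareM (\<lambda>p. f (snd p))"
  by (auto simp: bm_def intro!: measurable_compose[OF measurable_snd])

lemma (in finite_measure) bm_integrable: "bm M f \<Longrightarrow> integrable M f"
  by (metis AE_I2 bm_bound bm_measurable integrable_const_bound real_norm_def)

lemma bm_integral_snd: assumes "bm squareM F" shows "bm unitM (\<lambda>x. \<integral>y. F (x, y) \<partial>unitM)"
proof -
  obtain C where C: "0 \<le> C" "\<And>p. p \<in> space squareM \<Longrightarrow> \<bar>F p\<bar> \<le> C" using bm_bound[OF assms] by auto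
  have m[measurable]: "F \<in> borel_measurable squareM" by (rule bm_measurable[OF assms])
  show ?thesis
  proof (rule bmI)
    show "(\<lambda>x. \<integral>y. F (x, y) \<partial>unitM) \<in> borel_measurable unitM" by measurable
    fix x assume x: "x \<in> space unitM"
    have "\<bar>\<integral>y. F (x, y) \<partial>unitM\<bar> \<le> (\<integral>y. C \<partial>unitM)"
      using x C by (intro integral_abs_bound[THEN order_trans] integral_mono' unitM.integrable_const) auto
    then show "\<bar>\<integral>y. F (x, y) \<partial>unitM\<bar> \<le> C" using unitM.prob_space by simp
  qed
qed

lemma bm_section: assumes "bm squareM F" "x \<in> {0..1}" shows "bm unitM (\<lambda>y. F (x, y))"
proof -
  have "(\<lambda>y. (x, y)) \<in> unitM \<rightarrow>\<^sub>M squareM" using assms(2) by (intro measurable_Pair1') simp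
  then have "(\<lambda>y. F (x, y)) \<in> borel_measurable unitM"
    by (rule measurable_compose[OF _ bm_measurable[OF assms(1)]])
  then show ?thesis using assms by (fastforce simp: bm_def)
qed

section \<open>Iterated integrals and the exchange of coordinates\<close>

lemmas bm_intros = bm_const bm_add bm_mult bm_uminus bm_diff bm_divide bm_power bm_sum

lemma squareM_iterate: "bm squareM F \<Longrightarrow> (\<integral>p. F p \<partial>squareM) = (\<integral>x. \<integral>y. F (x, y) \<partial>unitM \<partial>unitM)"
  using squareM.integral_fst'[of F] squareM.bm_integrable[of F] by simp

lemma squareM_swap: assumes "bm squareM F" shows "(\<integral>p. F (snd p, fst p) \<partial>squareM) = (\<integral>p. F p \<partial>squareM)"
proof -
  have "(\<integral>p. F p \<partial>squareM) = (\<integral>p. F p \<partial>distr squareM squareM (\<lambda>(x, y). (y, x)))"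
    using squareM.distr_pair_swap by simp
  also have "\<dots> = (\<integral>p. F (snd p, fst p) \<partial>squareM)"
    using bm_measurable[OF assms] by (subst integral_distr) (auto simp: case_prod_unfold)
  finally show ?thesis by simp
qed

lemma squareM_integral_fst: "bm unitM f \<Longrightarrow> bm squareM F \<Longrightarrow>
    (\<integral>p. f (fst p) * F p \<partial>squareM) = (\<integral>x. f x * (\<integral>y. F (x, y) \<partial>unitM) \<partial>unitM)"
  by (subst squareM_iterate) (auto intro: bm_mult bm_fst)

section \<open>Graphons and their functionals over the restricted measures\<close>

lemma graphonD:
  assumes "graphon g"
  shows "bm squareM (\<lambda>p. g (fst p) (snd p))"
    and "\<And>x y. x \<in> {0..1} \<Longrightarrow> y \<in> {0..1} \<Longrightarrow> g x y = g y x"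
    and "\<And>x y. x \<in> {0..1} \<Longrightarrow> y \<in> {0..1} \<Longrightarrow> 0 \<le> g x y"
    and "\<And>x y. x \<in> {0..1} \<Longrightarrow> y \<in> {0..1} \<Longrightarrow> g x y \<le> 1"
  using assms unfolding graphon_def squareM_eq[symmetric]
  by (auto simp: bm_def case_prod_unfold abs_le_iff intro!: exI[of _ 1])
     (meson atLeastAtMost_iff dual_order.trans neg_le_0_iff_le zero_le_one)

lemma graphonI:
  assumes "(\<lambda>p. g (fst p) (snd p)) \<in> borel_measurable squareM"
    and "\<And>x y. x \<in> {0..1} \<Longrightarrow> y \<in> {0..1} \<Longrightarrow> g x y = g y x \<and> 0 \<le> g x y \<and> g x y \<le> 1"
  shows "graphon g"
  using assms unfolding graphon_def squareM_eq[symmetric] by (auto simp: case_prod_unfold)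

lemma degree_unitM: "degree g x = (\<integral>y. g x y \<partial>unitM)"
  unfolding degree_def set_lebesgue_integral_def unitM_def by (subst integral_restrict_space) auto

lemma star_density_unitM: "star_density j g = (\<integral>x. degree g x ^ j \<partial>unitM)"
  unfolding star_density_def set_lebesgue_integral_def unitM_def by (subst integral_restrict_space) auto

lemma entropy_squareM: "entropy g = 1 / 2 * (\<integral>p. S_ent (g (fst p) (snd p)) \<partial>squareM)"
proof -
  have S: "unit_sq \<in> sets (lborel \<Otimes>\<^sub>M lborel)" unfolding unit_sq_def by (intro pair_measureI) auto
  show ?thesis
    unfolding entropy_def set_lebesgue_integral_def squareM_eq using S
    by (subst integral_restrict_space) auto
qed

lemma degree_bm: "graphon g \<Longrightarrow> bm unitM (degree g)"
  unfolding degree_unitM using bm_integral_snd[OF graphonD(1), of g] by simp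

lemma degree_range: assumes "graphon g" "x \<in> {0..1}" shows "0 \<le> degree g x" "degree g x \<le> 1"
proof -
  have b: "bm unitM (g x)" using bm_section[OF graphonD(1)[OF assms(1)] assms(2)] by simp
  show "0 \<le> degree g x" unfolding degree_unitM 
    using graphonD(3)[OF assms(1,2)] by (intro integral_nonneg_AE AE_I2) auto
  have "degree g x \<le> (\<integral>y. 1 \<partial>unitM)" unfolding degree_unitM
    using graphonD(4)[OF assms(1,2)] by (intro integral_mono unitM.bm_integrable b bm_const) auto
  then show "degree g x \<le> 1" using unitM.prob_space by simp
qed

lemma S_ent_graphon_bm: assumes "graphon g" shows "bm squareM (\<lambda>p. S_ent (g (fst p) (snd p)))"
proof (rule bmI[of _ _ 1])
  have [measurable]: "(\<lambda>p. g (fst p) (snd p)) \<in> borel_measurable squareM"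
    by (rule bm_measurable[OF graphonD(1)[OF assms]])
  show "(\<lambda>p. S_ent (g (fst p) (snd p))) \<in> borel_measurable squareM" by measurable
  fix p :: "real \<times> real" assume "p \<in> space squareM"
  then have "0 \<le> g (fst p) (snd p)" "g (fst p) (snd p) \<le> 1" using graphonD(3,4)[OF assms] by auto
  then show "\<bar>S_ent (g (fst p) (snd p))\<bar> \<le> 1" using S_ent_nonneg S_ent_le_1 by fastforce
qed

text \<open>Quantile transform: the generalized inverse of a distribution function carries the
  uniform distribution to the given one. It realizes a change of vertex masses by a map of the unit
  interval into itself.\<close>

lemma unitM_pushforward:
  assumes "bm unitM \<rho>" "\<And>x. x \<in> {0..1} \<Longrightarrow> 0 \<le> \<rho> x" "(\<integral>x. \<rho> x \<partial>unitM) = 1"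
  shows "\<exists>T \<in> unitM \<rightarrow>\<^sub>M unitM. \<forall>f. bm unitM f \<longrightarrow> (\<integral>u. f (T u) \<partial>unitM) = (\<integral>x. \<rho> x * f x \<partial>unitM)"
proof -
  have [measurable]: "\<rho> \<in> borel_measurable unitM" by (rule bm_measurable[OF assms(1)])
  let ?d = "density unitM (\<lambda>x. ennreal (\<rho> x))"
  \<comment> \<open>The distribution with density \<open>\<rho>\<close>, moved to the whole line,
    where distribution functions and their inverses are available.\<close>
  define N where "N = distr ?d borel (\<lambda>x. x)"
  have idm: "(\<lambda>x. x) \<in> unitM \<rightarrow>\<^sub>M borel" unfolding unitM_def by (auto intro: measurable_restrict_space1)
  have "emeasure N UNIV = emeasure ?d {0..1}"
    unfolding N_def by (subst emeasure_distr) (use idm in \<open>auto simp: space_density\<close>)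
  also have "\<dots> = (\<integral>\<^sup>+x. ennreal (\<rho> x) \<partial>unitM)"
    using sets.top[of unitM] by (subst emeasure_density) (auto intro!: nn_integral_cong)
  also have "\<dots> = 1" using assms by (subst nn_integral_eq_integral) (auto intro: unitM.bm_integrable)
  finally have N1: "emeasure N UNIV = 1" .
  interpret N: cdf_distribution N
    unfolding cdf_distribution_def real_distribution_def real_distribution_axioms_def
    using N1 by (auto simp: N_def intro!: prob_spaceI)
  have N_out: "measure N B = 0" if "B \<in> sets borel" "B \<inter> {0..1} = {}" for B
  proof -
    have "emeasure N B = emeasure ?d {}"
      unfolding N_def using that idm by (subst emeasure_distr) (auto simp: Int_commute)
    then show ?thesis by (simp add: measure_def)
  qed
  have c1: "cdf N 1 = 1"
  proof -
    have "measure N {..1} = measure N UNIV - measure N {1<..}"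
      using N.finite_measure_compl[of "{1<..}"] by (simp add: N_def Compl_eq_Diff_UNIV[symmetric] not_less atMost_def greaterThan_def Collect_neg_eq[symmetric])
    then show ?thesis using N_out[of "{1<..}"] N1
      by (simp add: cdf_def measure_def) (metis disjoint_iff atLeastAtMost_iff greaterThan_iff not_le)
  qed
  have c0: "cdf N x = 0" if "x < 0" for x
    unfolding cdf_def using N_out[of "{..x}"] that by auto
  define I where "I \<omega> = Inf {x. \<omega> \<le> cdf N x}" for \<omega>
  \<comment> \<open>The quantile \<open>I\<close> is controlled only for arguments strictly between
    0 and 1; the two end points form a null set and get the value 0.\<close>
  define T where "T u = (if 0 < u \<and> u < 1 then I u else 0)" for u
  have I01: "I u \<in> {0..1}" if "0 < u" "u < 1" for u
  proof -
    have "I u \<le> 1" using N.pseudoinverse[OF that, of 1] that c1 by (simp add: I_def)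
    moreover have "u \<le> cdf N (I u)" using N.pseudoinverse[OF that, of "I u"] by (simp add: I_def)
    then have "0 \<le> I u" using c0[of "I u"] that by force
    ultimately show ?thesis by simp
  qed
  have Tb: "T \<in> borel_measurable borel"
  proof -
    have "I \<in> borel_measurable (restrict_space borel {0<..<1})"
      unfolding I_def[abs_def] by (rule N.measurable_CI)
    then have "(\<lambda>u. indicator {0<..<1} u *\<^sub>R I u) \<in> borel_measurable borel"
      by (subst (asm) borel_measurable_restrict_space_iff) auto
    moreover have "T = (\<lambda>u. indicator {0<..<1} u *\<^sub>R I u)"
      by (auto simp: T_def fun_eq_iff indicator_def)
    ultimately show ?thesis by simp
  qed
  have Tm: "T \<in> unitM \<rightarrow>\<^sub>M unitM"
    unfolding unitM_def using Tb I01
    by (intro measurable_restrict_space2 measurable_restrict_space1) (auto simp: T_def)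
  show ?thesis
  proof (intro bexI[OF _ Tm] allI impI)
    fix f :: "real \<Rightarrow> real" assume f: "bm unitM f"
    \<comment> \<open>Extension by zero: \<open>N\<close> lives on the line, while \<open>f\<close>
      is known to be measurable on the interval only.\<close>
    define f' where "f' x = (if x \<in> {0..1} then f x else 0)" for x
    have f'm: "f' \<in> borel_measurable borel"
    proof -
      have "f \<in> borel_measurable (restrict_space borel {0..1})"
        using bm_measurable[OF f] unfolding unitM_def
        by (simp cong: measurable_cong_sets add: sets_restrict_space)
      then have "(\<lambda>x. indicator {0..1} x *\<^sub>R f x) \<in> borel_measurable borel"
        by (subst (asm) borel_measurable_restrict_space_iff) auto
      moreover have "f' = (\<lambda>x. indicator {0..1} x *\<^sub>R f x)"
        by (auto simp: f'_def fun_eq_iff indicator_def)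
      ultimately show ?thesis by simp
    qed
    have "(\<integral>u. f (T u) \<partial>unitM) = (\<integral>u. f' (T u) \<partial>unitM)"
      using measurable_space[OF Tm] by (intro Bochner_Integration.integral_cong) (auto simp: f'_def)
    also have "\<dots> = (\<integral>u. indicator {0..1} u * f' (T u) \<partial>lborel)"
      unfolding unitM_def by (subst integral_restrict_space) auto
    also have "\<dots> = (\<integral>u. indicator {0<..<1} u * f' (I u) \<partial>lborel)"
    proof (rule integral_cong_AE)
      have [measurable]: "I \<in> borel_measurable (restrict_space borel {0<..<1})"
        unfolding I_def[abs_def] by (rule N.measurable_CI)
      note [measurable] = f'm Tb
      show "(\<lambda>u. indicator {0..1} u * f' (T u)) \<in> borel_measurable lborel" by measurable
      have "(\<lambda>u. indicator {0<..<1} u * f' (I u)) = (\<lambda>u. indicator {0<..<1} u * f' (T u))"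
        by (auto simp: indicator_def T_def)
      moreover have "(\<lambda>u. indicator {0<..<1} u * f' (T u)) \<in> borel_measurable lborel" by measurable
      ultimately show "(\<lambda>u. indicator {0<..<1} u * f' (I u)) \<in> borel_measurable lborel" by simp
      show "AE u in lborel. indicator {0..1} u * f' (T u) = indicator {0<..<1} u * f' (I u)"
        using AE_lborel_singleton[of 0] AE_lborel_singleton[of 1]
        by eventually_elim (auto simp: indicator_def T_def)
    qed
    also have "\<dots> = (\<integral>u. f' (I u) \<partial>restrict_space lborel {0<..<1})"
      by (subst integral_restrict_space) auto
    also have "\<dots> = (\<integral>x. f' x \<partial>distr (restrict_space lborel {0<..<1}) borel I)"
      using N.measurable_CI f'm unfolding I_def[abs_def]
      by (subst integral_distr) (auto cong: measurable_cong_sets simp: sets_restrict_space)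
    also have "\<dots> = (\<integral>x. f' x \<partial>N)" using N.distr_I_eq_M unfolding I_def[abs_def] by simp
    also have "\<dots> = (\<integral>x. f' x \<partial>?d)" unfolding N_def using idm f'm
      by (subst integral_distr) (auto cong: measurable_cong_sets)
    also have "\<dots> = (\<integral>x. \<rho> x * f' x \<partial>unitM)"
      using idm f'm assms(2) by (subst integral_density) (auto intro: measurable_compose[OF idm] AE_I2)
    also have "\<dots> = (\<integral>x. \<rho> x * f x \<partial>unitM)"
      by (intro Bochner_Integration.integral_cong) (auto simp: f'_def)
    finally show "(\<integral>u. f (T u) \<partial>unitM) = (\<integral>x. \<rho> x * f x \<partial>unitM)" .
  qed
qed

text \<open>\<open>h\<close> is \<open>g\<close> read through the quantile map \<open>T\<close> of
  \<open>\<rho>\<close> in both variables. So every reweighting of the vertices of \<open>g\<close>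
  is an honest graphon, and its functionals are those of \<open>g\<close> with each integration
  weighted by \<open>\<rho>\<close>.\<close>

lemma weighted_graphon:
  assumes g: "graphon g" and \<rho>: "bm unitM \<rho>" "\<And>x. x \<in> {0..1} \<Longrightarrow> 0 \<le> \<rho> x" "(\<integral>x. \<rho> x \<partial>unitM) = 1"
  obtains h where "graphon h"
    "\<And>j. star_density j h = (\<integral>x. \<rho> x * (\<integral>y. \<rho> y * g x y \<partial>unitM) ^ j \<partial>unitM)"
    "entropy h = 1 / 2 * (\<integral>p. \<rho> (fst p) * \<rho> (snd p) * S_ent (g (fst p) (snd p)) \<partial>squareM)"
proof -
  from unitM_pushforward[OF \<rho>] obtain T where T: "T \<in> unitM \<rightarrow>\<^sub>M unitM"
    and I': "\<forall>f. bm unitM f \<longrightarrow> (\<integral>u. f (T u) \<partial>unitM) = (\<integral>x. \<rho> x * f x \<partial>unitM)" by (rule bexE)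
  have I: "(\<integral>u. f (T u) \<partial>unitM) = (\<integral>x. \<rho> x * f x \<partial>unitM)" if "bm unitM f" for f
    by (rule I'[rule_format, OF that])
  have T01: "T u \<in> {0..1}" if "u \<in> {0..1}" for u using measurable_space[OF T, of u] that by simp
  note gD = graphonD[OF g]
  have TT: "(\<lambda>p. (T (fst p), T (snd p))) \<in> squareM \<rightarrow>\<^sub>M squareM"
    by (intro measurable_Pair measurable_compose[OF measurable_fst T] measurable_compose[OF measurable_snd T])
  define h where "h x y = g (T x) (T y)" for x y
  have h: "graphon h"
  proof (rule graphonI)
    show "(\<lambda>p. h (fst p) (snd p)) \<in> borel_measurable squareM"
      unfolding h_def using measurable_compose[OF TT bm_measurable[OF gD(1)]] by simp
    fix x y :: real assume "x \<in> {0..1}" "y \<in> {0..1}"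
    then have "T x \<in> {0..1}" "T y \<in> {0..1}" using T01 by blast+
    then show "h x y = h y x \<and> 0 \<le> h x y \<and> h x y \<le> 1"
      unfolding h_def using gD(2-4)[of "T x" "T y"] by blast
  qed
  define H where "H x = (\<integral>y. \<rho> y * g x y \<partial>unitM)" for x
  have sec: "bm unitM (g x)" if "x \<in> {0..1}" for x
    using bm_section[OF gD(1) that] by simp
  have Hb: "bm unitM H"
    using bm_integral_snd[OF bm_mult[OF bm_snd[OF \<rho>(1)] gD(1)]] by (simp add: H_def[abs_def])
  have deg: "degree h u = H (T u)" if "u \<in> {0..1}" for u
    unfolding degree_unitM h_def H_def using I[OF sec[OF T01[OF that]]] .
  show ?thesis
  proof
    show "graphon h" by (rule h)
    show "star_density j h = (\<integral>x. \<rho> x * (\<integral>y. \<rho> y * g x y \<partial>unitM) ^ j \<partial>unitM)" for j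
    proof -
      have "star_density j h = (\<integral>u. H (T u) ^ j \<partial>unitM)"
        unfolding star_density_unitM using deg by (intro Bochner_Integration.integral_cong) auto
      also have "\<dots> = (\<integral>x. \<rho> x * H x ^ j \<partial>unitM)" by (rule I[OF bm_power[OF Hb]])
      finally show ?thesis by (simp add: H_def)
    qed
    have Sb: "bm squareM (\<lambda>p. S_ent (g (fst p) (snd p)))" by (rule S_ent_graphon_bm[OF g])
    have Ssec: "bm unitM (\<lambda>y. S_ent (g x y))" if "x \<in> {0..1}" for x
      using bm_section[OF Sb that] by simp
    have "(\<integral>p. S_ent (h (fst p) (snd p)) \<partial>squareM) = (\<integral>x. \<integral>y. S_ent (g (T x) (T y)) \<partial>unitM \<partial>unitM)"
      using squareM_iterate[OF S_ent_graphon_bm[OF h]] by (simp add: h_def)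
    also have "\<dots> = (\<integral>x. \<integral>y. \<rho> y * S_ent (g (T x) y) \<partial>unitM \<partial>unitM)"
    proof (rule Bochner_Integration.integral_cong)
      fix x assume "x \<in> space unitM"
      then have "T x \<in> {0..1}" using T01 by simp
      from I[OF Ssec[OF this]] show "(\<integral>y. S_ent (g (T x) (T y)) \<partial>unitM) = (\<integral>y. \<rho> y * S_ent (g (T x) y) \<partial>unitM)" .
    qed simp
    also have "\<dots> = (\<integral>x. \<rho> x * (\<integral>y. \<rho> y * S_ent (g x y) \<partial>unitM) \<partial>unitM)"
      by (rule I[where f = "\<lambda>x. \<integral>y. \<rho> y * S_ent (g x y) \<partial>unitM"])
        (use bm_integral_snd[OF bm_mult[OF bm_snd[OF \<rho>(1)] Sb]] in simp)
    also have "\<dots> = (\<integral>p. \<rho> (fst p) * (\<rho> (snd p) * S_ent (g (fst p) (snd p))) \<partial>squareM)"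
      using squareM_integral_fst[OF \<rho>(1) bm_mult[OF bm_snd[OF \<rho>(1)] Sb]] by simp
    finally show "entropy h = 1 / 2 * (\<integral>p. \<rho> (fst p) * \<rho> (snd p) * S_ent (g (fst p) (snd p)) \<partial>squareM)"
      unfolding entropy_squareM by (simp add: mult.assoc)
  qed
qed

section \<open>The price of violating the constraints\<close>

lemma measure_unit [simp]: "measure unitM {0..1} = 1" "measure squareM ({0..1} \<times> {0..1}) = 1"
  using unitM.prob_space squareM.P.prob_space by simp_all

lemma graphon_const: "0 \<le> c \<Longrightarrow> c \<le> 1 \<Longrightarrow> graphon (\<lambda>x y. c)"
  by (rule graphonI) auto

lemma graphon_mix:
  assumes "graphon g" "graphon h" "0 \<le> t" "t \<le> 1"
  shows "graphon (\<lambda>x y. (1 - t) * g x y + t * h x y)"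
proof (rule graphonI)
  have "bm squareM (\<lambda>p. (1 - t) * g (fst p) (snd p) + t * h (fst p) (snd p))"
    by (intro bm_intros graphonD(1) assms)
  then show "(\<lambda>p. (1 - t) * g (fst p) (snd p) + t * h (fst p) (snd p)) \<in> borel_measurable squareM"
    by (rule bm_measurable)
  fix x y :: real assume xy: "x \<in> {0..1}" "y \<in> {0..1}"
  have "0 \<le> (1 - t) * g x y + t * h x y"
    using graphonD(3)[OF assms(1) xy] graphonD(3)[OF assms(2) xy] assms by simp
  moreover have "(1 - t) * g x y + t * h x y \<le> 1"
    using graphonD(4)[OF assms(1) xy] graphonD(4)[OF assms(2) xy] assms by (intro convex_bound_le) auto
  moreover have "g x y = g y x" "h x y = h y x"
    using graphonD(2)[OF assms(1) xy] graphonD(2)[OF assms(2) xy] by auto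
  ultimately show "(1 - t) * g x y + t * h x y = (1 - t) * g y x + t * h y x
      \<and> 0 \<le> (1 - t) * g x y + t * h x y \<and> (1 - t) * g x y + t * h x y \<le> 1" by simp
qed

lemma graphon_section: "graphon g \<Longrightarrow> x \<in> {0..1} \<Longrightarrow> bm unitM (g x)"
  using bm_section[OF graphonD(1), of g x] by simp

lemma degree_const: "degree (\<lambda>x y. c) x = c"
  by (simp add: degree_unitM)

lemma degree_mix:
  assumes "graphon g" "graphon h" "x \<in> {0..1}"
  shows "degree (\<lambda>x y. (1 - t) * g x y + t * h x y) x = (1 - t) * degree g x + t * degree h x"
  unfolding degree_unitM using graphon_section[OF assms(1,3)] graphon_section[OF assms(2,3)]
  by (simp add: unitM.bm_integrable)

lemma star_density_1_mix:
  assumes "graphon g" "graphon h"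
  shows "star_density 1 (\<lambda>x y. (1 - t) * g x y + t * h x y) = (1 - t) * star_density 1 g + t * star_density 1 h"
proof -
  have "star_density 1 (\<lambda>x y. (1 - t) * g x y + t * h x y) = (\<integral>x. (1 - t) * degree g x + t * degree h x \<partial>unitM)"
    unfolding star_density_unitM using degree_mix[OF assms, of _ t]
    by (intro Bochner_Integration.integral_cong) auto
  then show ?thesis
    using unitM.bm_integrable[OF degree_bm[OF assms(1)]] unitM.bm_integrable[OF degree_bm[OF assms(2)]]
    by (simp add: star_density_unitM)
qed

lemma star_density_const: "star_density j (\<lambda>x y. c) = c ^ j"
  by (simp add: star_density_unitM degree_const)

lemma star_density_bm: "graphon g \<Longrightarrow> bm unitM (\<lambda>x. degree g x ^ j)"
  by (intro bm_power degree_bm)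

lemma star_density_range: assumes "graphon g" shows "0 \<le> star_density j g" "star_density j g \<le> 1"
proof -
  show "0 \<le> star_density j g" unfolding star_density_unitM
    using degree_range[OF assms] by (intro integral_nonneg_AE AE_I2) auto
  have "star_density j g \<le> (\<integral>x. 1 \<partial>unitM)" unfolding star_density_unitM
    using degree_range[OF assms] by (intro integral_mono unitM.bm_integrable star_density_bm assms bm_const) (auto intro: power_le_one)
  then show "star_density j g \<le> 1" by simp
qed

lemma star_density_le_1: assumes "graphon g" "1 \<le> j" shows "star_density j g \<le> star_density 1 g"
  unfolding star_density_unitM using degree_range[OF assms(1)] assms(2)
  by (intro integral_mono unitM.bm_integrable star_density_bm assms) (auto intro: power_decreasing[of 1 j, simplified])

lemma star_density_lipschitz:
  assumes "graphon g" "graphon h" and e: "\<And>x. x \<in> {0..1} \<Longrightarrow> \<bar>degree h x - degree g x\<bar> \<le> e"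
  shows "\<bar>star_density k h - star_density k g\<bar> \<le> real k * e"
proof -
  have i: "integrable unitM (\<lambda>x. degree h x ^ k)" "integrable unitM (\<lambda>x. degree g x ^ k)"
    by (intro unitM.bm_integrable star_density_bm assms)+
  have "star_density k h - star_density k g = (\<integral>x. degree h x ^ k - degree g x ^ k \<partial>unitM)"
    unfolding star_density_unitM using i by simp
  also have "\<bar>\<dots>\<bar> \<le> (\<integral>x. \<bar>degree h x ^ k - degree g x ^ k\<bar> \<partial>unitM)" by (rule integral_abs_bound)
  also have "\<dots> \<le> (\<integral>x. real k * e \<partial>unitM)"
  proof (rule integral_mono)
    fix x assume "x \<in> space unitM"
    then have x: "x \<in> {0..1}" by simp
    have "\<bar>degree h x ^ k - degree g x ^ k\<bar> \<le> real k * \<bar>degree h x - degree g x\<bar>"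
      using degree_range[OF assms(1) x] degree_range[OF assms(2) x] by (intro power_lipschitz_unit) auto
    also have "\<dots> \<le> real k * e" using e[OF x] by (intro mult_left_mono) auto
    finally show "\<bar>degree h x ^ k - degree g x ^ k\<bar> \<le> real k * e" .
  qed (use i in auto)
  finally show ?thesis by simp
qed

lemma entropy_range: assumes "graphon g" shows "0 \<le> entropy g" "entropy g \<le> 1"
proof -
  have S: "0 \<le> S_ent (g (fst p) (snd p)) \<and> S_ent (g (fst p) (snd p)) \<le> 1" if "p \<in> space squareM" for p
    using that graphonD(3,4)[OF assms, of "fst p" "snd p"] by (auto intro: S_ent_nonneg S_ent_le_1)
  show "0 \<le> entropy g" unfolding entropy_squareM
    using S by (intro mult_nonneg_nonneg integral_nonneg_AE AE_I2) auto
  have "(\<integral>p. S_ent (g (fst p) (snd p)) \<partial>squareM) \<le> (\<integral>p. 1 \<partial>squareM)"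
    using S by (intro integral_mono squareM.bm_integrable S_ent_graphon_bm assms bm_const) auto
  then show "entropy g \<le> 1" unfolding entropy_squareM by simp
qed

lemma entropy_mix:
  assumes "graphon g" "graphon h" "0 \<le> t" "t \<le> 1"
  shows "(1 - t) * entropy g + t * entropy h \<le> entropy (\<lambda>x y. (1 - t) * g x y + t * h x y)"
proof -
  have i: "integrable squareM (\<lambda>p. S_ent (g (fst p) (snd p)))" "integrable squareM (\<lambda>p. S_ent (h (fst p) (snd p)))"
    by (intro squareM.bm_integrable S_ent_graphon_bm assms)+
  have "(1 - t) * (\<integral>p. S_ent (g (fst p) (snd p)) \<partial>squareM) + t * (\<integral>p. S_ent (h (fst p) (snd p)) \<partial>squareM)
      = (\<integral>p. (1 - t) * S_ent (g (fst p) (snd p)) + t * S_ent (h (fst p) (snd p)) \<partial>squareM)"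
    using i by simp
  also have "\<dots> \<le> (\<integral>p. S_ent ((1 - t) * g (fst p) (snd p) + t * h (fst p) (snd p)) \<partial>squareM)"
  proof (rule integral_mono)
    show "integrable squareM (\<lambda>p. S_ent ((1 - t) * g (fst p) (snd p) + t * h (fst p) (snd p)))"
      using squareM.bm_integrable[OF S_ent_graphon_bm[OF graphon_mix[OF assms]]] by simp
    fix p :: "real \<times> real" assume "p \<in> space squareM"
    then have p: "fst p \<in> {0..1}" "snd p \<in> {0..1}" by auto
    show "(1 - t) * S_ent (g (fst p) (snd p)) + t * S_ent (h (fst p) (snd p))
        \<le> S_ent ((1 - t) * g (fst p) (snd p) + t * h (fst p) (snd p))"
      using graphonD(3,4)[OF assms(1) p] graphonD(3,4)[OF assms(2) p] assms by (intro S_ent_concave) auto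
  qed (use i in auto)
  finally show ?thesis unfolding entropy_squareM by simp
qed

lemma power_mix_le:
  fixes a b t :: real
  assumes "0 \<le> a" "0 \<le> b" "0 \<le> t" "t \<le> 1"
  shows "((1 - t) * a + t * b) ^ k \<le> (1 - t) * a ^ k + t * b ^ k"
proof -
  let ?c = "(1 - t) * a + t * b"
  have c: "0 \<le> ?c" using assms by simp
  have "(1 - t) * (?c ^ k + real k * ?c ^ (k - 1) * (a - ?c)) + t * (?c ^ k + real k * ?c ^ (k - 1) * (b - ?c))
      \<le> (1 - t) * a ^ k + t * b ^ k"
    using assms c by (intro add_mono mult_left_mono power_above_tangent) auto
  moreover have "(1 - t) * (?c ^ k + real k * ?c ^ (k - 1) * (a - ?c)) + t * (?c ^ k + real k * ?c ^ (k - 1) * (b - ?c)) = ?c ^ k"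
    by (simp only: algebra_simps)
  ultimately show ?thesis by linarith
qed

lemma star_density_mix_const:
  assumes "graphon g" "0 \<le> c" "c \<le> 1" "0 \<le> t" "t \<le> 1"
  shows "star_density k (\<lambda>x y. (1 - t) * g x y + t * c) \<le> (1 - t) * star_density k g + t * c ^ k"
proof -
  let ?h = "\<lambda>x y. (1 - t) * g x y + t * c"
  have h: "graphon ?h" by (intro graphon_mix graphon_const assms)
  have i: "integrable unitM (\<lambda>x. degree g x ^ k)" by (intro unitM.bm_integrable star_density_bm assms)
  have "star_density k ?h \<le> (\<integral>x. (1 - t) * degree g x ^ k + t * c ^ k \<partial>unitM)"
    unfolding star_density_unitM
  proof (rule integral_mono)
    fix x assume "x \<in> space unitM"
    then have x: "x \<in> {0..1}" by simp
    show "degree ?h x ^ k \<le> (1 - t) * degree g x ^ k + t * c ^ k"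
      unfolding degree_mix[OF assms(1) graphon_const[OF assms(2,3)] x] degree_const
      using degree_range[OF assms(1) x] assms by (intro power_mix_le) auto
  qed (use i unitM.bm_integrable[OF star_density_bm[OF h]] in auto)
  also have "\<dots> = (1 - t) * star_density k g + t * c ^ k"
    unfolding star_density_unitM using i by simp
  finally show ?thesis .
qed

lemma degree_mix_const_diff:
  assumes "graphon g" "0 \<le> c" "c \<le> 1" "x \<in> {0..1}"
  shows "\<bar>degree (\<lambda>x y. (1 - s) * g x y + s * c) x - degree (\<lambda>x y. (1 - t) * g x y + t * c) x\<bar> \<le> \<bar>s - t\<bar>"
proof -
  have "degree (\<lambda>x y. (1 - s) * g x y + s * c) x - degree (\<lambda>x y. (1 - t) * g x y + t * c) x
      = (s - t) * (c - degree g x)"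
    unfolding degree_mix[OF assms(1) graphon_const[OF assms(2,3)] assms(4)] degree_const
    by (simp add: algebra_simps)
  also have "\<bar>\<dots>\<bar> \<le> \<bar>s - t\<bar> * 1"
    unfolding abs_mult using degree_range[OF assms(1,4)] assms by (intro mult_left_mono) auto
  finally show ?thesis by simp
qed

lemma star_density_ge_power:
  assumes "graphon g"
  shows "star_density 1 g ^ k \<le> star_density k g"
proof -
  let ?t = "star_density 1 g"
  have i: "integrable unitM (\<lambda>x. degree g x ^ k)" "integrable unitM (degree g)"
    by (intro unitM.bm_integrable star_density_bm degree_bm assms)+
  have t: "(\<integral>x. degree g x \<partial>unitM) = ?t" by (simp add: star_density_unitM)
  have "?t ^ k = (\<integral>x. ?t ^ k + real k * ?t ^ (k - 1) * (degree g x - ?t) \<partial>unitM)"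
    using i t by simp
  also have "\<dots> \<le> star_density k g"
    unfolding star_density_unitM[of k] 
  proof (rule integral_mono)
    fix x assume "x \<in> space unitM"
    then show "?t ^ k + real k * ?t ^ (k - 1) * (degree g x - ?t) \<le> degree g x ^ k"
      using degree_range[OF assms, of x] star_density_range[OF assms, of 1] by (intro power_above_tangent) auto
  qed (use i in auto)
  finally show ?thesis .
qed

text \<open>The equality case of Jensen's inequality. It disposes of the boundary of the constraint
  region, where \<open>maximizer_penalty\<close> does not apply.\<close>

lemma star_density_eq_power_imp_const:
  assumes "graphon g" "2 \<le> k" "star_density k g = star_density 1 g ^ k"
  shows "AE x in unitM. degree g x = star_density 1 g"
proof -
  let ?t = "star_density 1 g"
  let ?f = "\<lambda>x. degree g x ^ k - (?t ^ k + real k * ?t ^ (k - 1) * (degree g x - ?t))"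
  have i: "integrable unitM (\<lambda>x. degree g x ^ k)" "integrable unitM (degree g)"
    by (intro unitM.bm_integrable star_density_bm degree_bm assms)+
  have t: "(\<integral>x. degree g x \<partial>unitM) = ?t" by (simp add: star_density_unitM)
  have "(\<integral>x. ?f x \<partial>unitM) = star_density k g - ?t ^ k"
    using i t by (simp add: star_density_unitM[of k])
  then have "(\<integral>x. ?f x \<partial>unitM) = 0" using assms by simp
  moreover have "AE x in unitM. 0 \<le> ?f x"
  proof (rule AE_I2)
    fix x assume "x \<in> space unitM"
    then have "?t ^ k + real k * ?t ^ (k - 1) * (degree g x - ?t) \<le> degree g x ^ k"
      using degree_range[OF assms(1), of x] star_density_range[OF assms(1), of 1] by (intro power_above_tangent) auto
    then show "0 \<le> ?f x" by simp
  qed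
  moreover have "integrable unitM ?f" using i by auto
  ultimately have "AE x in unitM. ?f x = 0" by (simp add: integral_nonneg_eq_0_iff_AE)
  moreover have "AE x in unitM. x \<in> {0..1}" by (intro AE_I2) simp
  ultimately show ?thesis
  proof eventually_elim
    case (elim x)
    then show ?case
      using power_above_tangent_strict[of ?t "degree g x" k] degree_range[OF assms(1), of x] star_density_range[OF assms(1), of 1] assms(2)
      by (cases "degree g x = ?t") auto
  qed
qed

text \<open>Mixing with a constant graphon restores the constraints exactly: with the constant \<open>0\<close> or \<open>1\<close> for
  \<open>t1\<close>, then with the constant \<open>t1\<close> for \<open>tk\<close>. By concavity the entropy drops at most linearly
  in the mixing weights.\<close>

lemma maximizer_penalty:
  assumes max: "entropy_maximizer k \<tau> g" and k: "1 \<le> k" and gap: "star_density 1 g ^ k < star_density k g"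
  obtains C where "0 \<le> C"
    "\<And>h. graphon h \<Longrightarrow> C * \<bar>star_density 1 h - star_density 1 g\<bar> \<le> star_density k h - star_density k g \<Longrightarrow>
       entropy h \<le> entropy g + C * (star_density k h - star_density k g)"
proof -
  have g: "graphon g" and \<tau>: "\<tau> = (star_density 1 g, star_density k g)"
    and best: "\<And>h. graphon h \<Longrightarrow> star_density 1 h = star_density 1 g \<Longrightarrow> star_density k h = star_density k g \<Longrightarrow> entropy h \<le> entropy g"
    using max by (auto simp: entropy_maximizer_def)
  define t where "t = star_density 1 g"
  define \<kappa> where "\<kappa> = star_density k g - t ^ k"
  have \<kappa>: "0 < \<kappa>" using gap by (simp add: \<kappa>_def t_def)
  have t0: "0 < t"
    using gap star_density_le_1[OF g k] star_density_range[OF g, of 1] k 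
    by (cases "t = 0") (auto simp: t_def power_0_left)
  have t1: "t < 1"
    using gap star_density_range[OF g, of k] star_density_range[OF g, of 1] by (cases "t = 1") (auto simp: t_def)
  \<comment> \<open>The weight needed to restore \<open>t1\<close> is its error divided by
    \<open>star_density 1 h\<close> or by \<open>1 - star_density 1 h\<close>; in the respective
    case these are at least \<open>t\<close> and \<open>1 - t\<close>.\<close>
  define C1 where "C1 = 1 / t + 1 / (1 - t)"
  have C1: "1 / t \<le> C1" "1 / (1 - t) \<le> C1" "0 \<le> C1" using t0 t1 by (auto simp: C1_def)
  \<comment> \<open>With \<open>real k * C1\<close> the hypothesis on \<open>h\<close> pays for the
    change of \<open>tk\<close> caused by restoring \<open>t1\<close>. The terms
    \<open>2 / \<kappa>\<close> and \<open>1\<close> bound the two mixing weights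
    \<open>\<delta>\<close> and \<open>l\<close> by the excess.\<close>
  define C where "C = real k * C1 + 2 / \<kappa> + 1"
  have C: "0 \<le> C" "real k * C1 \<le> C" "2 / \<kappa> + 1 \<le> C" using C1 \<kappa> by (auto simp: C_def)
  show ?thesis
  proof (rule that)
    fix h assume h: "graphon h" and big: "C * \<bar>star_density 1 h - star_density 1 g\<bar> \<le> star_density k h - star_density k g"
    let ?d1 = "star_density 1 h - t"
    let ?dk = "star_density k h - star_density k g"
    have h01: "0 \<le> star_density 1 h" "star_density 1 h \<le> 1" using star_density_range[OF h] by auto
    obtain l b where l: "0 \<le> l" "l \<le> 1" "l \<le> C1 * \<bar>?d1\<bar>" and b: "0 \<le> b" "b \<le> 1"
      and fix1: "(1 - l) * star_density 1 h + l * b = t"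
    proof (cases "0 \<le> ?d1")
      case True
      have "?d1 / star_density 1 h \<le> ?d1 / t" using True t0 by (intro divide_left_mono mult_pos_pos) auto
      also have "\<dots> \<le> C1 * \<bar>?d1\<bar>" using True mult_right_mono[OF C1(1), of ?d1] by simp
      finally have "?d1 / star_density 1 h \<le> C1 * \<bar>?d1\<bar>" .
      moreover have "?d1 / star_density 1 h * star_density 1 h = ?d1" using True t0 by simp
      moreover have "0 \<le> ?d1 / star_density 1 h" "?d1 / star_density 1 h \<le> 1"
        using True t0 by (auto simp: divide_le_eq_1)
      ultimately show ?thesis
        by (intro that[of "?d1 / star_density 1 h" 0]) (auto simp: left_diff_distrib)
    next
      case False
      have "- ?d1 / (1 - star_density 1 h) \<le> - ?d1 / (1 - t)" using False t1 by (intro divide_left_mono mult_pos_pos) auto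
      also have "\<dots> \<le> C1 * \<bar>?d1\<bar>" using False mult_right_mono[OF C1(2), of "- ?d1"] by simp
      finally have "- ?d1 / (1 - star_density 1 h) \<le> C1 * \<bar>?d1\<bar>" .
      moreover have "- ?d1 / (1 - star_density 1 h) * (1 - star_density 1 h) = - ?d1" using False t1 by simp
      then have "(1 - - ?d1 / (1 - star_density 1 h)) * star_density 1 h + - ?d1 / (1 - star_density 1 h) * 1 = t"
        by (simp only: algebra_simps)
      moreover have "0 \<le> - ?d1 / (1 - star_density 1 h)" "- ?d1 / (1 - star_density 1 h) \<le> 1"
        using False t1 by (auto simp: divide_le_eq_1 intro!: divide_nonneg_pos)
      ultimately show ?thesis
        by (intro that[of "- ?d1 / (1 - star_density 1 h)" 1]) auto
    qed
    define h2 where "h2 = (\<lambda>x y. (1 - l) * h x y + l * b)"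
    have h2: "graphon h2" unfolding h2_def by (intro graphon_mix graphon_const h l b)
    have h2t: "star_density 1 h2 = t"
      unfolding h2_def using star_density_1_mix[OF h graphon_const[OF b], of l] fix1 star_density_const[of 1 b] by simp
    have kl: "\<bar>star_density k h2 - star_density k h\<bar> \<le> real k * l"
      unfolding h2_def using degree_mix_const_diff[OF h b, of _ l 0] l
      by (intro star_density_lipschitz h graphon_mix graphon_const l b) auto
    have "real k * l \<le> real k * (C1 * \<bar>?d1\<bar>)" using l by (intro mult_left_mono) auto
    also have "\<dots> \<le> C * \<bar>?d1\<bar>" using mult_right_mono[OF C(2), of "\<bar>?d1\<bar>"] by (simp add: mult_ac)
    also have "\<dots> \<le> ?dk" using big by (simp add: t_def)
    finally have kldk: "real k * l \<le> ?dk" .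
    have ldk: "l \<le> ?dk" using kldk k l mult_right_mono[of 1 "real k" l] by simp
    have lo: "star_density k g \<le> star_density k h2" and up: "star_density k h2 - star_density k g \<le> 2 * ?dk"
      using kl kldk by (auto simp: abs_le_iff)
    \<comment> \<open>Intermediate value argument: at weight 0 the density \<open>tk\<close> is
      still at least the target, at weight 1 it is \<open>t ^ k\<close>, which the gap puts below
      the target.\<close>
    define f where "f \<delta> = star_density k (\<lambda>x y. (1 - \<delta>) * h2 x y + \<delta> * t)" for \<delta>
    have tt: "0 \<le> t" "t \<le> 1" using t0 t1 by auto
    have gm: "graphon (\<lambda>x y. (1 - \<delta>) * h2 x y + \<delta> * t)" if "0 \<le> \<delta>" "\<delta> \<le> 1" for \<delta>
      by (intro graphon_mix graphon_const h2 tt that)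
    have "k-lipschitz_on {0..1} f"
    proof (rule lipschitz_onI)
      fix r s :: real assume "r \<in> {0..1}" "s \<in> {0..1}"
      then show "dist (f r) (f s) \<le> real k * dist r s"
        unfolding f_def dist_real_def using degree_mix_const_diff[OF h2 tt, of _ r s]
        by (intro star_density_lipschitz gm) auto
    qed simp
    then have "continuous_on {0..1} f" by (rule lipschitz_on_continuous_on)
    moreover have "f 0 = star_density k h2" "f 1 = t ^ k" by (simp_all add: f_def star_density_const)
    ultimately obtain \<delta> where \<delta>: "0 \<le> \<delta>" "\<delta> \<le> 1" "f \<delta> = star_density k g"
      using IVT2'[of f 1 "star_density k g" 0] lo gap by (auto simp: t_def)
    \<comment> \<open>Convexity of \<open>tk\<close> along the mixture makes it fall by at least
      \<open>\<delta> * \<kappa>\<close>, so the weight is bounded by the excess.\<close>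
    have "f \<delta> \<le> (1 - \<delta>) * star_density k h2 + \<delta> * t ^ k"
      unfolding f_def by (intro star_density_mix_const h2 tt \<delta>)
    then have "\<delta> * (star_density k h2 - t ^ k) \<le> star_density k h2 - star_density k g"
      using \<delta>(3) by (simp add: algebra_simps)
    moreover have "\<delta> * \<kappa> \<le> \<delta> * (star_density k h2 - t ^ k)"
      using lo \<delta> by (intro mult_left_mono) (auto simp: \<kappa>_def)
    ultimately have "\<delta> * \<kappa> \<le> 2 * ?dk" using up by linarith
    then have \<delta>dk: "\<delta> \<le> 2 / \<kappa> * ?dk" using \<kappa> by (simp add: field_simps)
    let ?h3 = "\<lambda>x y. (1 - \<delta>) * h2 x y + \<delta> * t"
    have "star_density 1 ?h3 = star_density 1 g"
      using star_density_1_mix[OF h2 graphon_const[OF tt], of \<delta>] star_density_const[of 1 t] h2t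
      by (simp add: t_def algebra_simps)
    then have "entropy ?h3 \<le> entropy g" using \<delta> by (intro best gm) (auto simp: f_def)
    moreover have "(1 - \<delta>) * entropy h2 + \<delta> * entropy (\<lambda>x y. t) \<le> entropy ?h3"
      by (intro entropy_mix h2 graphon_const tt \<delta>)
    moreover have "(1 - l) * entropy h + l * entropy (\<lambda>x y. b) \<le> entropy h2"
      unfolding h2_def by (intro entropy_mix h graphon_const b l)
    moreover have "0 \<le> l * entropy (\<lambda>x y. b)" "0 \<le> \<delta> * entropy (\<lambda>x y. t)"
      using l \<delta> entropy_range[OF graphon_const[OF b]] entropy_range[OF graphon_const[OF tt]] by auto
    moreover have "\<delta> * entropy h2 \<le> \<delta> * 1" "l * entropy h \<le> l * 1"
      using l \<delta> entropy_range[OF h] entropy_range[OF h2] by (intro mult_left_mono; simp)+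
    ultimately have "entropy h \<le> entropy g + \<delta> + l" by (simp add: algebra_simps)
    also have "\<dots> \<le> entropy g + (2 / \<kappa> + 1) * ?dk" using \<delta>dk ldk by (simp add: algebra_simps)
    also have "\<dots> \<le> entropy g + C * ?dk" using C(3) ldk l by (intro add_left_mono mult_right_mono) auto
    finally show "entropy h \<le> entropy g + C * ?dk" .
  qed (rule C(1))
qed

section \<open>Finitely many degrees\<close>

text \<open>Jensen on a block, with its equality case. A null block gets \<open>c = 0\<close>
  through division by zero, which is consistent with all four claims.\<close>

lemma S_ent_jensen:
  assumes B: "B \<in> sets squareM" and F: "bm squareM F" and F01: "\<And>p. p \<in> space squareM \<Longrightarrow> 0 \<le> F p \<and> F p \<le> 1"
  defines "c \<equiv> (\<integral>p. indicator B p * F p \<partial>squareM) / measure squareM B"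
  shows "0 \<le> c" "c \<le> 1"
    and "(\<integral>p. indicator B p * S_ent (F p) \<partial>squareM) \<le> measure squareM B * S_ent c"
    and "(\<integral>p. indicator B p * S_ent (F p) \<partial>squareM) = measure squareM B * S_ent c \<Longrightarrow> AE p in squareM. p \<in> B \<longrightarrow> F p = c"
proof -
  let ?b = "measure squareM B"
  have [measurable]: "F \<in> borel_measurable squareM" by (rule bm_measurable[OF F])
  have S01: "0 \<le> S_ent (F p) \<and> S_ent (F p) \<le> 1" if "p \<in> space squareM" for p
    using F01[OF that] S_ent_nonneg S_ent_le_1 by auto
  have SF: "bm squareM (\<lambda>p. S_ent (F p))"
  proof (rule bmI[of _ _ 1])
    show "(\<lambda>p. S_ent (F p)) \<in> borel_measurable squareM" by measurable
    show "\<bar>S_ent (F p)\<bar> \<le> 1" if "p \<in> space squareM" for p using S01[OF that] by auto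
  qed
  have iF: "integrable squareM (\<lambda>p. indicator B p * F p)" and iS: "integrable squareM (\<lambda>p. indicator B p * S_ent (F p))"
    and i1: "integrable squareM (\<lambda>p. indicator B p :: real)"
    by (intro squareM.P.bm_integrable bm_mult bm_indicator B F SF)+
  have b: "(\<integral>p. indicator B p \<partial>squareM) = ?b"
    using sets.sets_into_space[OF B] by (simp add: Int_absorb2)
  have le: "(\<integral>p. indicator B p * F p \<partial>squareM) \<le> ?b"
    unfolding b[symmetric] using F01 by (intro integral_mono iF i1) (auto simp: indicator_def)
  have ge: "0 \<le> (\<integral>p. indicator B p * F p \<partial>squareM)"
    using F01 by (intro integral_nonneg_AE AE_I2) (auto simp: indicator_def)
  show c0: "0 \<le> c" unfolding c_def using ge by simp
  show c1: "c \<le> 1" unfolding c_def using le ge by (auto simp: divide_le_eq_1)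
  have null: "AE p in squareM. p \<notin> B" if "?b = 0"
    using that B by (intro AE_not_in) (auto simp: null_sets_def squareM.P.emeasure_eq_measure)
  have int_c: "(\<integral>p. indicator B p * F p \<partial>squareM) = ?b * c"
    using le ge by (cases "?b = 0") (auto simp: c_def)
  have B_S_ge: "0 \<le> (\<integral>p. indicator B p * S_ent (F p) \<partial>squareM)"
    using S01 by (intro integral_nonneg_AE AE_I2) (auto simp: indicator_def)
  have edge: "AE p in squareM. p \<in> B \<longrightarrow> F p = c" if "c = 0 \<or> c = 1"
  proof -
    have "(\<integral>p. indicator B p * \<bar>F p - c\<bar> \<partial>squareM) = 0"
      using that
    proof
      assume c: "c = 0"
      have "(\<integral>p. indicator B p * \<bar>F p - c\<bar> \<partial>squareM) = (\<integral>p. indicator B p * F p \<partial>squareM)"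
        using F01 c by (intro Bochner_Integration.integral_cong) auto
      then show ?thesis using int_c c by simp
    next
      assume c: "c = 1"
      have "(\<integral>p. indicator B p * \<bar>F p - c\<bar> \<partial>squareM) = (\<integral>p. indicator B p - indicator B p * F p \<partial>squareM)"
        using F01 c by (intro Bochner_Integration.integral_cong) (auto simp: indicator_def)
      then show ?thesis using int_c c iF i1 b by simp
    qed
    moreover have "integrable squareM (\<lambda>p. indicator B p * \<bar>F p - c\<bar>)"
    proof (intro squareM.P.bm_integrable bm_mult bm_indicator B)
      have "bm squareM (\<lambda>p. F p - c)" by (intro bm_intros F)
      then show "bm squareM (\<lambda>p. \<bar>F p - c\<bar>)" by (auto simp: bm_def)
    qed
    ultimately have "AE p in squareM. indicator B p * \<bar>F p - c\<bar> = 0"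
      by (subst (asm) integral_nonneg_eq_0_iff_AE) auto
    then show ?thesis by eventually_elim auto
  qed
  consider "?b = 0" | "c = 0 \<or> c = 1" | "?b \<noteq> 0" "0 < c" "c < 1" using c0 c1 by linarith
  then have "(\<integral>p. indicator B p * S_ent (F p) \<partial>squareM) \<le> ?b * S_ent c \<and>
     ((\<integral>p. indicator B p * S_ent (F p) \<partial>squareM) = ?b * S_ent c \<longrightarrow> (AE p in squareM. p \<in> B \<longrightarrow> F p = c))"
  proof cases
    case 1
    have "(\<integral>p. indicator B p * S_ent (F p) \<partial>squareM) = (\<integral>p. 0 \<partial>squareM)"
    proof (rule integral_cong_AE)
      show "AE p in squareM. indicator B p * S_ent (F p) = 0"
        using null[OF 1] by eventually_elim auto
    qed (use iS in auto)
    moreover have "AE p in squareM. p \<in> B \<longrightarrow> F p = c" using null[OF 1] by eventually_elim auto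
    ultimately show ?thesis using 1 by simp
  next
    case 2
    have "(\<integral>p. indicator B p * S_ent (F p) \<partial>squareM) = (\<integral>p. 0 \<partial>squareM)"
    proof (rule integral_cong_AE)
      show "AE p in squareM. indicator B p * S_ent (F p) = 0"
        using edge[OF 2] by eventually_elim (use 2 in \<open>auto simp: indicator_def\<close>)
    qed (use iS in auto)
    then show ?thesis using 2 edge[OF 2] by auto
  next
    case 3
    \<comment> \<open>The gap in Gibbs' inequality at \<open>c\<close>. The tangent is affine, so
      the integral of \<open>?G\<close> is exactly the Jensen gap.\<close>
    let ?G = "\<lambda>p. indicator B p * (- F p * ln c - (1 - F p) * ln (1 - c)) - indicator B p * S_ent (F p)"
    have iG: "integrable squareM ?G"
      by (intro squareM.P.bm_integrable bm_diff bm_mult bm_indicator B bm_uminus bm_const F SF)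
    have eqG: "?G = (\<lambda>p. (ln (1 - c) - ln c) * (indicator B p * F p) - ln (1 - c) * indicator B p - indicator B p * S_ent (F p))"
      by (auto simp: algebra_simps)
    have "(\<integral>p. ?G p \<partial>squareM) = (ln (1 - c) - ln c) * (?b * c) - ln (1 - c) * ?b - (\<integral>p. indicator B p * S_ent (F p) \<partial>squareM)"
      unfolding eqG using iF i1 iS int_c b by simp
    also have "\<dots> = ?b * S_ent c - (\<integral>p. indicator B p * S_ent (F p) \<partial>squareM)"
      by (simp add: S_ent_def algebra_simps)
    finally have intG: "(\<integral>p. ?G p \<partial>squareM) = ?b * S_ent c - (\<integral>p. indicator B p * S_ent (F p) \<partial>squareM)" .
    have posG: "AE p in squareM. 0 \<le> ?G p"
      using S_ent_gibbs[OF _ _ 3(2,3)] F01 by (intro AE_I2) (auto simp: indicator_def)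
    have "0 \<le> (\<integral>p. ?G p \<partial>squareM)" by (rule integral_nonneg_AE[OF posG])
    moreover have "AE p in squareM. p \<in> B \<longrightarrow> F p = c" if "(\<integral>p. ?G p \<partial>squareM) = 0"
    proof -
      have "AE p in squareM. ?G p = 0" using that integral_nonneg_eq_0_iff_AE[OF iG posG] by simp
      moreover have "AE p in squareM. p \<in> space squareM" by (rule AE_space)
      ultimately show ?thesis
      proof eventually_elim
        case (elim p)
        show ?case
        proof (rule impI, rule ccontr)
          assume "p \<in> B" "F p \<noteq> c"
          then show False using S_ent_gibbs_strict[OF _ _ 3(2,3), of "F p"] F01[of p] elim by simp
        qed
      qed
    qed
    ultimately show ?thesis using intG by auto
  qed
  then show "(\<integral>p. indicator B p * S_ent (F p) \<partial>squareM) \<le> ?b * S_ent c"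
    and "(\<integral>p. indicator B p * S_ent (F p) \<partial>squareM) = ?b * S_ent c \<Longrightarrow> AE p in squareM. p \<in> B \<longrightarrow> F p = c"
    by auto
qed

text \<open>The support of the distribution of the degree. Each of its points comes with vertex sets
  of positive measure and nearly equal degree, and the test functions are built from their
  normalized indicators.\<close>

definition degree_support :: "(real \<Rightarrow> real \<Rightarrow> real) \<Rightarrow> real set" where
  "degree_support g = {r. \<forall>\<eta>>0. 0 < measure unitM {x \<in> {0..1}. \<bar>degree g x - r\<bar> < \<eta>}}"

lemma degree_near_sets: "graphon g \<Longrightarrow> {x \<in> {0..1}. \<bar>degree g x - r\<bar> < \<eta>} \<in> sets unitM"
proof -
  assume "graphon g"
  then have [measurable]: "degree g \<in> borel_measurable unitM" by (intro bm_measurable degree_bm)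
  have "{x \<in> space unitM. \<bar>degree g x - r\<bar> < \<eta>} \<in> sets unitM" by measurable
  then show ?thesis by simp
qed

text \<open>A degree outside the support lies in a rational interval of measure zero, and there are
  only countably many of these.\<close>

lemma AE_degree_support:
  assumes g: "graphon g"
  shows "AE x in unitM. degree g x \<in> degree_support g"
proof -
  let ?N = "\<lambda>q \<delta>. {x \<in> {0..1}. \<bar>degree g x - q\<bar> < \<delta>}"
  have "AE x in unitM. \<forall>(q::rat) (\<delta>::rat). measure unitM (?N (of_rat q) (of_rat \<delta>)) = 0 \<longrightarrow> x \<notin> ?N (of_rat q) (of_rat \<delta>)"
  proof (subst AE_all_countable, intro allI, subst AE_all_countable, intro allI)
    fix q \<delta> :: rat
    show "AE x in unitM. measure unitM (?N (of_rat q) (of_rat \<delta>)) = 0 \<longrightarrow> x \<notin> ?N (of_rat q) (of_rat \<delta>)"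
    proof (cases "measure unitM (?N (of_rat q) (of_rat \<delta>)) = 0")
      case True
      then have "?N (of_rat q) (of_rat \<delta>) \<in> null_sets unitM"
        using degree_near_sets[OF g] by (auto simp: null_sets_def unitM.emeasure_eq_measure)
      from AE_not_in[OF this] show ?thesis by eventually_elim auto
    qed auto
  qed
  moreover have "AE x in unitM. x \<in> space unitM" by (rule AE_space)
  ultimately show ?thesis
  proof eventually_elim
    case (elim x)
    show ?case
    proof (rule ccontr)
      assume "degree g x \<notin> degree_support g"
      then obtain \<eta> where \<eta>: "0 < \<eta>" "\<not> 0 < measure unitM (?N (degree g x) \<eta>)"
        by (auto simp: degree_support_def)
      obtain \<delta> :: rat where \<delta>: "0 < real_of_rat \<delta>" "real_of_rat \<delta> < \<eta> / 2"
        using of_rat_dense[of 0 "\<eta> / 2"] \<eta> by auto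
      obtain q :: rat where q: "degree g x < real_of_rat q" "real_of_rat q < degree g x + real_of_rat \<delta>"
        using of_rat_dense[of "degree g x" "degree g x + real_of_rat \<delta>"] \<delta> by auto
      have "?N (of_rat q) (of_rat \<delta>) \<subseteq> ?N (degree g x) \<eta>" using q \<delta> by (auto simp: abs_less_iff)
      then have "measure unitM (?N (of_rat q) (of_rat \<delta>)) \<le> measure unitM (?N (degree g x) \<eta>)"
        using degree_near_sets[OF g] by (intro unitM.finite_measure_mono) auto
      then have "measure unitM (?N (of_rat q) (of_rat \<delta>)) = 0"
        using \<eta> measure_nonneg[of unitM "?N (of_rat q) (of_rat \<delta>)"] by linarith
      moreover have "x \<in> ?N (of_rat q) (of_rat \<delta>)" using elim q by auto
      ultimately show False using elim by blast
    qed
  qed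
qed

lemma maximizer_finite_degrees_podal:
  assumes max: "entropy_maximizer k \<tau> g" and R: "finite R" and dR: "AE x in unitM. degree g x \<in> R"
  shows "podal (card R) g"
proof -
  have g: "graphon g"
    and best: "\<And>h. graphon h \<Longrightarrow> star_density 1 h = star_density 1 g \<Longrightarrow> star_density k h = star_density k g \<Longrightarrow> entropy h \<le> entropy g"
    using max by (auto simp: entropy_maximizer_def)
  note gD = graphonD[OF g]
  have [measurable]: "degree g \<in> borel_measurable unitM" by (intro bm_measurable degree_bm g)
  define n where "n = card R"
  obtain r where r: "bij_betw r {..<n} R" using ex_bij_betw_nat_finite[OF R] by (auto simp: n_def lessThan_atLeast0)
  have "R \<noteq> {}"
  proof
    assume "R = {}"
    then have "AE x in unitM. False" using dR by simp
    then show False using unitM.AE_False by simp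
  qed
  then have n: "0 < n" using R by (simp add: n_def card_gt_0_iff)
  \<comment> \<open>the null set of exceptional degrees is put into the class \<open>0\<close>\<close>
  define V where "V i = {x \<in> {0..1}. degree g x = r i \<or> i = 0 \<and> degree g x \<notin> R}" for i :: nat
  have Vs: "V i \<in> sets unitM" for i
  proof -
    have 1: "{x \<in> space unitM. degree g x = r i} \<in> sets unitM" by measurable
    have "degree g -` R \<inter> space unitM \<in> sets unitM"
      using R by (intro measurable_sets[of _ _ borel]) (auto intro: borel_closed finite_imp_closed)
    then have 2: "{x \<in> space unitM. degree g x \<in> R} \<in> sets unitM" by (simp add: vimage_def Int_def conj_commute)
    have "V i = {x \<in> space unitM. degree g x = r i} \<union> (if i = 0 then space unitM - {x \<in> space unitM. degree g x \<in> R} else {})"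
      by (auto simp: V_def)
    also have "\<dots> \<in> sets unitM" using sets.Un[OF 1 sets.Diff[OF sets.top 2]] 1 by (cases "i = 0") simp_all
    finally show ?thesis .
  qed
  have Vcover: "\<exists>!i. i < n \<and> x \<in> V i" if "x \<in> {0..1}" for x
  proof (cases "degree g x \<in> R")
    case True
    then obtain i where i: "i < n" "degree g x = r i" using r by (auto simp: bij_betw_def)
    show ?thesis
    proof (rule ex1I[of _ i])
      show "i < n \<and> x \<in> V i" using i that by (simp add: V_def)
      fix j assume "j < n \<and> x \<in> V j"
      then show "j = i" using i True r by (auto simp: V_def bij_betw_def inj_on_def)
    qed
  next
    case False
    show ?thesis
    proof (rule ex1I[of _ 0])
      show "0 < n \<and> x \<in> V 0" using n False that by (simp add: V_def)
      fix j assume j: "j < n \<and> x \<in> V j"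
      then have "r j \<in> R" using r by (auto simp: bij_betw_def)
      then show "j = 0" using j False by (auto simp: V_def)
    qed
  qed
  have sumV: "(\<Sum>i<n. indicator (V i) x * f i) = f i" if "i < n" "x \<in> V i" for x i and f :: "nat \<Rightarrow> real"
  proof -
    have x: "x \<in> {0..1}" using that by (simp add: V_def)
    have "(\<Sum>j<n. indicator (V j) x * f j) = (\<Sum>j\<in>{i}. indicator (V j) x * f j)"
      using Vcover[OF x] that by (intro sum.mono_neutral_right) (auto simp: indicator_def)
    then show ?thesis using that by simp
  qed
  define m where "m i = measure unitM (V i)" for i
  let ?B = "\<lambda>i j. V i \<times> V j"
  have Bs: "?B i j \<in> sets squareM" for i j by (intro pair_measureI Vs)
  have mB: "measure squareM (?B i j) = m i * m j" for i j
    unfolding m_def measure_def using Vs by (simp add: unitM.emeasure_pair_measure_Times enn2real_mult)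
  define J where "J i j = (\<integral>p. indicator (?B i j) p * g (fst p) (snd p) \<partial>squareM)" for i j
  define c where "c i j = J i j / measure squareM (?B i j)" for i j
  note jensen = S_ent_jensen[OF Bs gD(1), folded J_def, folded c_def]
  have g01: "0 \<le> g (fst p) (snd p) \<and> g (fst p) (snd p) \<le> 1" if "p \<in> space squareM" for p
    using that gD(3,4) by auto
  have Jsym: "J i j = J j i" for i j
  proof -
    have "bm squareM (\<lambda>p. indicator (?B i j) p * g (fst p) (snd p))" by (intro bm_mult bm_indicator Bs gD(1))
    from squareM_swap[OF this] have "J i j = (\<integral>p. indicator (?B i j) (snd p, fst p) * g (snd p) (fst p) \<partial>squareM)"
      by (simp add: J_def)
    also have "\<dots> = J j i"
      unfolding J_def
    proof (intro Bochner_Integration.integral_cong refl)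
      fix p assume "p \<in> space squareM"
      then have "g (snd p) (fst p) = g (fst p) (snd p)" by (intro gD(2)) auto
      then show "indicator (?B i j) (snd p, fst p) * g (snd p) (fst p) = indicator (?B j i) p * g (fst p) (snd p)"
        by (simp add: indicator_def mem_Times_iff conj_commute)
    qed
    finally show ?thesis .
  qed
  \<comment> \<open>The block average of \<open>g\<close>. On null blocks its value is 0 by division
    by zero; these blocks affect neither degrees nor entropy.\<close>
  define h where "h x y = (\<Sum>i<n. indicator (V i) x * (\<Sum>j<n. indicator (V j) y * c i j))" for x y
  have hV: "h x y = c i j" if "x \<in> V i" "y \<in> V j" "i < n" "j < n" for x y i j
    unfolding h_def using sumV[OF that(3,1), of "\<lambda>i. \<Sum>j<n. indicator (V j) y * c i j"] sumV[OF that(4,2), of "c i"] by simp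
  have bmh: "bm squareM (\<lambda>p. h (fst p) (snd p))"
    unfolding h_def using bm_fst[OF bm_indicator[OF Vs]] bm_snd[OF bm_indicator[OF Vs]]
    by (intro bm_sum bm_mult bm_const)
  have h: "graphon h"
  proof (rule graphonI)
    show "(\<lambda>p. h (fst p) (snd p)) \<in> borel_measurable squareM" by (rule bm_measurable[OF bmh])
    fix x y :: real assume "x \<in> {0..1}" "y \<in> {0..1}"
    then obtain i j where ij: "i < n" "x \<in> V i" "j < n" "y \<in> V j" using Vcover by meson
    have "c i j = c j i" unfolding c_def using Jsym[of i j] by (simp add: mB mult.commute)
    then show "h x y = h y x \<and> 0 \<le> h x y \<and> h x y \<le> 1"
      using ij hV jensen(1,2)[OF g01] by simp
  qed
  have Jsum: "(\<Sum>j<n. J i j) = r i * m i" if "i < n" for i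
  proof -
    have "(\<Sum>j<n. J i j) = (\<integral>p. (\<Sum>j<n. indicator (?B i j) p * g (fst p) (snd p)) \<partial>squareM)"
      unfolding J_def
      by (intro Bochner_Integration.integral_sum[symmetric] squareM.P.bm_integrable bm_mult bm_indicator Bs gD(1))
    also have "\<dots> = (\<integral>p. indicator (V i) (fst p) * g (fst p) (snd p) \<partial>squareM)"
    proof (intro Bochner_Integration.integral_cong refl)
      fix p assume "p \<in> space squareM"
      then have "snd p \<in> {0..1}" by auto
      then obtain j where j: "j < n" "snd p \<in> V j" using Vcover by meson
      have "(\<Sum>j<n. indicator (?B i j) p * g (fst p) (snd p)) =
        (\<Sum>j<n. indicator (V j) (snd p) * (indicator (V i) (fst p) * g (fst p) (snd p)))"
        by (intro sum.cong refl) (auto simp: indicator_def mem_Times_iff)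
      then show "(\<Sum>j<n. indicator (?B i j) p * g (fst p) (snd p)) = indicator (V i) (fst p) * g (fst p) (snd p)"
        using sumV[OF j] by simp
    qed
    also have "\<dots> = (\<integral>x. indicator (V i) x * degree g x \<partial>unitM)"
      using squareM_integral_fst[OF bm_indicator[OF Vs] gD(1)] by (simp add: degree_unitM)
    also have "\<dots> = (\<integral>x. r i * indicator (V i) x \<partial>unitM)"
    proof (rule integral_cong_AE)
      show "AE x in unitM. indicator (V i) x * degree g x = r i * indicator (V i) x"
        using dR by eventually_elim (auto simp: V_def indicator_def)
    qed (use Vs in measurable)
    also have "\<dots> = r i * m i" using sets.sets_into_space[OF Vs[of i]] by (simp add: m_def Int_absorb2)
    finally show ?thesis .
  qed
  \<comment> \<open>Averaging preserves the row sums of \<open>J\<close>, and the row sum of a class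
    is its degree times its mass. The mass must be nonzero to cancel.\<close>
  have degh: "degree h x = r i" if "i < n" "x \<in> V i" "m i \<noteq> 0" for i x
  proof -
    have "degree h x = (\<integral>y. (\<Sum>j<n. indicator (V j) y * c i j) \<partial>unitM)"
      unfolding degree_unitM h_def using sumV[OF that(1,2), of "\<lambda>i. \<Sum>j<n. indicator (V j) _ * c i j"] by simp
    also have "\<dots> = (\<Sum>j<n. \<integral>y. indicator (V j) y * c i j \<partial>unitM)"
      by (intro Bochner_Integration.integral_sum unitM.bm_integrable bm_mult bm_indicator Vs bm_const)
    also have "\<dots> = (\<Sum>j<n. J i j / m i)"
    proof (intro sum.cong refl)
      fix j
      have "(\<integral>y. indicator (V j) y * c i j \<partial>unitM) = m j * c i j"
        using sets.sets_into_space[OF Vs[of j]] by (simp add: m_def Int_absorb2)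
      moreover have "J i j = 0" if "m j = 0"
      proof -
        have "AE p in squareM. p \<notin> ?B i j"
          using that Bs[of i j] mB[of i j] by (intro AE_not_in) (auto simp: null_sets_def squareM.P.emeasure_eq_measure)
        then have "AE p in squareM. indicator (?B i j) p * g (fst p) (snd p) = 0" by eventually_elim auto
        then show ?thesis unfolding J_def by (rule integral_eq_zero_AE)
      qed
      ultimately show "(\<integral>y. indicator (V j) y * c i j \<partial>unitM) = J i j / m i"
        using \<open>m i \<noteq> 0\<close> by (cases "m j = 0") (auto simp: c_def mB)
    qed
    also have "\<dots> = r i" using Jsum[OF that(1)] that(3) by (simp add: sum_divide_distrib[symmetric])
    finally show ?thesis .
  qed
  have "AE x in unitM. \<forall>i. m i = 0 \<longrightarrow> x \<notin> V i"
    unfolding AE_all_countable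
  proof
    fix i show "AE x in unitM. m i = 0 \<longrightarrow> x \<notin> V i"
      using AE_not_in[of "V i" unitM] Vs[of i] by (cases "m i = 0") (auto simp: null_sets_def m_def unitM.emeasure_eq_measure)
  qed
  with dR AE_space[of unitM] have AEdeg: "AE x in unitM. degree h x = degree g x"
  proof eventually_elim
    case (elim x)
    then obtain i where i: "i < n" "x \<in> V i" using Vcover[of x] by auto
    moreover have "m i \<noteq> 0" using elim i by auto
    moreover have "degree g x = r i" using i elim by (auto simp: V_def)
    ultimately show ?case using degh by simp
  qed
  have [measurable]: "degree h \<in> borel_measurable unitM" by (intro bm_measurable degree_bm h)
  have dens: "star_density j h = star_density j g" for j
    unfolding star_density_unitM
  proof (rule integral_cong_AE)
    show "AE x in unitM. degree h x ^ j = degree g x ^ j" using AEdeg by eventually_elim simp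
  qed measurable
  have le: "entropy h \<le> entropy g" by (intro best h dens)
  have split: "(\<integral>p. S_ent (f (fst p) (snd p)) \<partial>squareM) = (\<Sum>i<n. \<Sum>j<n. \<integral>p. indicator (?B i j) p * S_ent (f (fst p) (snd p)) \<partial>squareM)"
    if f: "graphon f" for f
  proof -
    have "(\<integral>p. S_ent (f (fst p) (snd p)) \<partial>squareM) = (\<integral>p. (\<Sum>i<n. \<Sum>j<n. indicator (?B i j) p * S_ent (f (fst p) (snd p))) \<partial>squareM)"
    proof (intro Bochner_Integration.integral_cong refl)
      fix p assume "p \<in> space squareM"
      then have "fst p \<in> {0..1}" "snd p \<in> {0..1}" by auto
      then obtain i j where ij: "i < n" "fst p \<in> V i" "j < n" "snd p \<in> V j" using Vcover by meson
      have "(\<Sum>i<n. \<Sum>j<n. indicator (?B i j) p * S_ent (f (fst p) (snd p))) =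
        (\<Sum>i<n. indicator (V i) (fst p) * (\<Sum>j<n. indicator (V j) (snd p) * S_ent (f (fst p) (snd p))))"
        unfolding sum_distrib_left by (intro sum.cong refl) (auto simp: indicator_def mem_Times_iff)
      also have "\<dots> = S_ent (f (fst p) (snd p))"
        using sumV[OF ij(1,2), of "\<lambda>_. \<Sum>j<n. indicator (V j) (snd p) * S_ent (f (fst p) (snd p))"]
          sumV[OF ij(3,4), of "\<lambda>_. S_ent (f (fst p) (snd p))"] by (simp only:)
      finally show "S_ent (f (fst p) (snd p)) = (\<Sum>i<n. \<Sum>j<n. indicator (?B i j) p * S_ent (f (fst p) (snd p)))" by simp
    qed
    also have "\<dots> = (\<Sum>i<n. \<integral>p. (\<Sum>j<n. indicator (?B i j) p * S_ent (f (fst p) (snd p))) \<partial>squareM)"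
      by (intro Bochner_Integration.integral_sum squareM.P.bm_integrable bm_sum bm_mult bm_indicator Bs S_ent_graphon_bm f)
    also have "\<dots> = (\<Sum>i<n. \<Sum>j<n. \<integral>p. indicator (?B i j) p * S_ent (f (fst p) (snd p)) \<partial>squareM)"
      by (intro sum.cong refl Bochner_Integration.integral_sum squareM.P.bm_integrable bm_mult bm_indicator Bs S_ent_graphon_bm f)
    finally show ?thesis .
  qed
  let ?Ig = "\<lambda>i j. \<integral>p. indicator (?B i j) p * S_ent (g (fst p) (snd p)) \<partial>squareM"
  let ?Ih = "\<lambda>i j. measure squareM (?B i j) * S_ent (c i j)"
  have Ih: "(\<integral>p. indicator (?B i j) p * S_ent (h (fst p) (snd p)) \<partial>squareM) = ?Ih i j" if "i < n" "j < n" for i j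
  proof -
    have "(\<integral>p. indicator (?B i j) p * S_ent (h (fst p) (snd p)) \<partial>squareM) = (\<integral>p. indicator (?B i j) p * S_ent (c i j) \<partial>squareM)"
      using hV that by (intro Bochner_Integration.integral_cong) (auto simp: indicator_def)
    then show ?thesis using sets.sets_into_space[OF Bs[of i j]] by (simp add: Int_absorb2)
  qed
  \<comment> \<open>Maximality bounds the sum over blocks in one direction, Jensen bounds each block
    in the other. Hence every block is an equality case, where \<open>g\<close> is constant.\<close>
  have "(\<Sum>i<n. \<Sum>j<n. ?Ih i j) \<le> (\<Sum>i<n. \<Sum>j<n. ?Ig i j)"
    using le Ih unfolding entropy_squareM split[OF g] split[OF h] by simp
  then have "(\<Sum>p\<in>{..<n}\<times>{..<n}. ?Ih (fst p) (snd p)) \<le> (\<Sum>p\<in>{..<n}\<times>{..<n}. ?Ig (fst p) (snd p))"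
    by (simp add: sum.cartesian_product case_prod_unfold)
  moreover have each: "?Ig i j \<le> ?Ih i j" for i j by (rule jensen(3)[OF g01])
  ultimately have eq: "?Ig (fst q) (snd q) = ?Ih (fst q) (snd q)" if "q \<in> {..<n}\<times>{..<n}" for q
    using that sum_mono_inv[of "\<lambda>p. ?Ig (fst p) (snd p)" "{..<n}\<times>{..<n}" "\<lambda>p. ?Ih (fst p) (snd p)" q]
      sum_mono[of "{..<n}\<times>{..<n}" "\<lambda>p. ?Ig (fst p) (snd p)" "\<lambda>p. ?Ih (fst p) (snd p)"]
    by (simp add: antisym)
  have AEc: "AE z in lborel \<Otimes>\<^sub>M lborel. z \<in> ?B i j \<longrightarrow> g (fst z) (snd z) = c i j" if "i < n" "j < n" for i j
  proof -
    have "AE p in squareM. p \<in> ?B i j \<longrightarrow> g (fst p) (snd p) = c i j"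
      by (rule jensen(4)[OF g01 eq[of "(i, j)", unfolded fst_conv snd_conv]]) (use that in auto)
    moreover have "unit_sq \<in> sets (lborel \<Otimes>\<^sub>M lborel)" unfolding unit_sq_def by (intro pair_measureI) auto
    ultimately have "AE z in lborel \<Otimes>\<^sub>M lborel. z \<in> unit_sq \<longrightarrow> z \<in> ?B i j \<longrightarrow> g (fst z) (snd z) = c i j"
      unfolding squareM_eq by (subst (asm) AE_restrict_space_iff) auto
    then show ?thesis by eventually_elim (auto simp: unit_sq_def V_def)
  qed
  show ?thesis
    unfolding podal_def n_def[symmetric]
  proof (intro exI[of _ n] conjI exI[of _ V] allI impI)
    show "V i \<in> sets lborel" for i
      using Vs[of i] unfolding unitM_def by (auto simp: sets_restrict_space_iff)
    show "(\<Union>i<n. V i) = {0..1}"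
    proof
      show "(\<Union>i<n. V i) \<subseteq> {0..1}" by (auto simp: V_def)
      show "{0..1} \<subseteq> (\<Union>i<n. V i)"
      proof
        fix x :: real assume "x \<in> {0..1}"
        from ex1_implies_ex[OF Vcover[OF this]] show "x \<in> (\<Union>i<n. V i)" by blast
      qed
    qed
    show "V i \<inter> V j = {}" if "i < n" "j < n" "i \<noteq> j" for i j
    proof (rule ccontr)
      assume "V i \<inter> V j \<noteq> {}"
      then obtain x where x: "x \<in> V i" "x \<in> V j" by blast
      then have "x \<in> {0..1}" by (simp add: V_def)
      from Vcover[OF this] show False using x that by blast
    qed
    show "\<exists>c. AE z in lborel \<Otimes>\<^sub>M lborel. z \<in> V i \<times> V j \<longrightarrow> g (fst z) (snd z) = c" if "i < n" "j < n" for i j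
      using AEc[OF that] by blast
  qed simp
qed

section \<open>Maximizers with zero-one values\<close>

lemma density_gap_imp_nontrivial:
  assumes g: "graphon g" and k: "1 \<le> k" and gap: "star_density 1 g ^ k < star_density k g"
  shows "0 < star_density 1 g" "star_density 1 g < 1"
proof -
  show "0 < star_density 1 g"
    using gap star_density_le_1[OF g k] star_density_range[OF g, of 1] k
    by (cases "star_density 1 g = 0") (auto simp: power_0_left)
  show "star_density 1 g < 1"
    using gap star_density_range[OF g, of k] star_density_range[OF g, of 1]
    by (cases "star_density 1 g = 1") auto
qed

text \<open>Everywhere concavity and \<open>S \<le> 1\<close> limit the loss to \<open>e\<close>. At
  \<open>w = 0\<close> the new value is \<open>e * v\<close>, with entropy at least
  \<open>e * a * ln (1 / e)\<close>; \<open>w = 1\<close> is the mirror image. The distance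
  \<open>a\<close> of \<open>v\<close> from both ends makes the gain uniform.\<close>

lemma S_ent_mix_gain:
  assumes w: "0 \<le> w" "w \<le> 1" and v: "a \<le> v" "v \<le> 1 - a" and a: "0 < a" and e: "0 < e" "e \<le> 1"
  shows "S_ent w - e + (if w \<in> {0, 1} then e * a * ln (1 / e) else 0) \<le> S_ent ((1 - e) * w + e * v)"
proof -
  have key: "e * a * ln (1 / e) \<le> S_ent (e * u)" if u: "a \<le> u" "u \<le> 1 - a" for u
  proof -
    have u0: "0 < u" "u \<le> 1" using u a by auto
    have "e * a * ln (1 / e) \<le> (e * u) * ln (1 / (e * u))"
    proof (intro mult_mono)
      have "1 / e \<le> 1 / (e * u)" using u0 e by (simp add: frac_le)
      then show "ln (1 / e) \<le> ln (1 / (e * u))" using u0 e by (subst ln_le_cancel_iff) auto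
    qed (use u0 e u a in auto)
    also have "\<dots> \<le> S_ent (e * u)" using u0 e by (intro S_ent_ge_xlogx) (auto intro: mult_le_one)
    finally show ?thesis .
  qed
  consider "w = 0" | "w = 1" | "w \<notin> {0, 1}" by auto
  then show ?thesis
  proof cases
    case 1
    then show ?thesis using key[OF v] e by simp
  next
    case 2
    have "(1 - e) * w + e * v = 1 - e * (1 - v)" using 2 by (simp add: algebra_simps)
    then have "S_ent ((1 - e) * w + e * v) = S_ent (e * (1 - v))" by (simp only: S_ent_reflect)
    then show ?thesis using 2 key[of "1 - v"] v e by simp
  next
    case 3
    have v01: "0 \<le> v" "v \<le> 1" using v a by auto
    have "S_ent w - e \<le> (1 - e) * S_ent w + e * S_ent v"
    proof -
      have "e * S_ent w \<le> e * 1" using S_ent_le_1[OF w] e by (intro mult_left_mono) auto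
      moreover have "0 \<le> e * S_ent v" using S_ent_nonneg[OF v01] e by simp
      ultimately show ?thesis by (simp add: algebra_simps)
    qed
    also have "\<dots> \<le> S_ent ((1 - e) * w + e * v)" using w v01 e by (intro S_ent_concave) auto
    finally show ?thesis using 3 by simp
  qed
qed

definition pure_set :: "(real \<Rightarrow> real \<Rightarrow> real) \<Rightarrow> (real \<times> real) set" where
  "pure_set g = {p \<in> space squareM. g (fst p) (snd p) \<in> {0, 1}}"

lemma pure_set_sets: "graphon g \<Longrightarrow> pure_set g \<in> sets squareM"
proof -
  assume "graphon g"
  then have [measurable]: "(\<lambda>p. g (fst p) (snd p)) \<in> borel_measurable squareM" by (intro bm_measurable graphonD)
  have "pure_set g = {p \<in> space squareM. g (fst p) (snd p) = 0} \<union> {p \<in> space squareM. g (fst p) (snd p) = 1}"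
    by (auto simp: pure_set_def)
  also have "\<dots> \<in> sets squareM" by measurable
  finally show ?thesis .
qed

text \<open>A gain \<open>e * ln (1 / e)\<close> cannot be paid at a linear price; the common factor
  \<open>e\<close> is already divided out.\<close>

lemma log_unbounded_contradiction:
  assumes "0 < (c::real)" "\<And>e. 0 < e \<Longrightarrow> e \<le> e0 \<Longrightarrow> c * ln (1 / e) \<le> K" "0 < e0"
  shows False
proof -
  define e where "e = min e0 (exp (- ((\<bar>K\<bar> + 1) / c)))"
  have e: "0 < e" "e \<le> e0" "e \<le> exp (- ((\<bar>K\<bar> + 1) / c))" using assms by (auto simp: e_def)
  have "(\<bar>K\<bar> + 1) / c \<le> ln (1 / e)"
    using e ln_le_cancel_iff[of e "exp (- ((\<bar>K\<bar> + 1) / c))"] by (simp add: ln_div)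
  then have "c * ((\<bar>K\<bar> + 1) / c) \<le> c * ln (1 / e)" using assms by (intro mult_left_mono) auto
  then show False using assms(2)[OF e(1,2)] assms(1) by auto
qed

text \<open>Moving a \<open>0\<close>-\<open>1\<close> valued part into the interior by \<open>e\<close> gains entropy of order \<open>e * ln (1 / e)\<close>, which beats
  the linear price of \<open>maximizer_penalty\<close>; so no direction may increase \<open>tk\<close> to first order.\<close>

lemma pure_maximizer_linear_optimal:
  assumes max: "entropy_maximizer k \<tau> g" and k: "2 \<le> k" and gap: "star_density 1 g ^ k < star_density k g"
    and pure: "0 < measure squareM (pure_set g)"
    and h: "graphon h" "star_density 1 h = star_density 1 g"
  shows "(\<integral>x. degree g x ^ (k - 1) * degree h x \<partial>unitM) \<le> (\<integral>x. degree g x ^ (k - 1) * degree g x \<partial>unitM)"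
proof (rule ccontr)
  assume less: "\<not> ?thesis"
  define \<kappa> where "\<kappa> = (\<integral>x. degree g x ^ (k - 1) * degree h x \<partial>unitM) - (\<integral>x. degree g x ^ (k - 1) * degree g x \<partial>unitM)"
  have \<kappa>: "0 < \<kappa>" using less by (simp add: \<kappa>_def)
  have g: "graphon g" using max by (simp add: entropy_maximizer_def)
  have k1: "1 \<le> k" using k by simp
  let ?t = "star_density 1 g"
  have t: "0 < ?t" "?t < 1" using density_gap_imp_nontrivial[OF g k1 gap] by auto
  have tt: "0 \<le> ?t" "?t \<le> 1" using t by auto
  \<comment> \<open>Mixing \<open>h\<close> with the constant \<open>t1\<close> at weight
    \<open>c\<close> keeps its values at distance \<open>c * \<eta>\<close> from 0 and 1. The choice
    \<open>c \<le> \<kappa> / 2\<close> sacrifices at most half of the first-order gain.\<close>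
  define c where "c = min (1/2) (\<kappa> / 2)"
  have c: "0 < c" "c \<le> 1" "c \<le> \<kappa> / 2" using \<kappa> by (auto simp: c_def)
  define \<eta> where "\<eta> = min ?t (1 - ?t)"
  have \<eta>: "0 < \<eta>" "\<eta> \<le> ?t" "\<eta> \<le> 1 - ?t" using t by (auto simp: \<eta>_def)
  define h' where "h' = (\<lambda>x y. (1 - c) * h x y + c * ?t)"
  have h': "graphon h'" unfolding h'_def using c by (intro graphon_mix graphon_const h tt) auto
  have h'r: "c * \<eta> \<le> h' x y" "h' x y \<le> 1 - c * \<eta>" if "x \<in> {0..1}" "y \<in> {0..1}" for x y
  proof -
    have a: "0 \<le> (1 - c) * h x y" "(1 - c) * h x y \<le> (1 - c) * 1"
      using graphonD(3,4)[OF h(1) that] c by (intro mult_nonneg_nonneg mult_left_mono; simp)+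
    have b: "c * \<eta> \<le> c * ?t" "c * \<eta> \<le> c * (1 - ?t)" using \<eta> c by (intro mult_left_mono; simp)+
    show "c * \<eta> \<le> h' x y" using a b unfolding h'_def by linarith
    show "h' x y \<le> 1 - c * \<eta>" using a b unfolding h'_def by (simp add: algebra_simps)
  qed
  have bp: "bm unitM (\<lambda>x. degree g x ^ (k - 1))" by (intro star_density_bm g)
  have deg_h': "degree h' x = (1 - c) * degree h x + c * ?t" if "x \<in> {0..1}" for x
    unfolding h'_def using degree_mix[OF h(1) graphon_const[OF tt] that, of c] by (simp add: degree_const)
  have int: "integrable unitM (\<lambda>x. degree g x ^ (k - 1) * degree f x)" if "graphon f" for f
    by (intro unitM.bm_integrable bm_mult bp degree_bm that)
  have gain: "\<kappa> / 2 \<le> (\<integral>x. degree g x ^ (k - 1) * degree h' x \<partial>unitM) - (\<integral>x. degree g x ^ (k - 1) * degree g x \<partial>unitM)"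
  proof -
    have "(\<integral>x. degree g x ^ (k - 1) * degree h x - c \<partial>unitM) \<le> (\<integral>x. degree g x ^ (k - 1) * degree h' x \<partial>unitM)"
    proof (rule integral_mono)
      fix x assume "x \<in> space unitM"
      then have x: "x \<in> {0..1}" by simp
      have p: "0 \<le> degree g x ^ (k - 1)" "degree g x ^ (k - 1) \<le> 1"
        using degree_range[OF g x] by (auto intro: power_le_one)
      have "degree g x ^ (k - 1) * (degree h x - ?t) \<le> degree g x ^ (k - 1) * 1"
        using degree_range[OF h(1) x] t p by (intro mult_left_mono) auto
      then have "degree g x ^ (k - 1) * (degree h x - ?t) \<le> 1" using p by simp
      then have "c * (degree g x ^ (k - 1) * (degree h x - ?t)) \<le> c * 1" using c by (intro mult_left_mono) auto
      then show "degree g x ^ (k - 1) * degree h x - c \<le> degree g x ^ (k - 1) * degree h' x"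
        unfolding deg_h'[OF x] by (simp add: algebra_simps)
    qed (use int h h' in auto)
    then show ?thesis using int[OF h(1)] c by (simp add: \<kappa>_def)
  qed
  obtain C where C: "0 \<le> C"
    "\<And>h. graphon h \<Longrightarrow> C * \<bar>star_density 1 h - ?t\<bar> \<le> star_density k h - star_density k g \<Longrightarrow>
       entropy h \<le> entropy g + C * (star_density k h - star_density k g)"
    using maximizer_penalty[OF max k1 gap] by blast
  let ?N = "measure squareM (pure_set g)"
  have "(?N * c * \<eta>) * ln (1 / e) \<le> 1 + 2 * C * real k" if e: "0 < e" "e \<le> 1" for e
  proof -
    define f where "f = (\<lambda>x y. (1 - e) * g x y + e * h' x y)"
    have f: "graphon f" unfolding f_def using e by (intro graphon_mix g h') auto
    have "star_density 1 h' = ?t"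
      unfolding h'_def using star_density_1_mix[OF h(1) graphon_const[OF tt], of c] star_density_const[of 1 ?t] h(2)
      by (simp add: algebra_simps)
    then have ft: "star_density 1 f = ?t"
      unfolding f_def using star_density_1_mix[OF g h', of e] by (simp add: algebra_simps)
    have deg_f: "degree f x = (1 - e) * degree g x + e * degree h' x" if "x \<in> {0..1}" for x
      unfolding f_def by (rule degree_mix[OF g h' that])
    have "\<bar>star_density k f - star_density k g\<bar> \<le> real k * e"
    proof (rule star_density_lipschitz[OF g f])
      fix x :: real assume x: "x \<in> {0..1}"
      have "degree f x - degree g x = e * (degree h' x - degree g x)" using deg_f[OF x] by (simp add: algebra_simps)
      also have "\<bar>\<dots>\<bar> \<le> e * 1" unfolding abs_mult
        using e degree_range[OF g x] degree_range[OF h' x] by (intro mult_mono) auto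
      finally show "\<bar>degree f x - degree g x\<bar> \<le> e" by simp
    qed
    then have up: "star_density k f - star_density k g \<le> real k * e" by simp
    \<comment> \<open>The tangent inequality for the power makes the first-order gain a lower bound
      for \<open>tk\<close> itself, so the penalty condition holds with \<open>t1\<close>
      exact.\<close>
    have "star_density k g + real k * e * (\<kappa> / 2) \<le> (\<integral>x. degree g x ^ k + real k * e * (degree g x ^ (k - 1) * degree h' x - degree g x ^ (k - 1) * degree g x) \<partial>unitM)"
      using int[OF g] int[OF h'] unitM.bm_integrable[OF star_density_bm[OF g, of k]] mult_left_mono[OF gain, of "real k * e"] e
      by (simp add: star_density_unitM[of k])
    also have "\<dots> \<le> star_density k f"
      unfolding star_density_unitM[of k]
    proof (rule integral_mono)
      fix x assume "x \<in> space unitM"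
      then have x: "x \<in> {0..1}" by simp
      have "degree g x ^ k + real k * degree g x ^ (k - 1) * (degree f x - degree g x) \<le> degree f x ^ k"
        using degree_range[OF g x] degree_range[OF f x] by (intro power_above_tangent) auto
      then show "degree g x ^ k + real k * e * (degree g x ^ (k - 1) * degree h' x - degree g x ^ (k - 1) * degree g x) \<le> degree f x ^ k"
        unfolding deg_f[OF x] by (simp add: algebra_simps)
    next
      show "integrable unitM (\<lambda>x. degree g x ^ k + real k * e * (degree g x ^ (k - 1) * degree h' x - degree g x ^ (k - 1) * degree g x))"
        using int[OF g] int[OF h'] unitM.bm_integrable[OF star_density_bm[OF g, of k]] by auto
    qed (rule unitM.bm_integrable[OF star_density_bm[OF f]])
    finally have "star_density k g + real k * e * (\<kappa> / 2) \<le> star_density k f" .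
    moreover have "0 \<le> real k * e * (\<kappa> / 2)" using e \<kappa> by simp
    ultimately have "star_density k g \<le> star_density k f" by linarith
    then have "entropy f \<le> entropy g + C * (star_density k f - star_density k g)"
      using ft by (intro C(2) f) auto
    also have "\<dots> \<le> entropy g + C * (real k * e)" using up C(1) by (intro add_left_mono mult_left_mono) auto
    finally have upper: "entropy f \<le> entropy g + C * (real k * e)" .
    have iS: "integrable squareM (\<lambda>p. S_ent (g (fst p) (snd p)))" "integrable squareM (\<lambda>p. indicator (pure_set g) p :: real)"
      by (intro squareM.P.bm_integrable S_ent_graphon_bm g bm_indicator pure_set_sets)+
    have "(\<integral>p. S_ent (g (fst p) (snd p)) - e + indicator (pure_set g) p * (e * (c * \<eta>) * ln (1 / e)) \<partial>squareM)
        \<le> (\<integral>p. S_ent (f (fst p) (snd p)) \<partial>squareM)"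
    proof (rule integral_mono)
      fix p assume p: "p \<in> space squareM"
      then have p': "fst p \<in> {0..1}" "snd p \<in> {0..1}" by auto
      show "S_ent (g (fst p) (snd p)) - e + indicator (pure_set g) p * (e * (c * \<eta>) * ln (1 / e)) \<le> S_ent (f (fst p) (snd p))"
        using S_ent_mix_gain[OF graphonD(3,4)[OF g p'] h'r[OF p'], of e] e c \<eta> p
        by (auto simp: f_def pure_set_def indicator_def)
    qed (use iS squareM.P.bm_integrable[OF S_ent_graphon_bm[OF f]] in auto)
    moreover have "pure_set g \<subseteq> {0..1} \<times> {0..1}" by (auto simp: pure_set_def)
    ultimately have "(\<integral>p. S_ent (g (fst p) (snd p)) \<partial>squareM) - e + ?N * (e * (c * \<eta>) * ln (1 / e)) \<le> (\<integral>p. S_ent (f (fst p) (snd p)) \<partial>squareM)"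
      using iS by (simp add: Int_absorb2)
    then have "2 * entropy g - e + ?N * (e * (c * \<eta>) * ln (1 / e)) \<le> 2 * entropy f"
      unfolding entropy_squareM by simp
    then have "e * ((?N * c * \<eta>) * ln (1 / e)) \<le> e * (1 + 2 * C * real k)"
      using upper by (simp add: algebra_simps)
    then show ?thesis using e by (simp add: mult_le_cancel_left)
  qed
  then show False
    using pure c \<eta> by (intro log_unbounded_contradiction[of "?N * c * \<eta>" 1 "1 + 2 * C * real k"]) auto
qed

section \<open>Threshold structure of zero-one maximizers\<close>

lemma selfadjoint_degree:
  assumes g: "graphon g" and a: "bm unitM a" and b: "bm unitM b"
  shows "(\<integral>x. a x * (\<integral>y. b y * g x y \<partial>unitM) \<partial>unitM) = (\<integral>x. b x * (\<integral>y. a y * g x y \<partial>unitM) \<partial>unitM)"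
proof -
  note gb = graphonD(1)[OF g]
  have F: "bm squareM (\<lambda>p. a (fst p) * (b (snd p) * g (fst p) (snd p)))" by (intro bm_mult bm_fst bm_snd gb a b)
  have "(\<integral>x. a x * (\<integral>y. b y * g x y \<partial>unitM) \<partial>unitM) = (\<integral>p. a (fst p) * (b (snd p) * g (fst p) (snd p)) \<partial>squareM)"
    using squareM_integral_fst[OF a bm_mult[OF bm_snd[OF b] gb]] by simp
  also have "\<dots> = (\<integral>p. a (snd p) * (b (fst p) * g (snd p) (fst p)) \<partial>squareM)"
    using squareM_swap[OF F] by simp
  also have "\<dots> = (\<integral>p. b (fst p) * (a (snd p) * g (fst p) (snd p)) \<partial>squareM)"
  proof (intro Bochner_Integration.integral_cong refl)
    fix p assume "p \<in> space squareM"
    then have "g (snd p) (fst p) = g (fst p) (snd p)" by (intro graphonD(2)[OF g]) auto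
    then show "a (snd p) * (b (fst p) * g (snd p) (fst p)) = b (fst p) * (a (snd p) * g (fst p) (snd p))" by simp
  qed
  also have "\<dots> = (\<integral>x. b x * (\<integral>y. a y * g x y \<partial>unitM) \<partial>unitM)"
    using squareM_integral_fst[OF b bm_mult[OF bm_snd[OF a] gb]] by simp
  finally show ?thesis .
qed

lemma integral_weighted_section:
  assumes g: "graphon g" and b: "bm unitM b"
  shows "(\<integral>x. (\<integral>y. b y * g x y \<partial>unitM) \<partial>unitM) = (\<integral>x. b x * degree g x \<partial>unitM)"
  using selfadjoint_degree[OF g bm_const[of _ 1] b] by (simp add: degree_unitM)

lemma weighted_section_bm:
  assumes g: "graphon g" and b: "bm unitM b"
  shows "bm unitM (\<lambda>x. \<integral>y. b y * g x y \<partial>unitM)"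
  using bm_integral_snd[OF bm_mult[OF bm_snd[OF b] graphonD(1)[OF g]]] by simp

text \<open>By symmetry the integral of \<open>d ^ (k - 1)\<close> against the degree of
  \<open>h\<close> is half the integral of \<open>D\<close> against \<open>h\<close>. Maximizing
  this linear functional at fixed integral of \<open>h\<close> is a bathtub problem: mass sits where
  \<open>D\<close> is largest. Nothing is claimed where \<open>D\<close> equals the level
  \<open>c\<close>.\<close>

lemma pure_maximizer_threshold:
  assumes max: "entropy_maximizer k \<tau> g" and k: "2 \<le> k" and gap: "star_density 1 g ^ k < star_density k g"
    and pure: "0 < measure squareM (pure_set g)"
  defines "D \<equiv> \<lambda>p. degree g (fst p) ^ (k - 1) + degree g (snd p) ^ (k - 1)"
  obtains c where "AE p in squareM. (D p < c \<longrightarrow> g (fst p) (snd p) = 0) \<and> (c < D p \<longrightarrow> g (fst p) (snd p) = 1)"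
proof -
  have g: "graphon g" using max by (simp add: entropy_maximizer_def)
  have k1: "1 \<le> k" using k by simp
  note gb = graphonD(1)[OF g]
  note t = density_gap_imp_nontrivial[OF g k1 gap]
  have bp: "bm unitM (\<lambda>x. degree g x ^ (k - 1))" by (intro star_density_bm g)
  have bD: "bm squareM D" unfolding D_def by (intro bm_add bm_fst[OF bp] bm_snd[OF bp])
  have [measurable]: "D \<in> borel_measurable squareM" "(\<lambda>p. g (fst p) (snd p)) \<in> borel_measurable squareM"
    by (intro bm_measurable bD gb)+
  have D01: "0 \<le> D p" "D p \<le> 2" if "p \<in> space squareM" for p
    using that degree_range[OF g, of "fst p"] degree_range[OF g, of "snd p"]
      power_le_one[of "degree g (fst p)" "k - 1"] power_le_one[of "degree g (snd p)" "k - 1"]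
    by (auto simp: D_def)
  define lo where "lo c = {p \<in> space squareM. D p < c}" for c
  define hi where "hi c = {p \<in> space squareM. c < D p}" for c
  have lohi: "lo c \<in> sets squareM" "hi c \<in> sets squareM" for c unfolding lo_def hi_def by measurable
  define A where "A c = (\<integral>p. indicator (lo c) p * g (fst p) (snd p) \<partial>squareM)" for c
  define A' where "A' c = (\<integral>p. indicator (hi c) p * (1 - g (fst p) (snd p)) \<partial>squareM)" for c
  have iA: "integrable squareM (\<lambda>p. indicator (lo c) p * g (fst p) (snd p))"
    and iA': "integrable squareM (\<lambda>p. indicator (hi c) p * (1 - g (fst p) (snd p)))" for c
    by (intro squareM.P.bm_integrable bm_mult bm_indicator lohi bm_diff bm_const gb)+
  have g01: "0 \<le> g (fst p) (snd p)" "g (fst p) (snd p) \<le> 1" if "p \<in> space squareM" for p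
    using that graphonD(3,4)[OF g] by auto
  have Apos: "0 \<le> A c" "0 \<le> A' c" for c
    unfolding A_def A'_def using g01 by (intro integral_nonneg_AE AE_I2; auto simp: indicator_def)+
  have A0: "AE p in squareM. D p < c \<longrightarrow> g (fst p) (snd p) = 0" if "A c = 0" for c
  proof -
    have "AE p in squareM. indicator (lo c) p * g (fst p) (snd p) = 0"
      using that g01 unfolding A_def
      by (subst (asm) integral_nonneg_eq_0_iff_AE[OF iA]) (auto simp: indicator_def intro!: AE_I2)
    with AE_space[of squareM] show ?thesis by eventually_elim (auto simp: lo_def)
  qed
  have A'0: "AE p in squareM. c < D p \<longrightarrow> g (fst p) (snd p) = 1" if "A' c = 0" for c
  proof -
    have "AE p in squareM. indicator (hi c) p * (1 - g (fst p) (snd p)) = 0"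
      using that g01 unfolding A'_def
      by (subst (asm) integral_nonneg_eq_0_iff_AE[OF iA']) (auto simp: indicator_def intro!: AE_I2)
    with AE_space[of squareM] show ?thesis by eventually_elim (auto simp: hi_def)
  qed
  \<comment> \<open>If \<open>g\<close> had mass below level \<open>c1\<close> and room above level
    \<open>c2\<close>, moving some of it upward would increase the functional at fixed
    \<open>t1\<close>.\<close>
  have exchange: "A c1 = 0 \<or> A' c2 = 0" if "c1 < c2" for c1 c2
  proof (rule ccontr)
    assume "\<not> ?thesis"
    then have pos: "0 < A c1" "0 < A' c2" using Apos[of c1] Apos[of c2] by auto
    \<comment> \<open>\<open>s\<close> and \<open>s'\<close> balance the mass removed and the mass
      added; both are at most 1, so \<open>h\<close> stays between 0 and 1.\<close>
    define s where "s = A' c2 / (A c1 + A' c2)"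
    define s' where "s' = A c1 / (A c1 + A' c2)"
    have s: "0 < s" "s \<le> 1" "0 < s'" "s' \<le> 1" using pos by (auto simp: s_def s'_def)
    have bal: "s' * A' c2 = s * A c1" by (simp add: s_def s'_def)
    define \<phi> where "\<phi> p = s' * (indicator (hi c2) p * (1 - g (fst p) (snd p))) - s * (indicator (lo c1) p * g (fst p) (snd p))" for p
    define h where "h x y = g x y + \<phi> (x, y)" for x y
    have b\<phi>: "bm squareM \<phi>" unfolding \<phi>_def
      by (intro bm_diff bm_mult bm_const bm_indicator lohi gb)
    have hg: "graphon h"
    proof (rule graphonI)
      have "bm squareM (\<lambda>p. g (fst p) (snd p) + \<phi> p)" by (intro bm_add gb b\<phi>)
      then show "(\<lambda>p. h (fst p) (snd p)) \<in> borel_measurable squareM"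
        unfolding h_def by (simp add: bm_measurable)
      fix x y :: real assume xy: "x \<in> {0..1}" "y \<in> {0..1}"
      have Dsym: "D (x, y) = D (y, x)" by (simp add: D_def)
      have gsym: "g x y = g y x" by (rule graphonD(2)[OF g xy])
      have "h x y = h y x" using xy gsym Dsym by (simp add: h_def \<phi>_def indicator_def lo_def hi_def)
      moreover have "0 \<le> h x y \<and> h x y \<le> 1"
      proof -
        have gxy: "0 \<le> g x y" "g x y \<le> 1" using graphonD(3,4)[OF g xy] by auto
        have m: "0 \<le> s' * (1 - g x y)" "s' * (1 - g x y) \<le> 1 * (1 - g x y)" "s * g x y \<le> 1 * g x y" "0 \<le> s * g x y"
          using gxy s by (intro mult_nonneg_nonneg mult_right_mono; simp)+
        have "\<not> (D (x, y) < c1 \<and> c2 < D (x, y))" using that by linarith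
        then consider "c2 < D (x, y)" "\<not> D (x, y) < c1" | "\<not> c2 < D (x, y)" "D (x, y) < c1" | "\<not> c2 < D (x, y)" "\<not> D (x, y) < c1"
          by blast
        then show ?thesis
          by cases (use xy gxy m in \<open>auto simp: h_def \<phi>_def indicator_def lo_def hi_def\<close>)
      qed
      ultimately show "h x y = h y x \<and> 0 \<le> h x y \<and> h x y \<le> 1" by simp
    qed
    have i\<phi>: "(\<integral>p. \<phi> p \<partial>squareM) = 0"
      unfolding \<phi>_def using iA[of c1] iA'[of c2] bal by (simp add: A_def A'_def)
    have ih: "(\<integral>p. f p * h (fst p) (snd p) \<partial>squareM) = (\<integral>p. f p * g (fst p) (snd p) \<partial>squareM) + (\<integral>p. f p * \<phi> p \<partial>squareM)"
      if "bm squareM f" for f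
      unfolding h_def using squareM.P.bm_integrable[OF bm_mult[OF that gb]] squareM.P.bm_integrable[OF bm_mult[OF that b\<phi>]]
      by (simp add: algebra_simps)
    have t1: "star_density 1 f = (\<integral>p. f (fst p) (snd p) \<partial>squareM)" if "graphon f" for f
      using squareM_iterate[OF graphonD(1)[OF that]] by (simp add: star_density_unitM degree_unitM)
    have "star_density 1 h = star_density 1 g"
      unfolding t1[OF hg] t1[OF g] using ih[OF bm_const[of _ 1]] i\<phi> by simp
    from pure_maximizer_linear_optimal[OF max k gap pure hg this]
    have "(\<integral>x. degree g x ^ (k - 1) * degree h x \<partial>unitM) \<le> (\<integral>x. degree g x ^ (k - 1) * degree g x \<partial>unitM)" .
    moreover have dd: "(\<integral>x. degree g x ^ (k - 1) * degree f x \<partial>unitM) = (\<integral>p. degree g (fst p) ^ (k - 1) * f (fst p) (snd p) \<partial>squareM)"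
      if "graphon f" for f
      using squareM_integral_fst[OF bp graphonD(1)[OF that]] by (simp add: degree_unitM)
    ultimately have "(\<integral>p. degree g (fst p) ^ (k - 1) * \<phi> p \<partial>squareM) \<le> 0"
      using ih[OF bm_fst[OF bp]] dd[OF g] dd[OF hg] by simp
    moreover have "(\<integral>p. degree g (snd p) ^ (k - 1) * \<phi> p \<partial>squareM) = (\<integral>p. degree g (fst p) ^ (k - 1) * \<phi> p \<partial>squareM)"
    proof -
      have "(\<integral>p. degree g (snd p) ^ (k - 1) * \<phi> p \<partial>squareM) = (\<integral>p. degree g (fst p) ^ (k - 1) * \<phi> (snd p, fst p) \<partial>squareM)"
        using squareM_swap[OF bm_mult[OF bm_snd[OF bp] b\<phi>]] by simp
      also have "\<dots> = (\<integral>p. degree g (fst p) ^ (k - 1) * \<phi> p \<partial>squareM)"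
      proof (intro Bochner_Integration.integral_cong refl)
        fix p assume "p \<in> space squareM"
        then have "fst p \<in> {0..1}" "snd p \<in> {0..1}" by auto
        then have "h (snd p) (fst p) = h (fst p) (snd p)" "g (snd p) (fst p) = g (fst p) (snd p)"
          using graphonD(2)[OF hg] graphonD(2)[OF g] by auto
        then show "degree g (fst p) ^ (k - 1) * \<phi> (snd p, fst p) = degree g (fst p) ^ (k - 1) * \<phi> p"
          by (simp add: h_def)
      qed
      finally show ?thesis .
    qed
    ultimately have "(\<integral>p. D p * \<phi> p \<partial>squareM) \<le> 0"
      unfolding D_def using squareM.P.bm_integrable[OF bm_mult[OF bm_fst[OF bp] b\<phi>]] squareM.P.bm_integrable[OF bm_mult[OF bm_snd[OF bp] b\<phi>]]
      by (simp add: algebra_simps)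
    moreover have "c2 * (s' * A' c2) - c1 * (s * A c1) \<le> (\<integral>p. D p * \<phi> p \<partial>squareM)"
    proof -
      have "c2 * (s' * A' c2) - c1 * (s * A c1) =
        (\<integral>p. c2 * (s' * (indicator (hi c2) p * (1 - g (fst p) (snd p)))) - c1 * (s * (indicator (lo c1) p * g (fst p) (snd p))) \<partial>squareM)"
        using iA[of c1] iA'[of c2] by (simp add: A_def A'_def)
      also have "\<dots> \<le> (\<integral>p. D p * \<phi> p \<partial>squareM)"
      proof (rule integral_mono)
        fix p assume p: "p \<in> space squareM"
        have "c2 * (s' * (indicator (hi c2) p * (1 - g (fst p) (snd p)))) \<le> D p * (s' * (indicator (hi c2) p * (1 - g (fst p) (snd p))))"
          using s g01[OF p] by (cases "p \<in> hi c2") (auto simp: hi_def intro!: mult_right_mono)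
        moreover have "D p * (s * (indicator (lo c1) p * g (fst p) (snd p))) \<le> c1 * (s * (indicator (lo c1) p * g (fst p) (snd p)))"
          using s g01[OF p] by (cases "p \<in> lo c1") (auto simp: lo_def intro!: mult_right_mono)
        ultimately show "c2 * (s' * (indicator (hi c2) p * (1 - g (fst p) (snd p)))) - c1 * (s * (indicator (lo c1) p * g (fst p) (snd p))) \<le> D p * \<phi> p"
          unfolding \<phi>_def right_diff_distrib by linarith
      qed (use iA[of c1] iA'[of c2] squareM.P.bm_integrable[OF bm_mult[OF bD b\<phi>]] in auto)
      finally show ?thesis .
    qed
    moreover have "0 < (c2 - c1) * (s * A c1)" using that s pos by simp
    ultimately show False unfolding bal by (simp add: algebra_simps)
  qed
  \<comment> \<open>\<open>U\<close> collects the levels below which \<open>g\<close> vanishes, and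
    the threshold is its supremum. It contains 0 because \<open>D \<ge> 0\<close>, and it is bounded
    because \<open>D \<le> 2\<close> and \<open>t1 > 0\<close>.\<close>
  define U where "U = {c. A c = 0}"
  have U0: "0 \<in> U"
  proof -
    have "lo 0 = {}" using D01 by (auto simp: lo_def not_less)
    then show ?thesis by (simp add: U_def A_def)
  qed
  have Ub: "c \<le> 3" if "c \<in> U" for c
  proof (rule ccontr)
    assume "\<not> c \<le> 3"
    then have Dc: "D p < c" if "p \<in> space squareM" for p using D01[OF that] by linarith
    have "AE p in squareM. D p < c \<longrightarrow> g (fst p) (snd p) = 0" using A0 that by (simp add: U_def)
    then have "AE p in squareM. g (fst p) (snd p) = 0"
      using AE_space[of squareM] by eventually_elim (use Dc in blast)
    then have "(\<integral>p. g (fst p) (snd p) \<partial>squareM) = 0" by (rule integral_eq_zero_AE)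
    moreover have "star_density 1 g = (\<integral>p. g (fst p) (snd p) \<partial>squareM)"
      using squareM_iterate[OF gb] by (simp add: star_density_unitM degree_unitM)
    ultimately show False using t by simp
  qed
  have bdd: "bdd_above U" using Ub by (auto intro!: bdd_aboveI)
  define c where "c = Sup U"
  have L: "AE p in squareM. D p < c - 1 / real (Suc n) \<longrightarrow> g (fst p) (snd p) = 0" for n
  proof -
    obtain u where u: "u \<in> U" "c - 1 / real (Suc n) < u"
      using less_cSup_iff[of U "c - 1 / real (Suc n)"] U0 bdd by (auto simp: c_def)
    have "AE p in squareM. D p < u \<longrightarrow> g (fst p) (snd p) = 0" using A0 u by (simp add: U_def)
    then show ?thesis by eventually_elim (use u in auto)
  qed
  have H: "AE p in squareM. c + 1 / real (Suc n) < D p \<longrightarrow> g (fst p) (snd p) = 1" for n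
  proof -
    have "c + 1 / real (Suc n) / 2 \<notin> U" using cSup_upper[OF _ bdd, of "c + 1 / real (Suc n) / 2"] by (auto simp: c_def[symmetric])
    moreover have half: "c + z / 2 < c + z" if "0 < z" for z :: real using that by simp
    have "c + 1 / real (Suc n) / 2 < c + 1 / real (Suc n)" by (rule half) simp
    ultimately have "A' (c + 1 / real (Suc n)) = 0"
      using exchange unfolding U_def mem_Collect_eq by blast
    then show ?thesis by (rule A'0)
  qed
  have "AE p in squareM. \<forall>n. D p < c - 1 / real (Suc n) \<longrightarrow> g (fst p) (snd p) = 0"
    unfolding AE_all_countable using L by blast
  moreover have "AE p in squareM. \<forall>n. c + 1 / real (Suc n) < D p \<longrightarrow> g (fst p) (snd p) = 1"
    unfolding AE_all_countable using H by blast
  ultimately have "AE p in squareM. (D p < c \<longrightarrow> g (fst p) (snd p) = 0) \<and> (c < D p \<longrightarrow> g (fst p) (snd p) = 1)"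
  proof eventually_elim
    case (elim p)
    have "\<exists>n. 1 / real (Suc n) < \<bar>D p - c\<bar>" if "D p \<noteq> c"
      using reals_Archimedean[of "\<bar>D p - c\<bar>"] that by (auto simp: inverse_eq_divide)
    then obtain n where n: "D p \<noteq> c \<longrightarrow> 1 / real (Suc n) < \<bar>D p - c\<bar>" by blast
    then have "D p < c \<longrightarrow> D p < c - 1 / real (Suc n)" "c < D p \<longrightarrow> c + 1 / real (Suc n) < D p" by auto
    then show ?case using elim by blast
  qed
  then show ?thesis by (rule that)
qed

lemma degree_support_range:
  assumes g: "graphon g" and r: "r \<in> degree_support g"
  shows "0 \<le> r" "r \<le> 1"
proof -
  have ne: "{x \<in> {0..1}. \<bar>degree g x - r\<bar> < \<eta>} \<noteq> {}" if "0 < \<eta>" for \<eta>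
  proof
    assume "{x \<in> {0..1}. \<bar>degree g x - r\<bar> < \<eta>} = {}"
    then have "measure unitM {x \<in> {0..1}. \<bar>degree g x - r\<bar> < \<eta>} = 0" by (simp only: measure_empty)
    then show False using r that unfolding degree_support_def by force
  qed
  show "0 \<le> r"
  proof (rule ccontr)
    assume "\<not> 0 \<le> r"
    then obtain x where "x \<in> {0..1}" "\<bar>degree g x - r\<bar> < - r" using ne[of "- r"] by auto
    then show False using degree_range[OF g, of x] by linarith
  qed
  show "r \<le> 1"
  proof (rule ccontr)
    assume "\<not> r \<le> 1"
    then obtain x where "x \<in> {0..1}" "\<bar>degree g x - r\<bar> < r - 1" using ne[of "r - 1"] by auto
    then show False using degree_range[OF g, of x] by linarith
  qed
qed

lemma integral_indicator_average:
  assumes g: "graphon g" and B: "B \<in> sets unitM" "0 < measure unitM B" "\<And>x. x \<in> B \<Longrightarrow> \<bar>degree g x - r\<bar> < \<eta>"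
  shows "\<bar>(\<integral>x. indicator B x / measure unitM B * degree g x \<partial>unitM) - r\<bar> \<le> \<eta>"
proof -
  define b where "b x = indicator B x / measure unitM B" for x
  have bb: "bm unitM b" unfolding b_def by (intro bm_divide bm_indicator B)
  have i: "integrable unitM b" "integrable unitM (\<lambda>x. b x * degree g x)"
    by (intro unitM.bm_integrable bm_mult bb degree_bm g)+
  have 1: "(\<integral>x. b x \<partial>unitM) = 1" using B sets.sets_into_space[OF B(1)] by (simp add: b_def Int_absorb2)
  have pt: "\<bar>b x * (degree g x - r)\<bar> \<le> \<eta> * b x" if "x \<in> space unitM" for x
    using B(2) B(3)[of x] by (cases "x \<in> B") (auto simp: b_def abs_mult divide_right_mono)
  have "(\<integral>x. b x * degree g x \<partial>unitM) - r = (\<integral>x. b x * (degree g x - r) \<partial>unitM)"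
    using i 1 by (simp add: right_diff_distrib)
  also have "\<bar>\<dots>\<bar> \<le> (\<integral>x. \<bar>b x * (degree g x - r)\<bar> \<partial>unitM)" by (rule integral_abs_bound)
  also have "\<dots> \<le> (\<integral>x. \<eta> * b x \<partial>unitM)"
  proof (rule integral_mono)
    have "integrable unitM (\<lambda>x. b x * (degree g x - r))"
      by (intro unitM.bm_integrable bm_mult bb bm_diff degree_bm g bm_const)
    then show "integrable unitM (\<lambda>x. \<bar>b x * (degree g x - r)\<bar>)" by (rule integrable_abs)
  qed (use i pt in auto)
  also have "\<dots> = \<eta>" using 1 by simp
  finally show ?thesis by (simp add: b_def)
qed

text \<open>Let \<open>B1, \<dots>, B4\<close> be the sets of points whose degree is near \<open>r1, \<dots>, r4\<close>, and \<open>B\<close> their union. Moving mass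
  from \<open>B1\<close> to \<open>B2\<close> and from \<open>B4\<close> to \<open>B3\<close> keeps \<open>t1\<close> exactly, because \<open>g\<close> is constant on \<open>B \<times> B\<close>, and is strictly
  convex for \<open>tk\<close>, because no point sees a difference both between \<open>B1\<close> and \<open>B2\<close> and between \<open>B3\<close> and \<open>B4\<close>.\<close>

lemma threshold_direction:
  assumes g: "graphon g" and p: "1 \<le> p"
  defines "D \<equiv> \<lambda>q. degree g (fst q) ^ p + degree g (snd q) ^ p"
  assumes thr: "AE q in squareM. (D q < c \<longrightarrow> g (fst q) (snd q) = 0) \<and> (c < D q \<longrightarrow> g (fst q) (snd q) = 1)"
    and r: "r1 \<in> degree_support g" "r2 \<in> degree_support g" "r3 \<in> degree_support g" "r4 \<in> degree_support g"
      "r1 < r2" "r2 < r3" "r3 < r4"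
    and side: "c < 2 * r1 ^ p \<or> 2 * r4 ^ p < c"
  obtains v B where "bm unitM v" "\<And>x. x \<notin> B \<Longrightarrow> v x = 0" "(\<integral>x. v x \<partial>unitM) = 0" "(\<integral>x. v x * degree g x \<partial>unitM) = 0"
    "AE x in unitM. x \<in> B \<longrightarrow> (\<integral>y. v y * g x y \<partial>unitM) = 0"
    "\<not> (AE x in unitM. (\<integral>y. v y * g x y \<partial>unitM) = 0)"
    "AE q in squareM. fst q \<in> B \<and> snd q \<in> B \<longrightarrow> g (fst q) (snd q) \<in> {0, 1}"
proof -
  have rr: "0 \<le> r1" "r4 \<le> 1" using degree_support_range[OF g] r by auto
  \<comment> \<open>At most a third of each gap, so that classes of radius below
    \<open>\<delta>\<close> stay apart and their mean degrees are ordered. A still smaller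
    \<open>\<eta>\<close> preserves the strict side condition on whole classes; \<open>max 0\<close>
    keeps the base of the power nonnegative.\<close>
  define \<delta> where "\<delta> = min (r2 - r1) (min (r3 - r2) (r4 - r3)) / 3"
  have \<delta>: "0 < \<delta>" "3 * \<delta> \<le> r2 - r1" "3 * \<delta> \<le> r3 - r2" "3 * \<delta> \<le> r4 - r3" using r by (auto simp: \<delta>_def)
  have "\<forall>\<^sub>F \<eta> in at_right 0. c < 2 * (max 0 (r1 - \<eta>)) ^ p \<or> 2 * (r4 + \<eta>) ^ p < c"
    using side
  proof
    assume s: "c < 2 * r1 ^ p"
    have "((\<lambda>\<eta>. 2 * (max 0 (r1 - \<eta>)) ^ p) \<longlongrightarrow> 2 * (max 0 (r1 - 0)) ^ p) (at_right 0)"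
      by (intro tendsto_intros)
    then have "\<forall>\<^sub>F \<eta> in at_right 0. c < 2 * (max 0 (r1 - \<eta>)) ^ p"
      by (rule order_tendstoD) (use s rr in simp)
    then show ?thesis by eventually_elim simp
  next
    assume s: "2 * r4 ^ p < c"
    have "((\<lambda>\<eta>. 2 * (r4 + \<eta>) ^ p) \<longlongrightarrow> 2 * (r4 + 0) ^ p) (at_right 0)"
      by (intro tendsto_intros)
    then have "\<forall>\<^sub>F \<eta> in at_right 0. 2 * (r4 + \<eta>) ^ p < c"
      by (rule order_tendstoD) (use s in simp)
    then show ?thesis by eventually_elim simp
  qed
  moreover have "\<forall>\<^sub>F \<eta> in at_right 0. \<eta> < \<delta>" "\<forall>\<^sub>F \<eta> in at_right (0::real). 0 < \<eta>"
    using \<delta>(1) by (auto simp: eventually_at_right_field eventually_at_right_less)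
  ultimately have "\<forall>\<^sub>F \<eta> in at_right 0. (c < 2 * (max 0 (r1 - \<eta>)) ^ p \<or> 2 * (r4 + \<eta>) ^ p < c) \<and> \<eta> < \<delta> \<and> 0 < \<eta>"
    by eventually_elim simp
  then obtain \<eta> where sep: "c < 2 * (max 0 (r1 - \<eta>)) ^ p \<or> 2 * (r4 + \<eta>) ^ p < c" and \<eta>: "\<eta> < \<delta>" "0 < \<eta>"
    using eventually_happens'[OF trivial_limit_at_right_real] by blast
  define N where "N r = {x \<in> {0..1}. \<bar>degree g x - r\<bar> < \<eta>}" for r
  define b where "b r x = indicator (N r) x / measure unitM (N r)" for r x
  define e where "e r = (\<integral>x. b r x * degree g x \<partial>unitM)" for r
  let ?R = "{r1, r2, r3, r4}"
  have Ns: "N r \<in> sets unitM" for r unfolding N_def by (rule degree_near_sets[OF g])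
  have Npos: "0 < measure unitM (N r)" if "r \<in> ?R" for r
    using that r \<eta> by (auto simp: degree_support_def N_def)
  have bb: "bm unitM (b r)" for r unfolding b_def by (intro bm_divide bm_indicator Ns)
  have b1: "(\<integral>x. b r x \<partial>unitM) = 1" if "r \<in> ?R" for r
    unfolding b_def using Npos[OF that] sets.sets_into_space[OF Ns[of r]] by (simp add: Int_absorb2)
  have er: "\<bar>e r - r\<bar> \<le> \<eta>" if "r \<in> ?R" for r
    unfolding e_def b_def using Npos[OF that] by (intro integral_indicator_average g Ns) (auto simp: N_def)
  have e12: "0 < e r2 - e r1" and e34: "0 < e r4 - e r3"
    using er[of r1] er[of r2] er[of r3] er[of r4] \<delta> \<eta> by (auto simp: abs_le_iff)
  \<comment> \<open>Both differences are scaled to have integral \<open>- 1\<close> against the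
    degree, so that \<open>v = u1 - u2\<close> is neutral for \<open>t1\<close> to first
    order.\<close>
  define u1 where "u1 y = (b r1 y - b r2 y) / (e r2 - e r1)" for y
  define u2 where "u2 y = (b r3 y - b r4 y) / (e r4 - e r3)" for y
  have bu: "bm unitM u1" "bm unitM u2" unfolding u1_def u2_def by (intro bm_divide bm_diff bb)+
  define B where "B = N r1 \<union> N r2 \<union> N r3 \<union> N r4"
  have ib: "integrable unitM (b r)" "integrable unitM (\<lambda>x. b r x * degree g x)" for r
    by (intro unitM.bm_integrable bm_mult bb degree_bm g)+
  have u0: "(\<integral>x. u1 x \<partial>unitM) = 0" "(\<integral>x. u2 x \<partial>unitM) = 0"
    unfolding u1_def u2_def using ib b1 by simp_all
  have ud: "(\<integral>x. u1 x * degree g x \<partial>unitM) = - 1" "(\<integral>x. u2 x * degree g x \<partial>unitM) = - 1"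
  proof -
    have "(\<integral>x. u1 x * degree g x \<partial>unitM) = (\<integral>x. (b r1 x * degree g x - b r2 x * degree g x) / (e r2 - e r1) \<partial>unitM)"
      unfolding u1_def by (simp add: left_diff_distrib)
    also have "\<dots> = (e r1 - e r2) / (e r2 - e r1)" unfolding e_def using ib by simp
    also have "\<dots> = - 1" using e12 by (simp add: field_simps)
    finally show "(\<integral>x. u1 x * degree g x \<partial>unitM) = - 1" .
    have "(\<integral>x. u2 x * degree g x \<partial>unitM) = (\<integral>x. (b r3 x * degree g x - b r4 x * degree g x) / (e r4 - e r3) \<partial>unitM)"
      unfolding u2_def by (simp add: left_diff_distrib)
    also have "\<dots> = (e r3 - e r4) / (e r4 - e r3)" unfolding e_def using ib by simp
    also have "\<dots> = - 1" using e34 by (simp add: field_simps)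
    finally show "(\<integral>x. u2 x * degree g x \<partial>unitM) = - 1" .
  qed
  have iu: "integrable unitM u1" "integrable unitM u2"
    "integrable unitM (\<lambda>x. u1 x * degree g x)" "integrable unitM (\<lambda>x. u2 x * degree g x)"
    by (intro unitM.bm_integrable bm_mult bu degree_bm g)+
  have iug: "integrable unitM (\<lambda>y. u1 y * g x y)" "integrable unitM (\<lambda>y. u2 y * g x y)" if "x \<in> {0..1}" for x
    by (intro unitM.bm_integrable bm_mult bu graphon_section g that)+
  define v where "v y = u1 y - u2 y" for y
  have bv: "bm unitM v" unfolding v_def by (intro bm_diff bu)
  have vB: "v x = 0" if "x \<notin> B" for x using that by (simp add: v_def u1_def u2_def b_def B_def)
  have v0: "(\<integral>x. v x \<partial>unitM) = 0" unfolding v_def using iu u0 by simp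
  have vd: "(\<integral>x. v x * degree g x \<partial>unitM) = 0" unfolding v_def using iu ud by (simp add: left_diff_distrib)
  have vg: "(\<integral>y. v y * g x y \<partial>unitM) = (\<integral>y. u1 y * g x y \<partial>unitM) - (\<integral>y. u2 y * g x y \<partial>unitM)" if "x \<in> {0..1}" for x
    unfolding v_def using iug[OF that] by (simp add: left_diff_distrib)
  have dB: "max 0 (r1 - \<eta>) \<le> degree g x" "degree g x \<le> r4 + \<eta>" "0 \<le> degree g x" if "x \<in> B" for x
    using that r degree_range[OF g, of x] by (auto simp: B_def N_def abs_less_iff)
  define \<gamma> :: real where "\<gamma> = (if c < 2 * (max 0 (r1 - \<eta>)) ^ p then 1 else 0)"
  have AE\<gamma>: "AE q in squareM. fst q \<in> B \<and> snd q \<in> B \<longrightarrow> g (fst q) (snd q) = \<gamma>"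
    using thr
  proof eventually_elim
    case (elim q)
    show ?case
    proof
      assume q: "fst q \<in> B \<and> snd q \<in> B"
      have "(max 0 (r1 - \<eta>)) ^ p \<le> degree g (fst q) ^ p" "(max 0 (r1 - \<eta>)) ^ p \<le> degree g (snd q) ^ p"
        "degree g (fst q) ^ p \<le> (r4 + \<eta>) ^ p" "degree g (snd q) ^ p \<le> (r4 + \<eta>) ^ p"
        using dB q by (intro power_mono; simp)+
      then have "2 * (max 0 (r1 - \<eta>)) ^ p \<le> D q" "D q \<le> 2 * (r4 + \<eta>) ^ p" by (simp_all add: D_def)
      then show "g (fst q) (snd q) = \<gamma>" using elim sep by (auto simp: \<gamma>_def)
    qed
  qed
  have const_zero: "(\<integral>y. u y * g x y \<partial>unitM) = 0"
    if x: "x \<in> {0..1}" and ae: "AE y in unitM. u y \<noteq> 0 \<longrightarrow> g x y = s" and u: "bm unitM u" "(\<integral>x. u x \<partial>unitM) = 0" for x u s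
  proof -
    have "(\<integral>y. u y * g x y \<partial>unitM) = (\<integral>y. u y * s \<partial>unitM)"
    proof (rule integral_cong_AE)
      show "AE y in unitM. u y * g x y = u y * s" using ae by eventually_elim auto
    qed (intro bm_measurable bm_mult u graphon_section g x bm_const)+
    then show ?thesis using u(2) by simp
  qed
  show ?thesis
  proof (rule that[OF bv vB v0 vd])
    have "AE x in unitM. AE y in unitM. x \<in> B \<and> y \<in> B \<longrightarrow> g x y = \<gamma>" using squareM.AE_pair[OF AE\<gamma>] by simp
    then show "AE x in unitM. x \<in> B \<longrightarrow> (\<integral>y. v y * g x y \<partial>unitM) = 0"
    proof eventually_elim
      case (elim x)
      show ?case
      proof
        assume x: "x \<in> B"
        have "AE y in unitM. v y \<noteq> 0 \<longrightarrow> g x y = \<gamma>" using elim by eventually_elim (use x vB in blast)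
        then show "(\<integral>y. v y * g x y \<partial>unitM) = 0"
          by (intro const_zero bv v0) (use x in \<open>auto simp: B_def N_def\<close>)
      qed
    qed
    show "AE q in squareM. fst q \<in> B \<and> snd q \<in> B \<longrightarrow> g (fst q) (snd q) \<in> {0, 1}"
      using AE\<gamma> by eventually_elim (auto simp: \<gamma>_def)
    show "\<not> (AE x in unitM. (\<integral>y. v y * g x y \<partial>unitM) = 0)"
    proof
      assume "AE x in unitM. (\<integral>y. v y * g x y \<partial>unitM) = 0"
      moreover have "AE x in unitM. AE y in unitM. (D (x, y) < c \<longrightarrow> g x y = 0) \<and> (c < D (x, y) \<longrightarrow> g x y = 1)"
        using squareM.AE_pair[OF thr] by simp
      ultimately have "AE x in unitM. (\<integral>y. u1 y * g x y \<partial>unitM) = 0"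
        using AE_space[of unitM]
      proof eventually_elim
        case (elim x)
        then have x: "x \<in> {0..1}" by simp
        \<comment> \<open>The level that \<open>x\<close> requires of its partner leaves the two
          lower classes entirely below it or the two upper classes entirely above it. So
          \<open>x\<close> sees one pair as constant. If the section of \<open>v\<close> vanished as
          well, that of \<open>u1\<close> would vanish for almost all \<open>x\<close>, against its
          integral \<open>- 1\<close>.\<close>
        have "(\<integral>y. u1 y * g x y \<partial>unitM) = 0 \<or> (\<integral>y. u2 y * g x y \<partial>unitM) = 0"
        proof (cases "degree g x ^ p + (r2 + \<eta>) ^ p < c")
          case True
          have "AE y in unitM. u1 y \<noteq> 0 \<longrightarrow> g x y = 0"
            using elim(2) AE_space[of unitM]
          proof eventually_elim
            case (elim y)
            have "D (x, y) < c" if "u1 y \<noteq> 0"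
            proof -
              have "y \<in> N r1 \<union> N r2" using that by (auto simp: u1_def b_def indicator_def split: if_splits)
              then have "degree g y \<le> r2 + \<eta>" using r by (auto simp: N_def)
              then have "degree g y ^ p \<le> (r2 + \<eta>) ^ p" using degree_range[OF g, of y] elim by (intro power_mono) auto
              then show ?thesis using True by (simp add: D_def)
            qed
            then show ?case using elim by blast
          qed
          then show ?thesis using const_zero[OF x _ bu(1) u0(1)] by blast
        next
          case False
          have "(r2 + \<eta>) ^ p < (r3 - \<eta>) ^ p" using rr r \<eta> \<delta> p by (intro power_strict_mono) auto
          then have gt: "c < degree g x ^ p + (r3 - \<eta>) ^ p" using False by linarith
          have "AE y in unitM. u2 y \<noteq> 0 \<longrightarrow> g x y = 1"
            using elim(2)
          proof eventually_elim
            case (elim y)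
            have "c < D (x, y)" if "u2 y \<noteq> 0"
            proof -
              have "y \<in> N r3 \<union> N r4" using that by (auto simp: u2_def b_def indicator_def split: if_splits)
              then have "r3 - \<eta> \<le> degree g y" using r by (auto simp: N_def)
              then have "(r3 - \<eta>) ^ p \<le> degree g y ^ p" using rr r \<eta> \<delta> by (intro power_mono) auto
              then show ?thesis using gt by (simp add: D_def)
            qed
            then show ?case using elim by blast
          qed
          then show ?thesis using const_zero[OF x _ bu(2) u0(2)] by blast
        qed
        then show ?case using elim(1) vg[OF x] by auto
      qed
      then have "(\<integral>x. (\<integral>y. u1 y * g x y \<partial>unitM) \<partial>unitM) = 0" by (rule integral_eq_zero_AE)
      then show False using integral_weighted_section[OF g bu(1)] ud(1) by simp
    qed
  qed
qed

lemma four_increasing: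
  fixes A :: "real set"
  assumes "finite A" "4 \<le> card A"
  obtains r1 r2 r3 r4 where "r1 \<in> A" "r2 \<in> A" "r3 \<in> A" "r4 \<in> A" "r1 < r2" "r2 < r3" "r3 < r4"
proof -
  let ?l = "sorted_list_of_set A"
  have l: "length ?l = card A" "set ?l = A" "sorted_wrt (<) ?l"
    using assms strict_sorted_list_of_set by auto
  have lt: "?l ! i < ?l ! Suc i" if "i < 3" for i
    using sorted_wrt_nth_less[OF l(3), of i "Suc i"] that l(1) assms by simp
  have mem: "?l ! i \<in> A" if "i < 4" for i
    using nth_mem[of i ?l] that l(1,2) assms by simp
  show ?thesis
    using that[of "?l ! 0" "?l ! 1" "?l ! 2" "?l ! 3"] lt[of 0] lt[of 1] lt[of 2] mem[of 0] mem[of 1] mem[of 2] mem[of 3]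
    by (simp add: numeral_2_eq_2 numeral_3_eq_3)
qed

text \<open>Reweighting by \<open>1 + e * v\<close> keeps \<open>t1\<close> exact, since
  \<open>v * Q = 0\<close> almost everywhere, and strictly raises \<open>tk\<close>, since
  \<open>Q\<close> is not null. The excess is spent on mixing with the constant \<open>t1\<close>,
  which earns entropy of order \<open>\<delta> * ln (1 / \<delta>)\<close> on the zero-one part,
  while every cost is linear in \<open>\<delta>\<close>.\<close>

lemma pure_maximizer_no_direction:
  assumes max: "entropy_maximizer k \<tau> g" and k: "2 \<le> k" and gap: "star_density 1 g ^ k < star_density k g"
    and pure: "0 < measure squareM (pure_set g)"
    and v0: "bm unitM v0" "\<And>x. x \<notin> B \<Longrightarrow> v0 x = 0" "(\<integral>x. v0 x \<partial>unitM) = 0" "(\<integral>x. v0 x * degree g x \<partial>unitM) = 0"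
    and gv0: "AE x in unitM. x \<in> B \<longrightarrow> (\<integral>y. v0 y * g x y \<partial>unitM) = 0"
      "\<not> (AE x in unitM. (\<integral>y. v0 y * g x y \<partial>unitM) = 0)"
    and gB: "AE q in squareM. fst q \<in> B \<and> snd q \<in> B \<longrightarrow> g (fst q) (snd q) \<in> {0, 1}"
  shows False
proof -
  have g: "graphon g" using max by (simp add: entropy_maximizer_def)
  have k1: "1 \<le> k" using k by simp
  note gb = graphonD(1)[OF g]
  let ?t = "star_density 1 g"
  have t: "0 < ?t" "?t < 1" using density_gap_imp_nontrivial[OF g k1 gap] by auto
  have tt: "0 \<le> ?t" "?t \<le> 1" using t by auto
  define d where "d = degree g"
  have bd: "bm unitM d" unfolding d_def by (rule degree_bm[OF g])
  have d01: "0 \<le> d x" "d x \<le> 1" if "x \<in> {0..1}" for x using degree_range[OF g that] by (auto simp: d_def)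
  define S where "S q = S_ent (g (fst q) (snd q))" for q
  have bS: "bm squareM S" unfolding S_def by (rule S_ent_graphon_bm[OF g])
  \<comment> \<open>\<open>F1\<close> and \<open>S1\<close> are the derivatives of \<open>tk\<close>
    and of twice the entropy under reweighting by \<open>1 + e * u\<close>.\<close>
  define F1 where "F1 u = (\<integral>x. u x * d x ^ k \<partial>unitM) + real k * (\<integral>x. d x ^ (k - 1) * (\<integral>y. u y * g x y \<partial>unitM) \<partial>unitM)" for u
  define S1 where "S1 u = (\<integral>q. S q * (u (fst q) + u (snd q)) \<partial>squareM)" for u
  \<comment> \<open>the sign of the direction is chosen so that neither first-order term is harmful\<close>
  have "\<exists>s. \<bar>s\<bar> = 1 \<and> (0 < F1 (\<lambda>x. s * v0 x) \<or> F1 (\<lambda>x. s * v0 x) = 0 \<and> 0 \<le> S1 (\<lambda>x. s * v0 x))"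
  proof -
    have "F1 (\<lambda>x. s * v0 x) = s * F1 v0" "S1 (\<lambda>x. s * v0 x) = s * S1 v0" for s
    proof -
      have "F1 (\<lambda>x. s * v0 x) = (\<integral>x. s * (v0 x * d x ^ k) \<partial>unitM) + real k * (\<integral>x. s * (d x ^ (k - 1) * (\<integral>y. v0 y * g x y \<partial>unitM)) \<partial>unitM)"
        unfolding F1_def by (simp add: mult_ac)
      then show "F1 (\<lambda>x. s * v0 x) = s * F1 v0" unfolding F1_def by (simp add: distrib_left)
      have "S1 (\<lambda>x. s * v0 x) = (\<integral>q. s * (S q * (v0 (fst q) + v0 (snd q))) \<partial>squareM)"
        unfolding S1_def by (simp add: algebra_simps)
      then show "S1 (\<lambda>x. s * v0 x) = s * S1 v0" unfolding S1_def by simp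
    qed
    then have 1: "F1 (\<lambda>x. s * v0 x) = s * F1 v0" "S1 (\<lambda>x. s * v0 x) = s * S1 v0" for s by blast+
    show ?thesis
    proof (cases "0 < F1 v0 \<or> F1 v0 = 0 \<and> 0 \<le> S1 v0")
      case True then show ?thesis using 1[of 1] by (intro exI[of _ 1]) simp
    next
      case False then show ?thesis using 1[of "- 1"] by (intro exI[of _ "- 1"]) auto
    qed
  qed
  then obtain s where s: "\<bar>s\<bar> = 1" and sgn: "0 < F1 (\<lambda>x. s * v0 x) \<or> F1 (\<lambda>x. s * v0 x) = 0 \<and> 0 \<le> S1 (\<lambda>x. s * v0 x)"
    by blast
  define v where "v x = s * v0 x" for x
  have bv: "bm unitM v" unfolding v_def by (intro bm_mult bm_const v0)
  define f1 where "f1 = F1 v"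
  define s1 where "s1 = S1 v"
  have f1: "0 < f1 \<or> f1 = 0 \<and> 0 \<le> s1" using sgn by (simp add: f1_def s1_def v_def[abs_def])
  define Q where "Q x = (\<integral>y. v y * g x y \<partial>unitM)" for x
  have bQ: "bm unitM Q" unfolding Q_def by (rule weighted_section_bm[OF g bv])
  have Qs: "Q x = s * (\<integral>y. v0 y * g x y \<partial>unitM)" for x
    unfolding Q_def v_def by (simp add: mult.assoc)
  have vB: "v x = 0" if "x \<notin> B" for x using v0(2)[OF that] by (simp add: v_def)
  have iv: "(\<integral>x. v x \<partial>unitM) = 0" "(\<integral>x. v x * d x \<partial>unitM) = 0"
    using v0(3,4) by (simp_all add: v_def d_def mult.assoc)
  have QB: "AE x in unitM. x \<in> B \<longrightarrow> Q x = 0" using gv0(1) by eventually_elim (auto simp: Qs)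
  have Qne: "\<not> (AE x in unitM. Q x = 0)" using gv0(2) s by (auto simp: Qs)
  have vQ: "AE x in unitM. v x * Q x = 0" using QB by eventually_elim (use vB in auto)
  obtain V where V: "0 \<le> V" "\<And>x. x \<in> {0..1} \<Longrightarrow> \<bar>v x\<bar> \<le> V" using bm_bound[OF bv] by auto
  \<comment> \<open>Keeps the weights at least \<open>1 / 2\<close>, hence their products at least
    \<open>1 / 4\<close>, the factor in the entropy bound.\<close>
  define e0 where "e0 = 1 / (2 * (V + 1))"
  have e0: "0 < e0" using V by (simp add: e0_def)
  obtain C where C: "0 \<le> C"
    "\<And>h. graphon h \<Longrightarrow> C * \<bar>star_density 1 h - ?t\<bar> \<le> star_density k h - star_density k g \<Longrightarrow>
       entropy h \<le> entropy g + C * (star_density k h - star_density k g)"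
    using maximizer_penalty[OF max k1 gap] by blast
  let ?N = "measure squareM (pure_set g)"
  define \<eta> where "\<eta> = min ?t (1 - ?t)"
  have \<eta>: "0 < \<eta>" "\<eta> \<le> ?t" "?t \<le> 1 - \<eta>" using t by (auto simp: \<eta>_def)
  \<comment> \<open>The rate at which a first-order loss of entropy is paid by the gain in
    \<open>tk\<close>: for \<open>f1 > 0\<close>, \<open>e * f1 \<le> \<theta> e\<close> gives
    \<open>e * \<bar>s1\<bar> \<le> L * \<theta> e\<close>. For \<open>f1 = 0\<close> the sign
    choice makes \<open>s1\<close> harmless.\<close>
  define L where "L = (if f1 = 0 then 0 else \<bar>s1\<bar> / f1)"
  have L: "0 \<le> L" using f1 by (auto simp: L_def)
  define \<theta> where "\<theta> e = (\<integral>x. (1 + e * v x) * (d x + e * Q x) ^ k \<partial>unitM) - star_density k g" for e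
  have range: "1 / 2 \<le> 1 + e * v x" "0 \<le> d x + e * Q x" "d x + e * Q x \<le> 1"
    and wsec: "(\<integral>y. (1 + e * v y) * g x y \<partial>unitM) = d x + e * Q x"
    if e: "0 < e" "e \<le> e0" and x: "x \<in> {0..1}" for e x
  proof -
    have half: "1 / 2 \<le> 1 + e * v y" if "y \<in> {0..1}" for y
    proof -
      have "\<bar>e * v y\<bar> \<le> e0 * V" unfolding abs_mult using e V that by (intro mult_mono) auto
      also have "e0 * V \<le> 1 / 2" using V by (simp add: e0_def field_simps)
      finally show ?thesis by (auto simp: abs_le_iff)
    qed
    then show "1 / 2 \<le> 1 + e * v x" using x by simp
    have i: "integrable unitM (\<lambda>y. g x y)" "integrable unitM (\<lambda>y. v y * g x y)" "integrable unitM v"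
      by (intro unitM.bm_integrable bm_mult bv graphon_section g x)+
    show eq: "(\<integral>y. (1 + e * v y) * g x y \<partial>unitM) = d x + e * Q x"
      using i by (simp add: distrib_right mult.assoc d_def degree_unitM Q_def)
    have nn: "0 \<le> (1 + e * v y) * g x y \<and> (1 + e * v y) * g x y \<le> 1 + e * v y" if "y \<in> {0..1}" for y
      using half[OF that] graphonD(3,4)[OF g x that] by (auto intro: mult_left_le)
    have "0 \<le> (\<integral>y. (1 + e * v y) * g x y \<partial>unitM)" using nn by (intro integral_nonneg_AE AE_I2) auto
    then show "0 \<le> d x + e * Q x" using eq by simp
    have "(\<integral>y. (1 + e * v y) * g x y \<partial>unitM) \<le> (\<integral>y. 1 + e * v y \<partial>unitM)"
      using nn by (intro integral_mono unitM.bm_integrable bm_add bm_mult bm_const bv graphon_section g x) auto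
    also have "\<dots> = 1" using i iv by simp
    finally show "d x + e * Q x \<le> 1" using eq by simp
  qed
  have bPk: "bm unitM (\<lambda>x. (d x + e * Q x) ^ k)" for e
    by (intro bm_power bm_add bm_mult bm_const bd bQ)
  have bdk: "bm unitM (\<lambda>x. d x ^ j)" for j by (intro bm_power bd)
  \<comment> \<open>\<open>v * Q = 0\<close> removes the cross terms. Beyond the linear part only
    the convexity gap of the power between \<open>d\<close> and \<open>d + e * Q\<close>
    remains.\<close>
  have \<theta>_eq: "\<theta> e = e * f1 + (\<integral>x. (d x + e * Q x) ^ k - (d x ^ k + real k * d x ^ (k - 1) * (e * Q x)) \<partial>unitM)" for e
  proof -
    have "(\<integral>x. (1 + e * v x) * (d x + e * Q x) ^ k \<partial>unitM) = (\<integral>x. (d x + e * Q x) ^ k + e * (v x * d x ^ k) \<partial>unitM)"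
    proof (rule integral_cong_AE)
      show "AE x in unitM. (1 + e * v x) * (d x + e * Q x) ^ k = (d x + e * Q x) ^ k + e * (v x * d x ^ k)"
        using vQ
      proof eventually_elim
        case (elim x)
        then have "v x * (d x + e * Q x) ^ k = v x * d x ^ k" by auto
        then show ?case by (simp add: algebra_simps)
      qed
    qed (intro bm_measurable bm_add bm_mult bm_const bv bPk bdk)+
    moreover have i: "integrable unitM (\<lambda>x. (d x + e * Q x) ^ k)" "integrable unitM (\<lambda>x. v x * d x ^ k)"
      "integrable unitM (\<lambda>x. d x ^ k)" "integrable unitM (\<lambda>x. d x ^ (k - 1) * Q x)"
      by (intro unitM.bm_integrable bm_mult bv bPk bdk bQ)+
    moreover have "(\<integral>x. (d x + e * Q x) ^ k - (d x ^ k + real k * d x ^ (k - 1) * (e * Q x)) \<partial>unitM)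
      = (\<integral>x. (d x + e * Q x) ^ k - d x ^ k - (real k * e) * (d x ^ (k - 1) * Q x) \<partial>unitM)"
      by (simp add: algebra_simps)
    ultimately show ?thesis
      unfolding \<theta>_def f1_def F1_def star_density_unitM d_def[symmetric]
      by (simp add: Q_def[symmetric] algebra_simps)
  qed
  define M where "M = \<bar>f1\<bar> + real k * (\<integral>x. \<bar>Q x\<bar> \<partial>unitM) * 2 + 1"
  have baQ: "bm unitM (\<lambda>x. \<bar>Q x\<bar>)" using bQ by (auto simp: bm_def)
  have \<theta>pos: "0 < \<theta> e" "e * f1 \<le> \<theta> e" "\<theta> e \<le> M * e" if e: "0 < e" "e \<le> e0" for e
  proof -
    let ?w = "\<lambda>x. (d x + e * Q x) ^ k - (d x ^ k + real k * d x ^ (k - 1) * (e * Q x))"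
    have bw: "bm unitM ?w" by (intro bm_diff bm_add bm_mult bm_const bPk bdk bQ)
    have w0: "0 \<le> ?w x" if "x \<in> {0..1}" for x
      using power_above_tangent[of "d x" "d x + e * Q x" k] d01[OF that] range[OF e that] by simp
    have w1: "0 < ?w x" if "x \<in> {0..1}" "Q x \<noteq> 0" for x
      using power_above_tangent_strict[of "d x" "d x + e * Q x" k] d01[OF that(1)] range[OF e that(1)] that k e by simp
    have wAE: "AE x in unitM. 0 \<le> ?w x" using w0 by (intro AE_I2) auto
    have "0 \<le> (\<integral>x. ?w x \<partial>unitM)" by (rule integral_nonneg_AE[OF wAE])
    moreover have "(\<integral>x. ?w x \<partial>unitM) \<noteq> 0"
    proof
      assume "(\<integral>x. ?w x \<partial>unitM) = 0"
      then have "AE x in unitM. ?w x = 0" using integral_nonneg_eq_0_iff_AE[OF unitM.bm_integrable[OF bw] wAE] by simp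
      then have "AE x in unitM. Q x = 0" using AE_space[of unitM]
      proof eventually_elim
        case (elim x)
        then show ?case using w1[of x] by (cases "Q x = 0") auto
      qed
      then show False using Qne by simp
    qed
    moreover have "0 \<le> e * f1" using f1 e by auto
    ultimately show "0 < \<theta> e" "e * f1 \<le> \<theta> e" unfolding \<theta>_eq by linarith+
    have "(\<integral>x. ?w x \<partial>unitM) \<le> (\<integral>x. (real k * e * 2) * \<bar>Q x\<bar> \<partial>unitM)"
    proof (rule integral_mono)
      fix x assume "x \<in> space unitM"
      then have x: "x \<in> {0..1}" by simp
      have "\<bar>(d x + e * Q x) ^ k - d x ^ k\<bar> \<le> real k * \<bar>d x + e * Q x - d x\<bar>"
        using d01[OF x] range[OF e x] by (intro power_lipschitz_unit) auto
      then have 1: "(d x + e * Q x) ^ k - d x ^ k \<le> real k * e * \<bar>Q x\<bar>" using e by (simp add: abs_mult mult.assoc)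
      have "\<bar>real k * d x ^ (k - 1) * (e * Q x)\<bar> = real k * e * \<bar>Q x\<bar> * d x ^ (k - 1)"
        using e d01[OF x] by (simp add: abs_mult power_abs mult_ac)
      also have "\<dots> \<le> real k * e * \<bar>Q x\<bar> * 1" using e d01[OF x] by (intro mult_left_mono) (auto intro: power_le_one)
      finally show "?w x \<le> (real k * e * 2) * \<bar>Q x\<bar>" using 1 by (auto simp: abs_le_iff)
    qed (intro unitM.bm_integrable bw bm_mult bm_const baQ)+
    then have "\<theta> e \<le> e * f1 + (real k * e * 2) * (\<integral>x. \<bar>Q x\<bar> \<partial>unitM)" unfolding \<theta>_eq by simp
    also have "\<dots> \<le> e * \<bar>f1\<bar> + (real k * e * 2) * (\<integral>x. \<bar>Q x\<bar> \<partial>unitM) + e"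
      using mult_left_mono[OF abs_ge_self[of f1], of e] e by linarith
    finally show "\<theta> e \<le> M * e" by (simp add: M_def algebra_simps)
  qed
  have S0: "0 \<le> S q" "S q \<le> 1" if "q \<in> space squareM" for q
    using that graphonD(3,4)[OF g, of "fst q" "snd q"] by (auto simp: S_def intro: S_ent_nonneg S_ent_le_1)
  \<comment> \<open>\<open>v\<close> vanishes off \<open>B\<close>, and on
    \<open>B \<times> B\<close> the entropy of a zero-one value is 0; so twice the weighted entropy
    is exactly linear in \<open>e\<close>.\<close>
  have Svv: "AE q in squareM. S q * (v (fst q) * v (snd q)) = 0"
    using gB
  proof eventually_elim
    case (elim q)
    then show ?case
      using vB[of "fst q"] vB[of "snd q"] by (cases "fst q \<in> B \<and> snd q \<in> B") (auto simp: S_def)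
  qed
  \<comment> \<open>Mixing at weight \<open>\<delta> = \<theta> e / (2 * real k)\<close> changes
    \<open>tk\<close> by at most \<open>real k * \<delta>\<close>, half of the excess. The other
    half remains, so the penalty condition holds.\<close>
  have bound: "(?N * \<eta> / 4) * ln (1 / \<delta>) \<le> 1 + 2 * (real k * L) + 6 * (C * real k)"
    if e: "0 < e" "e \<le> e0" and \<delta>: "\<delta> = \<theta> e / (2 * real k)" "\<delta> \<le> 1" for e \<delta>
  proof -
    have \<delta>0: "0 < \<delta>" using \<theta>pos(1)[OF e] k by (simp add: \<delta>)
    have \<theta>\<delta>: "\<theta> e = 2 * real k * \<delta>" using k by (simp add: \<delta>)
    define G where "G = (\<lambda>x y. (1 - \<delta>) * g x y + \<delta> * ?t)"
    have G: "graphon G" unfolding G_def using \<delta>0 \<delta>(2) by (intro graphon_mix graphon_const g tt) auto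
    define \<rho> where "\<rho> x = 1 + e * v x" for x
    have b\<rho>: "bm unitM \<rho>" unfolding \<rho>_def by (intro bm_add bm_mult bm_const bv)
    have ivv: "integrable unitM v" by (rule unitM.bm_integrable[OF bv])
    have i\<rho>: "(\<integral>x. \<rho> x \<partial>unitM) = 1" unfolding \<rho>_def using ivv iv by simp
    have \<rho>half: "1 / 2 \<le> \<rho> x" if "x \<in> {0..1}" for x using range(1)[OF e that] by (simp add: \<rho>_def)
    have \<rho>0: "0 \<le> \<rho> x" if "x \<in> {0..1}" for x using \<rho>half[OF that] by simp
    obtain h where h: "graphon h"
      "\<And>j. star_density j h = (\<integral>x. \<rho> x * (\<integral>y. \<rho> y * G x y \<partial>unitM) ^ j \<partial>unitM)"
      "entropy h = 1 / 2 * (\<integral>q. \<rho> (fst q) * \<rho> (snd q) * S_ent (G (fst q) (snd q)) \<partial>squareM)"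
      using weighted_graphon[OF G b\<rho> \<rho>0 i\<rho>] by blast
    define P where "P x = d x + e * Q x" for x
    have bP: "bm unitM P" unfolding P_def by (intro bm_add bm_mult bm_const bd bQ)
    have P01: "0 \<le> P x" "P x \<le> 1" if "x \<in> {0..1}" for x using range[OF e that] by (auto simp: P_def)
    have sec: "(\<integral>y. \<rho> y * G x y \<partial>unitM) = (1 - \<delta>) * P x + \<delta> * ?t" if x: "x \<in> {0..1}" for x
    proof -
      have "(\<integral>y. \<rho> y * G x y \<partial>unitM) = (\<integral>y. (1 - \<delta>) * (\<rho> y * g x y) + (\<delta> * ?t) * \<rho> y \<partial>unitM)"
        unfolding G_def by (simp add: algebra_simps)
      also have "\<dots> = (1 - \<delta>) * (\<integral>y. \<rho> y * g x y \<partial>unitM) + (\<delta> * ?t) * (\<integral>y. \<rho> y \<partial>unitM)"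
        using unitM.bm_integrable[OF bm_mult[OF b\<rho> graphon_section[OF g x]]] unitM.bm_integrable[OF b\<rho>] by simp
      finally show ?thesis using wsec[OF e x] i\<rho> by (simp add: \<rho>_def P_def)
    qed
    have sd: "star_density j h = (\<integral>x. \<rho> x * ((1 - \<delta>) * P x + \<delta> * ?t) ^ j \<partial>unitM)" for j
      unfolding h(2) using sec by (intro Bochner_Integration.integral_cong) auto
    have "(\<integral>x. \<rho> x * P x \<partial>unitM) = ?t"
    proof -
      have "(\<integral>x. \<rho> x * P x \<partial>unitM) = (\<integral>x. d x + e * Q x + e * (v x * d x) \<partial>unitM)"
      proof (rule integral_cong_AE)
        show "AE x in unitM. \<rho> x * P x = d x + e * Q x + e * (v x * d x)"
          using vQ by eventually_elim (auto simp: \<rho>_def P_def algebra_simps)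
      qed (intro bm_measurable bm_add bm_mult bm_const b\<rho> bP bd bQ bv)+
      also have "\<dots> = (\<integral>x. d x \<partial>unitM) + e * (\<integral>x. Q x \<partial>unitM) + e * (\<integral>x. v x * d x \<partial>unitM)"
        using unitM.bm_integrable[OF bd] unitM.bm_integrable[OF bQ] unitM.bm_integrable[OF bm_mult[OF bv bd]] by simp
      also have "(\<integral>x. Q x \<partial>unitM) = 0"
        using integral_weighted_section[OF g bv] iv by (simp add: Q_def d_def)
      finally show ?thesis using iv by (simp add: d_def star_density_unitM)
    qed
    then have h1: "star_density 1 h = ?t"
    proof -
      have "star_density 1 h = (\<integral>x. (1 - \<delta>) * (\<rho> x * P x) + (\<delta> * ?t) * \<rho> x \<partial>unitM)"
        unfolding sd by (simp add: algebra_simps)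
      also have "\<dots> = (1 - \<delta>) * (\<integral>x. \<rho> x * P x \<partial>unitM) + (\<delta> * ?t) * (\<integral>x. \<rho> x \<partial>unitM)"
        using unitM.bm_integrable[OF bm_mult[OF b\<rho> bP]] unitM.bm_integrable[OF b\<rho>] by simp
      finally show ?thesis using \<open>(\<integral>x. \<rho> x * P x \<partial>unitM) = ?t\<close> i\<rho> by (simp add: algebra_simps)
    qed
    have ik: "integrable unitM (\<lambda>x. \<rho> x * P x ^ k)" "integrable unitM (\<lambda>x. \<rho> x * ((1 - \<delta>) * P x + \<delta> * ?t) ^ k)"
      by (intro unitM.bm_integrable bm_mult b\<rho> bm_power bm_add bm_const bP)+
    have "\<bar>star_density k h - (\<integral>x. \<rho> x * P x ^ k \<partial>unitM)\<bar> \<le> real k * \<delta>"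
    proof -
      have diff: "star_density k h - (\<integral>x. \<rho> x * P x ^ k \<partial>unitM) = (\<integral>x. \<rho> x * ((1 - \<delta>) * P x + \<delta> * ?t) ^ k - \<rho> x * P x ^ k \<partial>unitM)"
        unfolding sd using ik by simp
      have "\<bar>star_density k h - (\<integral>x. \<rho> x * P x ^ k \<partial>unitM)\<bar> \<le> (\<integral>x. \<bar>\<rho> x * ((1 - \<delta>) * P x + \<delta> * ?t) ^ k - \<rho> x * P x ^ k\<bar> \<partial>unitM)"
        unfolding diff by (rule integral_abs_bound)
      also have "\<dots> \<le> (\<integral>x. (real k * \<delta>) * \<rho> x \<partial>unitM)"
      proof (rule integral_mono)
        fix x assume "x \<in> space unitM"
        then have x: "x \<in> {0..1}" by simp
        have "0 \<le> (1 - \<delta>) * P x + \<delta> * ?t" using P01[OF x] tt \<delta>0 \<delta>(2) by simp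
        moreover have "(1 - \<delta>) * P x + \<delta> * ?t \<le> 1" using P01[OF x] tt \<delta>0 \<delta>(2) by (intro convex_bound_le) auto
        ultimately have "\<bar>((1 - \<delta>) * P x + \<delta> * ?t) ^ k - P x ^ k\<bar> \<le> real k * \<bar>(1 - \<delta>) * P x + \<delta> * ?t - P x\<bar>"
          using P01[OF x] by (intro power_lipschitz_unit) auto
        moreover have "(1 - \<delta>) * P x + \<delta> * ?t - P x = \<delta> * (?t - P x)" by (simp add: algebra_simps)
        ultimately have "\<bar>((1 - \<delta>) * P x + \<delta> * ?t) ^ k - P x ^ k\<bar> \<le> real k * \<bar>\<delta> * (?t - P x)\<bar>" by simp
        also have "real k * \<bar>\<delta> * (?t - P x)\<bar> \<le> real k * (\<delta> * 1)"
          unfolding abs_mult using P01[OF x] tt \<delta>0 by (intro mult_left_mono mult_mono) auto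
        finally have "\<rho> x * \<bar>((1 - \<delta>) * P x + \<delta> * ?t) ^ k - P x ^ k\<bar> \<le> \<rho> x * (real k * \<delta>)"
          using \<rho>0[OF x] by (intro mult_left_mono) auto
        moreover have "\<bar>\<rho> x * ((1 - \<delta>) * P x + \<delta> * ?t) ^ k - \<rho> x * P x ^ k\<bar> = \<rho> x * \<bar>((1 - \<delta>) * P x + \<delta> * ?t) ^ k - P x ^ k\<bar>"
          using \<rho>0[OF x] by (simp add: right_diff_distrib[symmetric] abs_mult)
        ultimately show "\<bar>\<rho> x * ((1 - \<delta>) * P x + \<delta> * ?t) ^ k - \<rho> x * P x ^ k\<bar> \<le> (real k * \<delta>) * \<rho> x"
          by (simp add: mult.commute)
      qed (use ik unitM.bm_integrable[OF b\<rho>] in auto)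
      also have "\<dots> = real k * \<delta>" using i\<rho> by simp
      finally show ?thesis .
    qed
    from abs_le_D1[OF this] abs_le_D2[OF this]
    have near: "star_density k h - (\<integral>x. \<rho> x * P x ^ k \<partial>unitM) \<le> real k * \<delta>"
      "- (star_density k h - (\<integral>x. \<rho> x * P x ^ k \<partial>unitM)) \<le> real k * \<delta>" by auto
    have "(\<integral>x. \<rho> x * P x ^ k \<partial>unitM) = star_density k g + \<theta> e"
      by (simp add: \<theta>_def \<rho>_def P_def)
    then have hk: "real k * \<delta> \<le> star_density k h - star_density k g" "star_density k h - star_density k g \<le> 3 * real k * \<delta>"
      using near \<theta>\<delta> by linarith+
    have "0 \<le> real k * \<delta>" using \<delta>0 by simp
    then have "entropy h \<le> entropy g + C * (star_density k h - star_density k g)"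
      using h1 hk by (intro C(2) h(1)) auto
    also have "\<dots> \<le> entropy g + C * (3 * real k * \<delta>)" using hk C(1) by (intro add_left_mono mult_left_mono) auto
    finally have upper: "entropy h \<le> entropy g + C * (3 * real k * \<delta>)" .
    let ?ln = "\<delta> * \<eta> * ln (1 / \<delta>)"
    have ln0: "0 \<le> ?ln" using \<delta>0 \<delta>(2) \<eta> by simp
    have b\<rho>\<rho>: "bm squareM (\<lambda>q. \<rho> (fst q) * \<rho> (snd q))" by (intro bm_mult bm_fst bm_snd b\<rho>)
    have bN: "bm squareM (\<lambda>q. indicator (pure_set g) q)" by (intro bm_indicator pure_set_sets g)
    have lower: "(\<integral>q. \<rho> (fst q) * \<rho> (snd q) * (S q - \<delta>) + indicator (pure_set g) q * (?ln / 4) \<partial>squareM)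
      \<le> (\<integral>q. \<rho> (fst q) * \<rho> (snd q) * S_ent (G (fst q) (snd q)) \<partial>squareM)"
    proof (rule integral_mono)
      fix q assume q: "q \<in> space squareM"
      then have q': "fst q \<in> {0..1}" "snd q \<in> {0..1}" by auto
      have quarter: "1 / 4 \<le> \<rho> (fst q) * \<rho> (snd q)"
        using mult_mono[OF \<rho>half[OF q'(1)] \<rho>half[OF q'(2)]] \<rho>half[OF q'(1)] by simp
      have "S q - \<delta> + indicator (pure_set g) q * ?ln \<le> S_ent (G (fst q) (snd q))"
        using S_ent_mix_gain[OF graphonD(3,4)[OF g q'] \<eta>(2,3) \<eta>(1) \<delta>0 \<delta>(2)] q
        by (auto simp: S_def G_def pure_set_def indicator_def)
      then have "\<rho> (fst q) * \<rho> (snd q) * (S q - \<delta> + indicator (pure_set g) q * ?ln) \<le> \<rho> (fst q) * \<rho> (snd q) * S_ent (G (fst q) (snd q))"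
        using quarter by (intro mult_left_mono) auto
      moreover have "1 / 4 * (indicator (pure_set g) q * ?ln) \<le> \<rho> (fst q) * \<rho> (snd q) * (indicator (pure_set g) q * ?ln)"
        using quarter ln0 by (intro mult_right_mono) auto
      ultimately show "\<rho> (fst q) * \<rho> (snd q) * (S q - \<delta>) + indicator (pure_set g) q * (?ln / 4) \<le> \<rho> (fst q) * \<rho> (snd q) * S_ent (G (fst q) (snd q))"
        unfolding distrib_left by simp
    next
      show "integrable squareM (\<lambda>q. \<rho> (fst q) * \<rho> (snd q) * (S q - \<delta>) + indicator (pure_set g) q * (?ln / 4))"
        by (intro squareM.P.bm_integrable bm_add bm_mult[OF b\<rho>\<rho>] bm_mult[OF bN] bm_diff bm_const bS)
      show "integrable squareM (\<lambda>q. \<rho> (fst q) * \<rho> (snd q) * S_ent (G (fst q) (snd q)))"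
        by (intro squareM.P.bm_integrable bm_mult[OF b\<rho>\<rho>] S_ent_graphon_bm G)
    qed
    have "(\<integral>q. \<rho> (fst q) * \<rho> (snd q) \<partial>squareM) = 1"
      using squareM_integral_fst[OF b\<rho> bm_snd[OF b\<rho>]] i\<rho> by simp
    moreover have "(\<integral>q. \<rho> (fst q) * \<rho> (snd q) * S q \<partial>squareM) = (\<integral>q. S q \<partial>squareM) + e * s1"
    proof -
      have "(\<integral>q. \<rho> (fst q) * \<rho> (snd q) * S q \<partial>squareM) = (\<integral>q. S q + e * (S q * (v (fst q) + v (snd q))) \<partial>squareM)"
      proof (rule integral_cong_AE)
        show "AE q in squareM. \<rho> (fst q) * \<rho> (snd q) * S q = S q + e * (S q * (v (fst q) + v (snd q)))"
          using Svv
        proof eventually_elim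
          case (elim q)
          have "\<rho> (fst q) * \<rho> (snd q) * S q = S q + e * (S q * (v (fst q) + v (snd q))) + e * e * (S q * (v (fst q) * v (snd q)))"
            by (simp add: \<rho>_def algebra_simps)
          then show ?case using elim by simp
        qed
      qed (intro bm_measurable bm_add bm_mult bm_const bm_fst bm_snd b\<rho> bS bv)+
      also have "\<dots> = (\<integral>q. S q \<partial>squareM) + e * s1"
        using squareM.P.bm_integrable[OF bS] squareM.P.bm_integrable[OF bm_mult[OF bS bm_add[OF bm_fst[OF bv] bm_snd[OF bv]]]]
        by (simp add: s1_def S1_def)
      finally show ?thesis .
    qed
    moreover have "(\<integral>q. \<rho> (fst q) * \<rho> (snd q) * (S q - \<delta>) + indicator (pure_set g) q * (?ln / 4) \<partial>squareM)
        = (\<integral>q. \<rho> (fst q) * \<rho> (snd q) * S q \<partial>squareM) - \<delta> * (\<integral>q. \<rho> (fst q) * \<rho> (snd q) \<partial>squareM) + ?N * (?ln / 4)"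
    proof -
      have "(\<integral>q. \<rho> (fst q) * \<rho> (snd q) * (S q - \<delta>) + indicator (pure_set g) q * (?ln / 4) \<partial>squareM)
        = (\<integral>q. \<rho> (fst q) * \<rho> (snd q) * S q - \<delta> * (\<rho> (fst q) * \<rho> (snd q)) + (?ln / 4) * indicator (pure_set g) q \<partial>squareM)"
        by (intro Bochner_Integration.integral_cong refl) (simp add: algebra_simps)
      also have "\<dots> = (\<integral>q. \<rho> (fst q) * \<rho> (snd q) * S q \<partial>squareM) - \<delta> * (\<integral>q. \<rho> (fst q) * \<rho> (snd q) \<partial>squareM) + (?ln / 4) * (\<integral>q. indicator (pure_set g) q \<partial>squareM)"
      proof -
        have i: "integrable squareM (\<lambda>q. \<rho> (fst q) * \<rho> (snd q) * S q)" "integrable squareM (\<lambda>q. \<delta> * (\<rho> (fst q) * \<rho> (snd q)))"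
          "integrable squareM (\<lambda>q. (?ln / 4) * indicator (pure_set g) q)"
          by (intro squareM.P.bm_integrable bm_mult[OF b\<rho>\<rho> bS] bm_mult[OF bm_const b\<rho>\<rho>] bm_mult[OF bm_const bN])+
        show ?thesis
          by (subst Bochner_Integration.integral_add[OF Bochner_Integration.integrable_diff[OF i(1,2)] i(3)],
              subst Bochner_Integration.integral_diff[OF i(1,2)]) simp
      qed
      also have "(\<integral>q. indicator (pure_set g) q \<partial>squareM) = ?N"
        using sets.sets_into_space[OF pure_set_sets[OF g]] by (simp add: Int_absorb2)
      finally show ?thesis by (simp only: mult.commute)
    qed
    moreover have "2 * entropy g = (\<integral>q. S q \<partial>squareM)" by (simp add: entropy_squareM S_def)
    ultimately have "2 * entropy g + e * s1 - \<delta> + ?N * (?ln / 4) \<le> 2 * entropy h"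
      using lower h(3) by simp
    then have "e * s1 - \<delta> + ?N * (?ln / 4) \<le> 6 * (C * real k) * \<delta>"
      using upper by (simp add: algebra_simps)
    moreover have "- (2 * (real k * L) * \<delta>) \<le> e * s1"
    proof (cases "f1 = 0")
      case True
      then show ?thesis using f1 e by (auto simp: L_def)
    next
      case False
      then have f: "0 < f1" using f1 by auto
      have "e * \<bar>s1\<bar> = e * f1 * L" using f by (simp add: L_def)
      also have "\<dots> \<le> \<theta> e * L" using \<theta>pos(2)[OF e] L by (rule mult_right_mono)
      finally have "e * \<bar>s1\<bar> \<le> 2 * (real k * L) * \<delta>" unfolding \<theta>\<delta> by (simp add: mult_ac)
      moreover have "e * (- \<bar>s1\<bar>) \<le> e * s1" using e by (intro mult_left_mono) auto
      ultimately show ?thesis by (simp only: mult_minus_right)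
    qed
    ultimately have "\<delta> * ((?N * \<eta> / 4) * ln (1 / \<delta>)) \<le> \<delta> * (1 + 2 * (real k * L) + 6 * (C * real k))"
      by (simp add: algebra_simps)
    then show ?thesis using \<delta>0 by (simp only: mult_le_cancel_left_pos)
  qed
  define K where "K = 1 + 2 * (real k * L) + 6 * (C * real k)"
  have M1: "1 \<le> M" unfolding M_def by (simp add: integral_nonneg_AE)
  have "(?N * \<eta> / 4) * ln (1 / e') \<le> K" if e': "0 < e'" "e' \<le> min 1 (e0 * M / (2 * real k))" for e'
  proof -
    \<comment> \<open>Since \<open>\<theta> e \<le> M * e\<close>, this choice gives
      \<open>\<delta> \<le> e'\<close>, and the bound at \<open>\<delta>\<close> transfers to the
      prescribed argument \<open>e'\<close>.\<close>
    define e where "e = e' * (2 * real k) / M"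
    have "e \<le> e0" using e' M1 k by (simp add: e_def field_simps)
    moreover have e: "0 < e" using e' M1 k by (simp add: e_def)
    ultimately have ee: "0 < e" "e \<le> e0" by auto
    define \<delta> where "\<delta> = \<theta> e / (2 * real k)"
    have "\<delta> \<le> M * e / (2 * real k)" unfolding \<delta>_def using \<theta>pos(3)[OF ee] k by (intro divide_right_mono) auto
    also have "\<dots> = e'" using M1 k by (simp add: e_def)
    finally have \<delta>: "\<delta> \<le> e'" .
    have \<delta>0: "0 < \<delta>" using \<theta>pos(1)[OF ee] k by (simp add: \<delta>_def)
    have "ln (1 / e') \<le> ln (1 / \<delta>)" using \<delta> \<delta>0 e' by (simp add: ln_div)
    then have "(?N * \<eta> / 4) * ln (1 / e') \<le> (?N * \<eta> / 4) * ln (1 / \<delta>)" using \<eta> by (intro mult_left_mono) auto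
    also have "\<dots> \<le> K" unfolding K_def using \<delta> e' by (intro bound[OF ee \<delta>_def]) auto
    finally show ?thesis .
  qed
  moreover have "0 < min 1 (e0 * M / (2 * real k))" using e0 M1 k by simp
  moreover have "0 < ?N * \<eta> / 4" using pure \<eta> by simp
  ultimately show False using log_unbounded_contradiction by blast
qed

text \<open>Only one degree can satisfy \<open>2 * r ^ (k - 1) = c\<close>. Among eight degrees four
  therefore lie strictly on one side, and they provide the forbidden direction.\<close>

lemma pure_maximizer_degree_support:
  assumes max: "entropy_maximizer k \<tau> g" and k: "2 \<le> k" and gap: "star_density 1 g ^ k < star_density k g"
    and pure: "0 < measure squareM (pure_set g)" and A: "finite A" "A \<subseteq> degree_support g"
  shows "card A \<le> 7"
proof (rule ccontr)
  assume "\<not> card A \<le> 7"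
  have g: "graphon g" using max by (simp add: entropy_maximizer_def)
  have p: "1 \<le> k - 1" using k by simp
  obtain c where thr: "AE q in squareM. (degree g (fst q) ^ (k - 1) + degree g (snd q) ^ (k - 1) < c \<longrightarrow> g (fst q) (snd q) = 0) \<and>
      (c < degree g (fst q) ^ (k - 1) + degree g (snd q) ^ (k - 1) \<longrightarrow> g (fst q) (snd q) = 1)"
    using pure_maximizer_threshold[OF max k gap pure] by blast
  let ?p = "\<lambda>r. r ^ (k - 1)"
  define A1 where "A1 = {r \<in> A. 2 * ?p r < c}"
  define A2 where "A2 = {r \<in> A. c < 2 * ?p r}"
  define A0 where "A0 = {r \<in> A. 2 * ?p r = c}"
  have "card A0 \<le> Suc 0"
  proof (rule card_le_Suc0_iff_eq[THEN iffD2])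
    show "finite A0" using A by (simp add: A0_def)
    show "\<forall>a\<in>A0. \<forall>b\<in>A0. a = b"
    proof (intro ballI)
      fix a b assume "a \<in> A0" "b \<in> A0"
      then have "?p a = ?p b" "0 \<le> a" "0 \<le> b" using A(2) degree_support_range[OF g] by (auto simp: A0_def)
      then show "a = b" using power_eq_imp_eq_base[of a "k - 1" b] p by simp
    qed
  qed
  moreover have "A = A0 \<union> A1 \<union> A2" by (auto simp: A0_def A1_def A2_def)
  then have "card A \<le> card A0 + card A1 + card A2"
    by (metis card_Un_le add_le_mono1 order_trans)
  ultimately have "4 \<le> card A1 \<or> 4 \<le> card A2" using \<open>\<not> card A \<le> 7\<close> by linarith
  moreover have "finite A1" "finite A2" using A by (auto simp: A1_def A2_def)
  ultimately obtain r1 r2 r3 r4 where r: "r1 \<in> A" "r2 \<in> A" "r3 \<in> A" "r4 \<in> A" "r1 < r2" "r2 < r3" "r3 < r4"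
    and side: "c < 2 * ?p r1 \<or> 2 * ?p r4 < c"
    using four_increasing[of A1] four_increasing[of A2] unfolding A1_def A2_def by (smt (verit) mem_Collect_eq)
  have rs: "r1 \<in> degree_support g" "r2 \<in> degree_support g" "r3 \<in> degree_support g" "r4 \<in> degree_support g"
    using r A(2) by auto
  show False
    by (rule threshold_direction[OF g p thr rs r(5-7) side], rule pure_maximizer_no_direction[OF max k gap pure])
qed

section \<open>Maximizers with values inside the unit interval\<close>

lemma graphon_perturb:
  assumes g: "graphon g" and \<phi>: "bm squareM \<phi>"
    and sym: "\<And>x y. x \<in> {0..1} \<Longrightarrow> y \<in> {0..1} \<Longrightarrow> \<phi> (x, y) = \<phi> (y, x)"
    and range: "\<And>x y. x \<in> {0..1} \<Longrightarrow> y \<in> {0..1} \<Longrightarrow> 0 \<le> g x y + \<phi> (x, y) \<and> g x y + \<phi> (x, y) \<le> 1"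
  shows "graphon (\<lambda>x y. g x y + \<phi> (x, y))"
proof (rule graphonI)
  have "bm squareM (\<lambda>p. g (fst p) (snd p) + \<phi> p)" by (intro bm_add graphonD(1)[OF g] \<phi>)
  then show "(\<lambda>p. g (fst p) (snd p) + \<phi> (fst p, snd p)) \<in> borel_measurable squareM" by (simp add: bm_measurable)
  fix x y :: real assume xy: "x \<in> {0..1}" "y \<in> {0..1}"
  show "g x y + \<phi> (x, y) = g y x + \<phi> (y, x) \<and> 0 \<le> g x y + \<phi> (x, y) \<and> g x y + \<phi> (x, y) \<le> 1"
    using graphonD(2)[OF g xy] sym[OF xy] range[OF xy] by simp
qed

lemma star_density_1_squareM: "graphon g \<Longrightarrow> star_density 1 g = (\<integral>p. g (fst p) (snd p) \<partial>squareM)"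
  using squareM_iterate[OF graphonD(1), of g] by (simp add: star_density_unitM degree_unitM)

text \<open>The perturbation is \<open>w\<^sup>2\<close> times the residual of \<open>S'(g)\<close> after projection onto the span of \<open>1\<close> and \<open>D\<close> in
  \<open>L\<^sup>2(w\<^sup>2)\<close>, where \<open>w = g * (1 - g)\<close>: the weight keeps \<open>g\<close> inside \<open>[0, 1]\<close> and compensates the infinite
  slope of \<open>S\<close>.\<close>

lemma interior_maximizer_euler_lagrange:
  assumes max: "entropy_maximizer k \<tau> g" and k: "2 \<le> k" and gap: "star_density 1 g ^ k < star_density k g"
    and int: "measure squareM (pure_set g) = 0"
  shows "\<exists>\<alpha> \<beta>. AE q in squareM. g (fst q) (snd q) =
    1 / (1 + exp (- (\<alpha> + \<beta> * (degree g (fst q) ^ (k - 1) + degree g (snd q) ^ (k - 1)))))"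
proof -
  have g: "graphon g" using max by (simp add: entropy_maximizer_def)
  have k1: "1 \<le> k" using k by simp
  note gb = graphonD(1)[OF g]
  have [measurable]: "(\<lambda>p. g (fst p) (snd p)) \<in> borel_measurable squareM" by (rule bm_measurable[OF gb])
  define \<gamma> where "\<gamma> q = g (fst q) (snd q)" for q
  have \<gamma>01: "0 \<le> \<gamma> q" "\<gamma> q \<le> 1" if "q \<in> space squareM" for q
    using that graphonD(3,4)[OF g] by (auto simp: \<gamma>_def)
  have interior: "AE q in squareM. 0 < \<gamma> q \<and> \<gamma> q < 1"
  proof -
    have "pure_set g \<in> null_sets squareM"
      using int pure_set_sets[OF g] by (auto simp: null_sets_def squareM.P.emeasure_eq_measure)
    from AE_not_in[OF this] AE_space[of squareM] show ?thesis
    proof eventually_elim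
      case (elim q)
      then have "\<gamma> q \<noteq> 0" "\<gamma> q \<noteq> 1" by (auto simp: pure_set_def \<gamma>_def)
      then show ?case using \<gamma>01[OF elim(2)] by simp
    qed
  qed
  define a where "a x = degree g x ^ (k - 1)" for x
  have ba: "bm unitM a" unfolding a_def by (intro star_density_bm g)
  define D where "D q = a (fst q) + a (snd q)" for q
  have bD: "bm squareM D" unfolding D_def by (intro bm_add bm_fst[OF ba] bm_snd[OF ba])
  define w where "w q = \<gamma> q * (1 - \<gamma> q)" for q
  have b\<gamma>: "bm squareM \<gamma>" unfolding \<gamma>_def by (rule gb)
  have bw: "bm squareM w" unfolding w_def by (intro bm_mult bm_diff bm_const b\<gamma>)
  have w01: "0 \<le> w q" "w q \<le> 1" if "q \<in> space squareM" for q
    using \<gamma>01[OF that] by (auto simp: w_def intro: mult_le_one)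
  \<comment> \<open>\<open>w * S'(g)\<close>: the weight makes the unbounded slope bounded, because
    \<open>u * ln u\<close> is bounded on the unit interval.\<close>
  define \<psi> where "\<psi> q = w q * ln ((1 - \<gamma> q) / \<gamma> q)" for q
  have b\<psi>: "bm squareM \<psi>"
  proof (rule bmI[of _ _ 1])
    show "\<psi> \<in> borel_measurable squareM" unfolding \<psi>_def w_def \<gamma>_def by measurable
    fix q assume q: "q \<in> space squareM"
    show "\<bar>\<psi> q\<bar> \<le> 1"
    proof (cases "\<gamma> q = 0 \<or> \<gamma> q = 1")
      case True then show ?thesis by (auto simp: \<psi>_def w_def)
    next
      case False
      then have i: "0 < \<gamma> q" "\<gamma> q < 1" using \<gamma>01[OF q] by auto
      define A where "A = - (\<gamma> q * ln (\<gamma> q))"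
      define B where "B = - ((1 - \<gamma> q) * ln (1 - \<gamma> q))"
      have nn: "0 \<le> A" "0 \<le> B" using i by (auto simp: A_def B_def mult_nonneg_nonpos)
      have "A + B = S_ent (\<gamma> q)" by (simp add: A_def B_def S_ent_def)
      then have AB: "A \<le> 1" "B \<le> 1" using nn S_ent_le_1[of "\<gamma> q"] i by auto
      have "\<psi> q = (1 - \<gamma> q) * A - \<gamma> q * B"
        using i by (simp add: \<psi>_def w_def A_def B_def ln_div algebra_simps)
      moreover have "0 \<le> (1 - \<gamma> q) * A" "(1 - \<gamma> q) * A \<le> 1" "0 \<le> \<gamma> q * B" "\<gamma> q * B \<le> 1"
        using i nn AB by (auto intro: mult_le_one)
      ultimately show ?thesis by (auto simp: abs_le_iff)
    qed
  qed
  have bww: "bm squareM (\<lambda>q. w q * w q)" by (intro bm_mult bw)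
  define W0 where "W0 = (\<integral>q. w q * w q \<partial>squareM)"
  have W0: "W0 \<noteq> 0"
  proof
    assume "W0 = 0"
    then have "AE q in squareM. w q * w q = 0"
      unfolding W0_def by (subst (asm) integral_nonneg_eq_0_iff_AE[OF squareM.P.bm_integrable[OF bww]]) auto
    with interior have "AE q in squareM. False" by eventually_elim (auto simp: w_def)
    then show False using squareM.P.AE_False by simp
  qed
  \<comment> \<open>Subtracting \<open>m\<close> makes 1 and \<open>E\<close> orthogonal for the
    weight \<open>w * w\<close>, so \<open>\<alpha>'\<close> and \<open>b\<close> are independent
    projection coefficients. If \<open>V = 0\<close>, then \<open>b = 0\<close> by division by zero,
    which is still the right projection.\<close>
  define m where "m = (\<integral>q. w q * w q * D q \<partial>squareM) / W0"
  define E where "E q = D q - m" for q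
  have bE: "bm squareM E" unfolding E_def by (intro bm_diff bD bm_const)
  define V where "V = (\<integral>q. w q * w q * (E q * E q) \<partial>squareM)"
  define \<alpha>' where "\<alpha>' = (\<integral>q. w q * \<psi> q \<partial>squareM) / W0"
  define b where "b = (\<integral>q. w q * \<psi> q * E q \<partial>squareM) / V"
  define \<omega> where "\<omega> q = \<psi> q - w q * (\<alpha>' + b * E q)" for q
  have b\<omega>: "bm squareM \<omega>" unfolding \<omega>_def by (intro bm_diff bm_mult bm_add bm_const b\<psi> bw bE)
  define \<phi> where "\<phi> q = w q * \<omega> q" for q
  have b\<phi>: "bm squareM \<phi>" unfolding \<phi>_def by (intro bm_mult bw b\<omega>)
  note I = squareM.P.bm_integrable
  have iE: "(\<integral>q. w q * w q * E q \<partial>squareM) = 0"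
  proof -
    have "(\<integral>q. w q * w q * E q \<partial>squareM) = (\<integral>q. w q * w q * D q - m * (w q * w q) \<partial>squareM)"
      by (simp add: E_def algebra_simps)
    also have "\<dots> = (\<integral>q. w q * w q * D q \<partial>squareM) - m * W0"
      using I[OF bm_mult[OF bww bD]] I[OF bww] by (simp add: W0_def)
    finally show ?thesis using W0 by (simp add: m_def)
  qed
  have i\<phi>: "(\<integral>q. \<phi> q \<partial>squareM) = 0"
  proof -
    have "(\<integral>q. \<phi> q \<partial>squareM) = (\<integral>q. w q * \<psi> q - \<alpha>' * (w q * w q) - b * (w q * w q * E q) \<partial>squareM)"
      by (simp add: \<phi>_def \<omega>_def algebra_simps)
    also have "\<dots> = (\<integral>q. w q * \<psi> q \<partial>squareM) - \<alpha>' * W0 - b * (\<integral>q. w q * w q * E q \<partial>squareM)"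
      using I[OF bm_mult[OF bw b\<psi>]] I[OF bww] I[OF bm_mult[OF bww bE]] by (simp add: W0_def)
    finally show ?thesis using W0 iE by (simp add: \<alpha>'_def)
  qed
  have i\<phi>E: "(\<integral>q. \<phi> q * E q \<partial>squareM) = 0"
  proof -
    have "(\<integral>q. \<phi> q * E q \<partial>squareM) = (\<integral>q. w q * \<psi> q * E q - \<alpha>' * (w q * w q * E q) - b * (w q * w q * (E q * E q)) \<partial>squareM)"
      by (simp add: \<phi>_def \<omega>_def algebra_simps)
    also have "\<dots> = (\<integral>q. w q * \<psi> q * E q \<partial>squareM) - \<alpha>' * (\<integral>q. w q * w q * E q \<partial>squareM) - b * V"
      using I[OF bm_mult[OF bm_mult[OF bw b\<psi>] bE]] I[OF bm_mult[OF bww bE]] I[OF bm_mult[OF bww bm_mult[OF bE bE]]]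
      by (simp add: V_def)
    also have "\<dots> = (\<integral>q. w q * \<psi> q * E q \<partial>squareM) - b * V" using iE by simp
    also have "\<dots> = 0"
    proof (cases "V = 0")
      case True
      have "AE q in squareM. w q * w q * (E q * E q) = 0"
        using True unfolding V_def
        by (subst (asm) integral_nonneg_eq_0_iff_AE[OF I[OF bm_mult[OF bww bm_mult[OF bE bE]]]]) auto
      then have "AE q in squareM. w q * \<psi> q * E q = 0" by eventually_elim auto
      then have "(\<integral>q. w q * \<psi> q * E q \<partial>squareM) = 0" by (rule integral_eq_zero_AE)
      then show ?thesis using True by simp
    qed (simp add: b_def)
    finally show ?thesis .
  qed
  have i\<phi>D: "(\<integral>q. \<phi> q * D q \<partial>squareM) = 0"
  proof -
    have "(\<integral>q. \<phi> q * D q \<partial>squareM) = (\<integral>q. \<phi> q * E q + m * \<phi> q \<partial>squareM)" by (simp add: E_def algebra_simps)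
    also have "\<dots> = 0" using I[OF bm_mult[OF b\<phi> bE]] I[OF b\<phi>] i\<phi> i\<phi>E by simp
    finally show ?thesis .
  qed
  have sym: "\<phi> (x, y) = \<phi> (y, x)" if "x \<in> {0..1}" "y \<in> {0..1}" for x y
    using graphonD(2)[OF g that] by (simp add: \<phi>_def \<omega>_def w_def \<psi>_def \<gamma>_def E_def D_def add.commute)
  define \<phi>1 where "\<phi>1 x = (\<integral>y. \<phi> (x, y) \<partial>unitM)" for x
  have b\<phi>1: "bm unitM \<phi>1" unfolding \<phi>1_def by (rule bm_integral_snd[OF b\<phi>])
  have i\<phi>1: "(\<integral>x. a x * \<phi>1 x \<partial>unitM) = 0"
  proof -
    have 1: "(\<integral>x. a x * \<phi>1 x \<partial>unitM) = (\<integral>q. a (fst q) * \<phi> q \<partial>squareM)"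
      unfolding \<phi>1_def using squareM_integral_fst[OF ba b\<phi>] by simp
    have "(\<integral>q. a (snd q) * \<phi> q \<partial>squareM) = (\<integral>q. a (fst q) * \<phi> (snd q, fst q) \<partial>squareM)"
      using squareM_swap[OF bm_mult[OF bm_snd[OF ba] b\<phi>]] by simp
    also have "\<dots> = (\<integral>q. a (fst q) * \<phi> q \<partial>squareM)"
      using sym by (intro Bochner_Integration.integral_cong) auto
    finally have 2: "(\<integral>q. a (snd q) * \<phi> q \<partial>squareM) = (\<integral>q. a (fst q) * \<phi> q \<partial>squareM)" .
    have "(\<integral>q. \<phi> q * D q \<partial>squareM) = (\<integral>q. a (fst q) * \<phi> q + a (snd q) * \<phi> q \<partial>squareM)"
      by (simp add: D_def algebra_simps)
    also have "\<dots> = 2 * (\<integral>q. a (fst q) * \<phi> q \<partial>squareM)"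
      using I[OF bm_mult[OF bm_fst[OF ba] b\<phi>]] I[OF bm_mult[OF bm_snd[OF ba] b\<phi>]] 2 by simp
    finally show ?thesis using 1 i\<phi>D by simp
  qed
  obtain K where K: "0 \<le> K" "\<And>q. q \<in> space squareM \<Longrightarrow> \<bar>\<omega> q\<bar> \<le> K" using bm_bound[OF b\<omega>] by auto
  have \<phi>K: "\<bar>\<phi> q\<bar> \<le> K * w q" if "q \<in> space squareM" for q
    unfolding \<phi>_def abs_mult using mult_right_mono[OF K(2)[OF that] w01(1)[OF that]] w01[OF that]
    by (simp add: mult.commute)
  define s0 where "s0 = 1 / (2 * (K + 1))"
  have s0: "0 < s0" "s0 \<le> 1" "s0 * K \<le> 1 / 2" using K by (auto simp: s0_def field_simps)
  obtain C where C: "0 \<le> C"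
    "\<And>h. graphon h \<Longrightarrow> C * \<bar>star_density 1 h - star_density 1 g\<bar> \<le> star_density k h - star_density k g \<Longrightarrow>
       entropy h \<le> entropy g + C * (star_density k h - star_density k g)"
    using maximizer_penalty[OF max k1 gap] by blast
  obtain C2 where C2: "0 \<le> C2" "\<And>d h :: real. \<bar>d\<bar> \<le> 1 \<Longrightarrow> \<bar>h\<bar> \<le> 1 \<Longrightarrow> \<bar>(d + h) ^ k - d ^ k - real k * d ^ (k - 1) * h\<bar> \<le> C2 * h\<^sup>2"
    using power_taylor2[of k] by blast
  define Z where "Z = 2 * C * C2 * K\<^sup>2 + 2 * K\<^sup>2"
  \<comment> \<open>The entropy gains \<open>s\<close> times the integral to first order. As
    \<open>\<phi>\<close> is orthogonal to 1 and to \<open>D\<close>, the change of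
    \<open>t1\<close> is zero and that of \<open>tk\<close> is of order \<open>s\<^sup>2\<close>,
    like the remaining errors.\<close>
  have main: "(\<integral>q. \<omega> q * \<psi> q \<partial>squareM) \<le> Z * s" if s: "0 < s" "s \<le> s0" for s
  proof -
    have small: "\<bar>s * \<phi> q\<bar> \<le> w q / 2" if q: "q \<in> space squareM" for q
    proof -
      have "\<bar>s * \<phi> q\<bar> \<le> s0 * (K * w q)"
        unfolding abs_mult using s s0 \<phi>K[OF q] by (intro mult_mono) auto
      also have "\<dots> \<le> 1 / 2 * w q" using mult_right_mono[OF s0(3) w01(1)[OF q]] by (simp add: mult.assoc)
      finally show ?thesis by simp
    qed
    have wle: "w q \<le> \<gamma> q" "w q \<le> 1 - \<gamma> q" if "q \<in> space squareM" for q
      using \<gamma>01[OF that] by (auto simp: w_def mult_left_le mult_left_le_one_le)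
    define f where "f = (\<lambda>x y. g x y + s * \<phi> (x, y))"
    have f: "graphon f"
      unfolding f_def
    proof (rule graphon_perturb[OF g, of "\<lambda>q. s * \<phi> q"])
      show "bm squareM (\<lambda>q. s * \<phi> q)" by (intro bm_mult bm_const b\<phi>)
      fix x y :: real assume xy: "x \<in> {0..1}" "y \<in> {0..1}"
      show "s * \<phi> (x, y) = s * \<phi> (y, x)" using sym[OF xy] by simp
      have q: "(x, y) \<in> space squareM" using xy by simp
      show "0 \<le> g x y + s * \<phi> (x, y) \<and> g x y + s * \<phi> (x, y) \<le> 1"
        using small[OF q] wle[OF q] \<gamma>01[OF q] w01[OF q] by (auto simp: \<gamma>_def abs_le_iff)
    qed
    have f1: "star_density 1 f = star_density 1 g"
      unfolding star_density_1_squareM[OF f] star_density_1_squareM[OF g] unfolding f_def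
      using I[OF gb] I[OF b\<phi>] i\<phi> by simp
    have df: "degree f x = degree g x + s * \<phi>1 x" if "x \<in> {0..1}" for x
      unfolding degree_unitM f_def \<phi>1_def
      using unitM.bm_integrable[OF graphon_section[OF g that]] unitM.bm_integrable[OF bm_section[OF b\<phi> that]] by simp
    have \<phi>1K: "\<bar>\<phi>1 x\<bar> \<le> K" if x: "x \<in> {0..1}" for x
    proof -
      have "\<bar>\<phi>1 x\<bar> \<le> (\<integral>y. \<bar>\<phi> (x, y)\<bar> \<partial>unitM)" unfolding \<phi>1_def by (rule integral_abs_bound)
      also have "\<dots> \<le> (\<integral>y. K \<partial>unitM)"
      proof (rule integral_mono)
        show "integrable unitM (\<lambda>y. \<bar>\<phi> (x, y)\<bar>)" using unitM.bm_integrable[OF bm_section[OF b\<phi> x]] by (rule integrable_abs)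
        fix y assume "y \<in> space unitM"
        then have q: "(x, y) \<in> space squareM" using x by simp
        show "\<bar>\<phi> (x, y)\<bar> \<le> K" using \<phi>K[OF q] w01[OF q] K(1) mult_left_le[of "w (x, y)" K] by linarith
      qed simp
      finally show ?thesis by simp
    qed
    have idk: "integrable unitM (\<lambda>x. degree g x ^ k)" "integrable unitM (\<lambda>x. a x * \<phi>1 x)" "integrable unitM (\<lambda>x. degree f x ^ k)"
      by (intro unitM.bm_integrable bm_mult star_density_bm g f ba b\<phi>1)+
    have base: "(\<integral>x. degree g x ^ k + real k * s * (a x * \<phi>1 x) \<partial>unitM) = star_density k g"
      using idk i\<phi>1 by (simp add: star_density_unitM)
    \<comment> \<open>Convexity gives the one-sided inequality that the penalty demands; the
      orthogonality to \<open>D\<close> has removed the linear term.\<close>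
    have lo: "star_density k g \<le> star_density k f"
      unfolding base[symmetric] star_density_unitM[of k f]
    proof (rule integral_mono)
      fix x assume "x \<in> space unitM"
      then have x: "x \<in> {0..1}" by simp
      have "degree g x ^ k + real k * degree g x ^ (k - 1) * (degree f x - degree g x) \<le> degree f x ^ k"
        using degree_range[OF g x] degree_range[OF f x] by (intro power_above_tangent) auto
      then show "degree g x ^ k + real k * s * (a x * \<phi>1 x) \<le> degree f x ^ k"
        unfolding df[OF x] a_def by (simp add: mult_ac)
    qed (use idk in auto)
    have "star_density k f \<le> (\<integral>x. (degree g x ^ k + real k * s * (a x * \<phi>1 x)) + C2 * K\<^sup>2 * s\<^sup>2 \<partial>unitM)"
      unfolding star_density_unitM[of k f]
    proof (rule integral_mono)
      fix x assume "x \<in> space unitM"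
      then have x: "x \<in> {0..1}" by simp
      have "\<bar>s * \<phi>1 x\<bar> \<le> s0 * K" unfolding abs_mult using s s0 \<phi>1K[OF x] by (intro mult_mono) auto
      then have "\<bar>s * \<phi>1 x\<bar> \<le> 1" using s0(3) by linarith
      then have "\<bar>(degree g x + s * \<phi>1 x) ^ k - degree g x ^ k - real k * degree g x ^ (k - 1) * (s * \<phi>1 x)\<bar> \<le> C2 * (s * \<phi>1 x)\<^sup>2"
        using degree_range[OF g x] by (intro C2(2)) auto
      also have "C2 * (s * \<phi>1 x)\<^sup>2 \<le> C2 * (s\<^sup>2 * K\<^sup>2)"
        unfolding power_mult_distrib using \<phi>1K[OF x] C2(1) by (intro mult_left_mono) (auto simp: abs_le_square_iff[symmetric] K(1))
      finally show "degree f x ^ k \<le> (degree g x ^ k + real k * s * (a x * \<phi>1 x)) + C2 * K\<^sup>2 * s\<^sup>2"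
        unfolding df[OF x] a_def by (simp add: abs_le_iff mult_ac)
    qed (use idk in auto)
    also have "\<dots> = star_density k g + C2 * K\<^sup>2 * s\<^sup>2"
      using idk base by simp
    finally have up: "star_density k f - star_density k g \<le> C2 * K\<^sup>2 * s\<^sup>2" by simp
    have "entropy f \<le> entropy g + C * (star_density k f - star_density k g)" using f1 lo by (intro C(2) f) auto
    also have "\<dots> \<le> entropy g + C * (C2 * K\<^sup>2 * s\<^sup>2)" using up C(1) by (intro add_left_mono mult_left_mono) auto
    finally have upper: "entropy f \<le> entropy g + C * (C2 * K\<^sup>2 * s\<^sup>2)" .
    have b\<omega>\<psi>: "bm squareM (\<lambda>q. \<omega> q * \<psi> q)" by (intro bm_mult b\<omega> b\<psi>)
    have bS: "bm squareM (\<lambda>q. S_ent (\<gamma> q))" unfolding \<gamma>_def by (rule S_ent_graphon_bm[OF g])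
    have "(\<integral>q. S_ent (\<gamma> q) + s * (\<omega> q * \<psi> q) - 2 * s\<^sup>2 * K\<^sup>2 \<partial>squareM) \<le> (\<integral>q. S_ent (f (fst q) (snd q)) \<partial>squareM)"
    proof (rule integral_mono_AE)
      show "integrable squareM (\<lambda>q. S_ent (\<gamma> q) + s * (\<omega> q * \<psi> q) - 2 * s\<^sup>2 * K\<^sup>2)"
        by (intro I bm_diff bm_add bm_mult bm_const b\<omega> b\<psi> bS)
      show "integrable squareM (\<lambda>q. S_ent (f (fst q) (snd q)))" by (intro I S_ent_graphon_bm f)
      show "AE q in squareM. S_ent (\<gamma> q) + s * (\<omega> q * \<psi> q) - 2 * s\<^sup>2 * K\<^sup>2 \<le> S_ent (f (fst q) (snd q))"
        using interior AE_space[of squareM]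
      proof eventually_elim
        case (elim q)
        then have i: "0 < \<gamma> q" "\<gamma> q < 1" and q: "q \<in> space squareM" by auto
        have w: "0 < w q" using i by (simp add: w_def)
        have "S_ent (\<gamma> q) + (s * \<phi> q) * ln ((1 - \<gamma> q) / \<gamma> q) - 2 * (s * \<phi> q)\<^sup>2 / (\<gamma> q * (1 - \<gamma> q)) \<le> S_ent (\<gamma> q + s * \<phi> q)"
          using small[OF q] wle[OF q] i by (intro S_ent_taylor_lower) auto
        moreover have "(s * \<phi> q) * ln ((1 - \<gamma> q) / \<gamma> q) = s * (\<omega> q * \<psi> q)"
          by (simp add: \<phi>_def \<psi>_def)
        moreover have "2 * (s * \<phi> q)\<^sup>2 / (\<gamma> q * (1 - \<gamma> q)) \<le> 2 * s\<^sup>2 * K\<^sup>2"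
        proof -
          have "(\<phi> q)\<^sup>2 / w q = (\<omega> q)\<^sup>2 * w q" using w by (simp add: \<phi>_def power2_eq_square)
          also have "\<dots> \<le> K\<^sup>2 * 1"
            using K(2)[OF q] K(1) w01[OF q] by (intro mult_mono) (auto simp: abs_le_square_iff[symmetric])
          finally have "2 * s\<^sup>2 * ((\<phi> q)\<^sup>2 / w q) \<le> 2 * s\<^sup>2 * K\<^sup>2" by (intro mult_left_mono) auto
          then show ?thesis by (simp add: w_def power_mult_distrib)
        qed
        ultimately have "S_ent (\<gamma> q) + s * (\<omega> q * \<psi> q) - 2 * s\<^sup>2 * K\<^sup>2 \<le> S_ent (\<gamma> q + s * \<phi> q)" by linarith
        then show ?case by (simp add: f_def \<gamma>_def)
      qed
    qed
    moreover have "(\<integral>q. S_ent (\<gamma> q) + s * (\<omega> q * \<psi> q) - 2 * s\<^sup>2 * K\<^sup>2 \<partial>squareM) = 2 * entropy g + s * (\<integral>q. \<omega> q * \<psi> q \<partial>squareM) - 2 * s\<^sup>2 * K\<^sup>2"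
      using I[OF bS] I[OF b\<omega>\<psi>] by (simp add: entropy_squareM \<gamma>_def)
    ultimately have "s * (\<integral>q. \<omega> q * \<psi> q \<partial>squareM) \<le> 2 * entropy f - 2 * entropy g + 2 * s\<^sup>2 * K\<^sup>2"
      by (simp add: entropy_squareM)
    also have "\<dots> \<le> s * (Z * s)" using upper by (simp add: Z_def algebra_simps power2_eq_square)
    finally show ?thesis using s by simp
  qed
  have "(\<integral>q. \<omega> q * \<psi> q \<partial>squareM) \<le> 0"
  proof (rule ccontr)
    assume "\<not> ?thesis"
    define J where "J = (\<integral>q. \<omega> q * \<psi> q \<partial>squareM)"
    have J: "0 < J" using \<open>\<not> (\<integral>q. \<omega> q * \<psi> q \<partial>squareM) \<le> 0\<close> by (simp add: J_def)
    have Z: "0 \<le> Z" using C C2 by (simp add: Z_def)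
    define s where "s = min s0 (J / (2 * (Z + 1)))"
    have s: "0 < s" "s \<le> s0" "s \<le> J / (2 * (Z + 1))" using s0 J Z by (auto simp: s_def)
    have "J \<le> Z * s" using main[OF s(1,2)] by (simp add: J_def)
    also have "\<dots> \<le> (Z + 1) * (J / (2 * (Z + 1)))" using s Z by (intro mult_mono) auto
    also have "\<dots> = J / 2" using Z by (simp add: field_simps)
    finally show False using J by simp
  qed
  \<comment> \<open>\<open>\<omega>\<close> and \<open>\<psi>\<close> differ by
    \<open>w * (\<alpha>' + b * E)\<close>, whose product with \<open>\<omega>\<close> is
    \<open>\<phi> * (\<alpha>' + b * E)\<close>, of integral 0.\<close>
  moreover have "(\<integral>q. \<omega> q * \<omega> q \<partial>squareM) = (\<integral>q. \<omega> q * \<psi> q \<partial>squareM)"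
  proof -
    have "(\<integral>q. \<omega> q * \<omega> q \<partial>squareM) = (\<integral>q. \<omega> q * \<psi> q - \<alpha>' * \<phi> q - b * (\<phi> q * E q) \<partial>squareM)"
      by (intro Bochner_Integration.integral_cong refl) (simp add: \<phi>_def \<omega>_def algebra_simps)
    also have "\<dots> = (\<integral>q. \<omega> q * \<psi> q \<partial>squareM) - \<alpha>' * (\<integral>q. \<phi> q \<partial>squareM) - b * (\<integral>q. \<phi> q * E q \<partial>squareM)"
      using I[OF bm_mult[OF b\<omega> b\<psi>]] I[OF b\<phi>] I[OF bm_mult[OF b\<phi> bE]] by simp
    finally show ?thesis using i\<phi> i\<phi>E by simp
  qed
  moreover have "0 \<le> (\<integral>q. \<omega> q * \<omega> q \<partial>squareM)" by (intro integral_nonneg_AE AE_I2) auto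
  ultimately have "(\<integral>q. \<omega> q * \<omega> q \<partial>squareM) = 0" by simp
  then have "AE q in squareM. \<omega> q * \<omega> q = 0"
    by (subst (asm) integral_nonneg_eq_0_iff_AE[OF I[OF bm_mult[OF b\<omega> b\<omega>]]]) auto
  \<comment> \<open>The slope \<open>ln ((1 - g) / g)\<close> is minus the logit of
    \<open>g\<close>, hence the opposite signs of \<open>\<alpha>'\<close> and \<open>b\<close> in
    the exponent.\<close>
  with interior have "AE q in squareM. g (fst q) (snd q) =
    1 / (1 + exp (- ((- \<alpha>' + b * m) + (- b) * (degree g (fst q) ^ (k - 1) + degree g (snd q) ^ (k - 1)))))"
  proof eventually_elim
    case (elim q)
    have i: "0 < \<gamma> q" "\<gamma> q < 1" using elim by auto
    have w: "0 < w q" using i by (simp add: w_def)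
    have "w q * ln ((1 - \<gamma> q) / \<gamma> q) = w q * (\<alpha>' + b * E q)" using elim by (simp add: \<omega>_def \<psi>_def)
    then have "ln ((1 - \<gamma> q) / \<gamma> q) = \<alpha>' + b * E q" using w by simp
    then have "(1 - \<gamma> q) / \<gamma> q = exp (\<alpha>' + b * E q)" using i exp_ln[of "(1 - \<gamma> q) / \<gamma> q"] by simp
    then have "1 + exp (\<alpha>' + b * E q) = 1 / \<gamma> q" using i by (simp add: field_simps)
    then have "\<gamma> q = 1 / (1 + exp (\<alpha>' + b * E q))" by simp
    also have "\<alpha>' + b * E q = - ((- \<alpha>' + b * m) + (- b) * (degree g (fst q) ^ (k - 1) + degree g (snd q) ^ (k - 1)))"
      by (simp add: E_def D_def a_def algebra_simps)
    finally show ?case by (simp add: \<gamma>_def)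
  qed
  then show ?thesis by blast
qed

text \<open>For \<open>\<beta> \<le> 0\<close> a vertex of larger degree would have smaller neighbourhoods.\<close>

lemma logistic_nonpos_degree_const:
  assumes g: "graphon g" and p: "1 \<le> p" and \<beta>: "\<beta> \<le> 0"
    and EL: "AE q in squareM. g (fst q) (snd q) = 1 / (1 + exp (- (\<alpha> + \<beta> * (degree g (fst q) ^ p + degree g (snd q) ^ p))))"
  shows "\<exists>c. AE x in unitM. degree g x = c"
proof -
  \<comment> \<open>The degree of a vertex as a function of its own power \<open>z\<close>. Almost
    every degree solves \<open>d = F (d ^ p)\<close> with \<open>F\<close> decreasing, which leaves
    room for one value only.\<close>
  define F where "F z = (\<integral>y. 1 / (1 + exp (- (\<alpha> + \<beta> * (z + degree g y ^ p)))) \<partial>unitM)" for z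
  have bF: "bm unitM (\<lambda>y. 1 / (1 + exp (- (\<alpha> + \<beta> * (z + degree g y ^ p)))))" for z
  proof (rule bmI[of _ _ 1])
    have [measurable]: "degree g \<in> borel_measurable unitM" by (intro bm_measurable degree_bm g)
    show "(\<lambda>y. 1 / (1 + exp (- (\<alpha> + \<beta> * (z + degree g y ^ p))))) \<in> borel_measurable unitM" by measurable
    have "0 < exp u" for u :: real by simp
    then show "\<bar>1 / (1 + exp (- (\<alpha> + \<beta> * (z + degree g y ^ p))))\<bar> \<le> 1" for y
      by (simp add: abs_of_pos add_pos_pos divide_le_eq_1)
  qed
  have anti: "F z' \<le> F z" if "z \<le> z'" for z z'
    unfolding F_def
  proof (intro integral_mono unitM.bm_integrable bF)
    fix y
    have "\<alpha> + \<beta> * (z' + degree g y ^ p) \<le> \<alpha> + \<beta> * (z + degree g y ^ p)"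
      using that \<beta> by (intro add_left_mono mult_left_mono_neg) auto
    then show "1 / (1 + exp (- (\<alpha> + \<beta> * (z' + degree g y ^ p)))) \<le> 1 / (1 + exp (- (\<alpha> + \<beta> * (z + degree g y ^ p))))"
      by (intro divide_left_mono mult_pos_pos add_pos_pos) auto
  qed
  have "AE x in unitM. AE y in unitM. g x y = 1 / (1 + exp (- (\<alpha> + \<beta> * (degree g x ^ p + degree g y ^ p))))"
    using squareM.AE_pair[OF EL] by simp
  with AE_space[of unitM] have fixed: "AE x in unitM. x \<in> {0..1} \<and> degree g x = F (degree g x ^ p)"
  proof eventually_elim
    case (elim x)
    have x: "x \<in> {0..1}" using elim by simp
    have "degree g x = F (degree g x ^ p)"
      unfolding degree_unitM[of g x] F_def
      by (rule integral_cong_AE[OF bm_measurable[OF graphon_section[OF g x]] bm_measurable[OF bF[unfolded degree_unitM[of g x]]]])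
         (use elim(2) in \<open>simp add: degree_unitM[of g x]\<close>)
    then show ?case using x by simp
  qed
  have "\<exists>x0. x0 \<in> {0..1} \<and> degree g x0 = F (degree g x0 ^ p)"
  proof (rule ccontr)
    assume none: "\<not> ?thesis"
    from fixed have "AE x in unitM. False" by eventually_elim (use none in blast)
    then show False using unitM.AE_False by simp
  qed
  then obtain x0 where x0: "x0 \<in> {0..1}" "degree g x0 = F (degree g x0 ^ p)" by blast
  have "AE x in unitM. degree g x = degree g x0"
    using fixed
  proof eventually_elim
    case (elim x)
    have r: "0 \<le> degree g x" "0 \<le> degree g x0" using elim x0 degree_range[OF g] by auto
    have "degree g x \<le> degree g x0" if "degree g x0 \<le> degree g x"
      using anti[of "degree g x0 ^ p" "degree g x ^ p"] that r x0 elim by (simp add: power_mono)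
    moreover have "degree g x0 \<le> degree g x" if "degree g x \<le> degree g x0"
      using anti[of "degree g x ^ p" "degree g x0 ^ p"] that r x0 elim by (simp add: power_mono)
    ultimately show ?case by linarith
  qed
  then show ?thesis by blast
qed

lemma degree_const_no_gap:
  assumes g: "graphon g" and c: "AE x in unitM. degree g x = c"
  shows "star_density j g = c ^ j"
proof -
  have "star_density j g = (\<integral>x. c ^ j \<partial>unitM)"
    unfolding star_density_unitM
  proof (rule integral_cong_AE)
    show "AE x in unitM. degree g x ^ j = c ^ j" using c by eventually_elim simp
  qed (use bm_measurable[OF star_density_bm[OF g]] in auto)
  then show ?thesis by simp
qed

text \<open>The integrand of \<open>tk\<close> when vertices have weight
  \<open>1 + \<epsilon> * v\<close> and the weighted section is a cubic in
  \<open>\<epsilon>\<close>. One constant must serve all vertices, so it depends on the bound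
  \<open>K\<close> and on \<open>k\<close> alone.\<close>

lemma second_order_expansion:
  assumes K: "1 \<le> (K::real)"
  shows "\<exists>C\<ge>0. \<forall>d q \<psi> r v \<epsilon>. \<bar>d\<bar> \<le> 1 \<longrightarrow> \<bar>q\<bar> \<le> K \<longrightarrow> \<bar>\<psi>\<bar> \<le> K \<longrightarrow> \<bar>r\<bar> \<le> K \<longrightarrow> \<bar>v\<bar> \<le> K \<longrightarrow> 0 < \<epsilon> \<longrightarrow> \<epsilon> \<le> 1 / (3 * K) \<longrightarrow>
    \<bar>(1 + \<epsilon> * v) * (d + \<epsilon> * q + \<epsilon>\<^sup>2 * \<psi> + \<epsilon> ^ 3 * r) ^ k
      - (d ^ k + \<epsilon> * (v * d ^ k + real k * d ^ (k - 1) * q)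
         + \<epsilon>\<^sup>2 * (real k * d ^ (k - 1) * \<psi> + real k * real (k - 1) / 2 * d ^ (k - 2) * q\<^sup>2 + real k * v * d ^ (k - 1) * q))\<bar> \<le> C * \<epsilon> ^ 3"
proof -
  obtain T where T: "0 \<le> T" "\<And>d h :: real. \<bar>d\<bar> \<le> 1 \<Longrightarrow> \<bar>h\<bar> \<le> 1 \<Longrightarrow>
     \<bar>(d + h) ^ k - d ^ k - real k * d ^ (k - 1) * h - real k * real (k - 1) / 2 * d ^ (k - 2) * h\<^sup>2\<bar> \<le> T * \<bar>h\<bar> ^ 3"
    using power_taylor3[of k] by blast
  let ?c = "real k * real (k - 1) / 2"
  define M where "M = real k * K + ?c * (2 * K * (2 * K) + (2 * K)\<^sup>2) + K * (real k * (2 * K) + ?c * (3 * K)\<^sup>2)"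
  have M0: "0 \<le> M" using K by (simp add: M_def)
  show ?thesis
  proof (intro exI[of _ "M + 2 * (T * (3 * K) ^ 3)"] conjI allI impI)
    show "0 \<le> M + 2 * (T * (3 * K) ^ 3)" using M0 T K by simp
    fix d q \<psi> r v \<epsilon> :: real
    assume b: "\<bar>d\<bar> \<le> 1" "\<bar>q\<bar> \<le> K" "\<bar>\<psi>\<bar> \<le> K" "\<bar>r\<bar> \<le> K" "\<bar>v\<bar> \<le> K" and e: "0 < \<epsilon>" "\<epsilon> \<le> 1 / (3 * K)"
    have eK: "\<epsilon> * (3 * K) \<le> 1" using e K by (simp add: field_simps)
    have "1 / (3 * K) \<le> 1" using K by simp
    then have e1: "\<epsilon> \<le> 1" using e by linarith
    \<comment> \<open>The increment becomes \<open>h = \<epsilon> * (q + \<epsilon> * s)\<close>;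
      the restriction on \<open>\<epsilon>\<close> ensures \<open>\<bar>h\<bar> \<le> 1\<close>, as
      Taylor's estimate requires.\<close>
    define s where "s = \<psi> + \<epsilon> * r"
    have "\<bar>\<epsilon> * r\<bar> \<le> 1 * K" unfolding abs_mult using e e1 b by (intro mult_mono) auto
    then have s: "\<bar>s\<bar> \<le> 2 * K" using b unfolding s_def by linarith
    have "\<bar>\<epsilon> * s\<bar> \<le> 1 * (2 * K)" unfolding abs_mult using e e1 s by (intro mult_mono) auto
    then have qs: "\<bar>q + \<epsilon> * s\<bar> \<le> 3 * K" using b by linarith
    define h where "h = \<epsilon> * (q + \<epsilon> * s)"
    have habs: "\<bar>h\<bar> \<le> \<epsilon> * (3 * K)" unfolding h_def abs_mult using e qs by simp
    have h1: "\<bar>h\<bar> \<le> 1" using habs eK by linarith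
    define R where "R = (d + h) ^ k - d ^ k - real k * d ^ (k - 1) * h - ?c * d ^ (k - 2) * h\<^sup>2"
    have "\<bar>R\<bar> \<le> T * \<bar>h\<bar> ^ 3" unfolding R_def using T(2)[OF b(1) h1] .
    also have "\<dots> \<le> T * (\<epsilon> * (3 * K)) ^ 3" using T(1) habs by (intro mult_left_mono power_mono) auto
    finally have R: "\<bar>R\<bar> \<le> T * (3 * K) ^ 3 * \<epsilon> ^ 3" by (simp add: power_mult_distrib mult_ac)
    \<comment> \<open>Everything of order at least three in the weighted quadratic Taylor
      polynomial, with \<open>\<epsilon> ^ 3\<close> factored out.\<close>
    define E where "E = real k * d ^ (k - 1) * r + ?c * d ^ (k - 2) * (2 * q * s + \<epsilon> * s\<^sup>2)
        + v * (real k * d ^ (k - 1) * s + ?c * d ^ (k - 2) * (q + \<epsilon> * s)\<^sup>2)"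
    have dp: "\<bar>d ^ j\<bar> \<le> 1" for j using b by (simp add: power_abs power_le_one)
    have kd: "\<bar>real k * d ^ (k - 1) * z\<bar> \<le> real k * Z" if "\<bar>z\<bar> \<le> Z" for z Z
      unfolding abs_mult using dp[of "k - 1"] that mult_mono[of "\<bar>d ^ (k - 1)\<bar>" 1 "\<bar>z\<bar>" Z]
      by (simp add: mult.assoc mult_left_mono)
    have cd: "\<bar>?c * d ^ (k - 2) * z\<bar> \<le> ?c * Z" if "\<bar>z\<bar> \<le> Z" for z Z
    proof -
      have "\<bar>d ^ (k - 2)\<bar> * \<bar>z\<bar> \<le> 1 * Z" using dp[of "k - 2"] that by (intro mult_mono) auto
      then have "?c * (\<bar>d ^ (k - 2)\<bar> * \<bar>z\<bar>) \<le> ?c * Z" by (intro mult_left_mono) auto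
      then show ?thesis by (simp add: abs_mult mult.assoc)
    qed
    have q2: "\<bar>2 * q * s + \<epsilon> * s\<^sup>2\<bar> \<le> 2 * K * (2 * K) + (2 * K)\<^sup>2"
    proof -
      have "\<bar>2 * q * s\<bar> \<le> 2 * K * (2 * K)" unfolding abs_mult using b s K by (intro mult_mono) auto
      moreover have "\<bar>\<epsilon> * s\<^sup>2\<bar> \<le> 1 * (2 * K)\<^sup>2" unfolding abs_mult
        using e e1 s K abs_le_square_iff[of s "2 * K"] by (intro mult_mono) auto
      ultimately show ?thesis by linarith
    qed
    have qs2: "\<bar>(q + \<epsilon> * s)\<^sup>2\<bar> \<le> (3 * K)\<^sup>2" using qs K abs_le_square_iff[of "q + \<epsilon> * s" "3 * K"] by auto
    have "\<bar>real k * d ^ (k - 1) * s + ?c * d ^ (k - 2) * (q + \<epsilon> * s)\<^sup>2\<bar> \<le> real k * (2 * K) + ?c * (3 * K)\<^sup>2"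
      by (rule order_trans[OF abs_triangle_ineq add_mono[OF kd[OF s] cd[OF qs2]]])
    then have vterm: "\<bar>v * (real k * d ^ (k - 1) * s + ?c * d ^ (k - 2) * (q + \<epsilon> * s)\<^sup>2)\<bar> \<le> K * (real k * (2 * K) + ?c * (3 * K)\<^sup>2)"
      unfolding abs_mult[of v] using b K by (intro mult_mono) auto
    have E: "\<bar>E\<bar> \<le> M" unfolding E_def M_def
      by (rule order_trans[OF abs_triangle_ineq add_mono[OF order_trans[OF abs_triangle_ineq add_mono[OF kd[OF b(4)] cd[OF q2]]] vterm]])
    have "(1 + \<epsilon> * v) * (d + h) ^ k = (1 + \<epsilon> * v) * (d ^ k + real k * d ^ (k - 1) * h + ?c * d ^ (k - 2) * h\<^sup>2) + (1 + \<epsilon> * v) * R"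
      by (simp add: R_def algebra_simps)
    also have "(1 + \<epsilon> * v) * (d ^ k + real k * d ^ (k - 1) * h + ?c * d ^ (k - 2) * h\<^sup>2) =
        (d ^ k + \<epsilon> * (v * d ^ k + real k * d ^ (k - 1) * q)
         + \<epsilon>\<^sup>2 * (real k * d ^ (k - 1) * \<psi> + ?c * d ^ (k - 2) * q\<^sup>2 + real k * v * d ^ (k - 1) * q)) + \<epsilon> ^ 3 * E"
    proof -
      have "(1 + \<epsilon> * v) * (x + y * h + z * h\<^sup>2) = (x + \<epsilon> * (v * x + y * q) + \<epsilon>\<^sup>2 * (y * \<psi> + z * q\<^sup>2 + v * (y * q)))
          + \<epsilon> ^ 3 * (y * r + z * (2 * q * s + \<epsilon> * s\<^sup>2) + v * (y * s + z * (q + \<epsilon> * s)\<^sup>2))" for x y z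
        unfolding h_def s_def by (simp add: algebra_simps power2_eq_square power3_eq_cube)
      from this[of "d ^ k" "real k * d ^ (k - 1)" "?c * d ^ (k - 2)"] show ?thesis by (simp add: E_def mult_ac)
    qed
    finally have eq: "(1 + \<epsilon> * v) * (d + h) ^ k - (d ^ k + \<epsilon> * (v * d ^ k + real k * d ^ (k - 1) * q)
         + \<epsilon>\<^sup>2 * (real k * d ^ (k - 1) * \<psi> + ?c * d ^ (k - 2) * q\<^sup>2 + real k * v * d ^ (k - 1) * q)) = \<epsilon> ^ 3 * E + (1 + \<epsilon> * v) * R"
      by simp
    have "\<bar>\<epsilon> * v\<bar> \<le> \<epsilon> * K" unfolding abs_mult using e b by simp
    also have "\<dots> \<le> \<epsilon> * (3 * K)" using e K by (intro mult_left_mono) auto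
    also note eK
    finally have "\<bar>1 + \<epsilon> * v\<bar> \<le> 2" by linarith
    then have "\<bar>(1 + \<epsilon> * v) * R\<bar> \<le> 2 * (T * (3 * K) ^ 3 * \<epsilon> ^ 3)" unfolding abs_mult using R by (intro mult_mono) auto
    moreover have "\<bar>\<epsilon> ^ 3 * E\<bar> \<le> \<epsilon> ^ 3 * M" unfolding abs_mult using E e by (simp add: mult_left_mono)
    ultimately have "\<bar>\<epsilon> ^ 3 * E + (1 + \<epsilon> * v) * R\<bar> \<le> (M + 2 * (T * (3 * K) ^ 3)) * \<epsilon> ^ 3"
      by (simp add: algebra_simps)
    moreover have "d + \<epsilon> * q + \<epsilon>\<^sup>2 * \<psi> + \<epsilon> ^ 3 * r = d + h"
      by (simp add: h_def s_def algebra_simps power2_eq_square power3_eq_cube)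
    ultimately show "\<bar>(1 + \<epsilon> * v) * (d + \<epsilon> * q + \<epsilon>\<^sup>2 * \<psi> + \<epsilon> ^ 3 * r) ^ k
      - (d ^ k + \<epsilon> * (v * d ^ k + real k * d ^ (k - 1) * q)
         + \<epsilon>\<^sup>2 * (real k * d ^ (k - 1) * \<psi> + ?c * d ^ (k - 2) * q\<^sup>2 + real k * v * d ^ (k - 1) * q))\<bar> \<le> (M + 2 * (T * (3 * K) ^ 3)) * \<epsilon> ^ 3"
      using eq by (simp only:)
  qed
qed

text \<open>Competitor: masses reweighted by \<open>1 + \<epsilon> * v\<close> on top of \<open>g + \<epsilon>\<^sup>2 * \<phi>\<close>, where \<open>\<phi> = c1 + c2 * D\<close> cancels the
  second-order change of \<open>t1\<close> and leaves the slack \<open>\<rho> * \<epsilon>\<^sup>2\<close> in \<open>tk\<close>. With the multipliers of the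
  Euler-Lagrange equation, the entropy then changes at second order by at least
  \<open>1 / 2 * (\<integral>\<integral> v v ln (1 + exp A))\<close>.\<close>

lemma logistic_maximizer_second_variation:
  fixes \<alpha> \<beta> :: real
  assumes max: "entropy_maximizer k \<tau> g" and k: "2 \<le> k" and gap: "star_density 1 g ^ k < star_density k g"
    and ba: "bm unitM a" and a: "AE x in unitM. a x = degree g x ^ (k - 1)" and \<beta>: "0 \<le> \<beta>"
  defines "A \<equiv> \<lambda>q. \<alpha> + \<beta> * (a (fst q) + a (snd q))"
  assumes gA: "\<And>x y. x \<in> {0..1} \<Longrightarrow> y \<in> {0..1} \<Longrightarrow> g x y = 1 / (1 + exp (- A (x, y)))"
    and bv: "bm unitM v"
    and v0: "(\<integral>x. v x \<partial>unitM) = 0" and v1: "(\<integral>x. v x * degree g x \<partial>unitM) = 0"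
    and vk: "(\<integral>x. v x * degree g x ^ k \<partial>unitM) + real k * (\<integral>x. degree g x ^ (k - 1) * (\<integral>y. v y * g x y \<partial>unitM) \<partial>unitM) = 0"
    and vS: "(\<integral>q. v (fst q) * S_ent (g (fst q) (snd q)) \<partial>squareM) = 0"
  shows "(\<integral>q. v (fst q) * v (snd q) * ln (1 + exp (A q)) \<partial>squareM) \<le> 0"
proof (rule ccontr)
  assume "\<not> ?thesis"
  define Q0 where "Q0 = (\<integral>q. v (fst q) * v (snd q) * ln (1 + exp (A q)) \<partial>squareM)"
  have Q0: "0 < Q0" using \<open>\<not> (\<integral>q. v (fst q) * v (snd q) * ln (1 + exp (A q)) \<partial>squareM) \<le> 0\<close> by (simp add: Q0_def)
  have g: "graphon g" using max by (simp add: entropy_maximizer_def)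
  have k1: "1 \<le> k" using k by simp
  note gb = graphonD(1)[OF g]
  note I1 = unitM.bm_integrable and I2 = squareM.P.bm_integrable
  define d where "d = degree g"
  have bd: "bm unitM d" unfolding d_def by (rule degree_bm[OF g])
  have d01: "0 \<le> d x" "d x \<le> 1" if "x \<in> {0..1}" for x using degree_range[OF g that] by (auto simp: d_def)
  define \<gamma> where "\<gamma> q = g (fst q) (snd q)" for q
  have b\<gamma>: "bm squareM \<gamma>" unfolding \<gamma>_def by (rule gb)
  define D where "D q = a (fst q) + a (snd q)" for q
  have bD: "bm squareM D" unfolding D_def by (intro bm_add bm_fst[OF ba] bm_snd[OF ba])
  have A_D: "A q = \<alpha> + \<beta> * D q" for q by (simp add: A_def D_def)
  have bA: "bm squareM A" unfolding A_D[abs_def] by (intro bm_add bm_mult bm_const bD)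
  define S where "S q = S_ent (\<gamma> q)" for q
  have bS: "bm squareM S" unfolding S_def \<gamma>_def by (rule S_ent_graphon_bm[OF g])
  define vv where "vv q = v (fst q) * v (snd q)" for q
  have bvv: "bm squareM vv" unfolding vv_def by (intro bm_mult bm_fst[OF bv] bm_snd[OF bv])
  have \<gamma>A: "\<gamma> q = 1 / (1 + exp (- A q))" if "q \<in> space squareM" for q
    using that gA[of "fst q" "snd q"] by (auto simp: \<gamma>_def)
  define q where "q x = (\<integral>y. v y * g x y \<partial>unitM)" for x
  have bq: "bm unitM q" unfolding q_def by (rule weighted_section_bm[OF g bv])
  have b\<^sub>p: "bm unitM (\<lambda>x. d x ^ j)" for j by (intro bm_power bd)
  define c where "c = real k * real (k - 1) / 2"
  \<comment> \<open>\<open>T1\<close> and \<open>Tk\<close> are the second-order coefficients of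
    \<open>t1\<close> and \<open>tk\<close> that the reweighting alone produces.\<close>
  define T1 where "T1 = (\<integral>x. v x * q x \<partial>unitM)"
  define J where "J = (\<integral>x. v x * (d x ^ (k - 1) * q x) \<partial>unitM)"
  define J2 where "J2 = (\<integral>x. d x ^ (k - 2) * (q x)\<^sup>2 \<partial>unitM)"
  define Tk where "Tk = real k * J + c * J2"
  have J2: "0 \<le> J2" unfolding J2_def using d01 by (intro integral_nonneg_AE AE_I2) auto
  have vv\<gamma>: "(\<integral>r. vv r * \<gamma> r \<partial>squareM) = T1"
    using squareM_integral_fst[OF bv bm_mult[OF bm_snd[OF bv] b\<gamma>]]
    by (simp add: vv_def T1_def q_def \<gamma>_def mult.assoc)
  have vvD: "(\<integral>r. vv r * (D r * \<gamma> r) \<partial>squareM) = 2 * J"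
  proof -
    have 1: "(\<integral>r. vv r * (a (fst r) * \<gamma> r) \<partial>squareM) = J"
    proof -
      have "(\<integral>r. vv r * (a (fst r) * \<gamma> r) \<partial>squareM) = (\<integral>r. (v (fst r) * a (fst r)) * (v (snd r) * \<gamma> r) \<partial>squareM)"
        by (simp add: vv_def mult_ac)
      also have "\<dots> = (\<integral>x. (v x * a x) * q x \<partial>unitM)"
        using squareM_integral_fst[OF bm_mult[OF bv ba] bm_mult[OF bm_snd[OF bv] b\<gamma>]] by (simp add: q_def \<gamma>_def)
      also have "\<dots> = J" unfolding J_def
      proof (rule integral_cong_AE)
        show "AE x in unitM. v x * a x * q x = v x * (d x ^ (k - 1) * q x)" using a by eventually_elim (simp add: d_def)
      qed (intro bm_measurable bm_mult bv ba bq b\<^sub>p)+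
      finally show ?thesis .
    qed
    have b1: "bm squareM (\<lambda>r. vv r * (a (fst r) * \<gamma> r))" and b2: "bm squareM (\<lambda>r. vv r * (a (snd r) * \<gamma> r))"
      by (intro bm_mult bvv b\<gamma> bm_fst[OF ba] bm_snd[OF ba])+
    have "(\<integral>r. vv r * (a (snd r) * \<gamma> r) \<partial>squareM) = (\<integral>r. vv r * (a (fst r) * \<gamma> r) \<partial>squareM)"
    proof -
      have "(\<integral>r. vv r * (a (snd r) * \<gamma> r) \<partial>squareM) = (\<integral>r. vv (snd r, fst r) * (a (fst r) * \<gamma> (snd r, fst r)) \<partial>squareM)"
        using squareM_swap[OF b2] by simp
      also have "\<dots> = (\<integral>r. vv r * (a (fst r) * \<gamma> r) \<partial>squareM)"
        using graphonD(2)[OF g] by (intro Bochner_Integration.integral_cong) (auto simp: vv_def \<gamma>_def mult_ac)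
      finally show ?thesis .
    qed
    moreover have "(\<integral>r. vv r * (D r * \<gamma> r) \<partial>squareM) = (\<integral>r. vv r * (a (fst r) * \<gamma> r) + vv r * (a (snd r) * \<gamma> r) \<partial>squareM)"
      by (simp add: D_def algebra_simps)
    ultimately show ?thesis using 1 I2[OF b1] I2[OF b2] by simp
  qed
  \<comment> \<open>The conjugate identity integrated against \<open>v v\<close>: the kernel form
    splits into an entropy part and the two multiplier parts.\<close>
  have Q0_eq: "Q0 = (\<integral>r. vv r * S r \<partial>squareM) + \<alpha> * T1 + 2 * \<beta> * J"
  proof -
    have "Q0 = (\<integral>r. vv r * S r + \<alpha> * (vv r * \<gamma> r) + \<beta> * (vv r * (D r * \<gamma> r)) \<partial>squareM)"
      unfolding Q0_def
    proof (intro Bochner_Integration.integral_cong refl)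
      fix r assume "r \<in> space squareM"
      note L = S_ent_logistic[OF \<gamma>A[OF this]]
      show "v (fst r) * v (snd r) * ln (1 + exp (A r)) = vv r * S r + \<alpha> * (vv r * \<gamma> r) + \<beta> * (vv r * (D r * \<gamma> r))"
        unfolding L[symmetric] by (simp add: vv_def S_def A_D algebra_simps)
    qed
    also have "\<dots> = (\<integral>r. vv r * S r \<partial>squareM) + \<alpha> * (\<integral>r. vv r * \<gamma> r \<partial>squareM) + \<beta> * (\<integral>r. vv r * (D r * \<gamma> r) \<partial>squareM)"
      using I2[OF bm_mult[OF bvv bS]] I2[OF bm_mult[OF bvv b\<gamma>]] I2[OF bm_mult[OF bvv bm_mult[OF bD b\<gamma>]]] by simp
    finally show ?thesis using vv\<gamma> vvD by simp
  qed
  define m where "m = (\<integral>r. D r \<partial>squareM)"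
  define V where "V = (\<integral>r. (D r - m) * (D r - m) \<partial>squareM)"
  have bDm: "bm squareM (\<lambda>r. D r - m)" by (intro bm_diff bD bm_const)
  \<comment> \<open>Otherwise \<open>a x + a y\<close> would be almost everywhere constant, so would
    the degree, and the gap would close. A positive variance of \<open>D\<close> lets
    \<open>\<phi>\<close> act on \<open>t1\<close> and \<open>tk\<close> independently.\<close>
  have V: "0 < V"
  proof (rule ccontr)
    assume "\<not> 0 < V"
    moreover have "0 \<le> V" unfolding V_def by (intro integral_nonneg_AE AE_I2) auto
    ultimately have "V = 0" by simp
    then have "AE r in squareM. (D r - m) * (D r - m) = 0"
      unfolding V_def by (subst (asm) integral_nonneg_eq_0_iff_AE[OF I2[OF bm_mult[OF bDm bDm]]]) auto
    then have "AE r in squareM. D r = m" by eventually_elim simp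
    then have "AE x in unitM. AE y in unitM. a x + a y = m" using squareM.AE_pair by (fastforce simp: D_def)
    then have "\<exists>x. AE y in unitM. a x + a y = m"
    proof (rule contrapos_pp)
      assume none: "\<not> (\<exists>x. AE y in unitM. a x + a y = m)"
      show "\<not> (AE x in unitM. AE y in unitM. a x + a y = m)"
        using none unitM.AE_False by simp
    qed
    then obtain x0 where "AE y in unitM. a x0 + a y = m" by blast
    with a AE_space[of unitM] have "AE y in unitM. degree g y = root (k - 1) (m - a x0)"
    proof eventually_elim
      case (elim y)
      have "0 \<le> degree g y" using degree_range[OF g, of y] elim by simp
      moreover have "degree g y ^ (k - 1) = m - a x0" using elim by linarith
      ultimately show ?case using k real_root_power_cancel[of "k - 1" "degree g y"] by simp
    qed
    from degree_const_no_gap[OF g this] show False using gap by simp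
  qed
  obtain C where C: "0 \<le> C"
    "\<And>h. graphon h \<Longrightarrow> C * \<bar>star_density 1 h - star_density 1 g\<bar> \<le> star_density k h - star_density k g \<Longrightarrow>
       entropy h \<le> entropy g + C * (star_density k h - star_density k g)"
    using maximizer_penalty[OF max k1 gap] by blast
  \<comment> \<open>The slack \<open>\<rho>0\<close> costs
    \<open>2 * \<beta> / real k * \<rho>0\<close> in twice the entropy and
    \<open>2 * C * \<rho>0\<close> in the penalty; dividing by \<open>2 * z\<close> keeps the total
    within \<open>Q0 / 2\<close>.\<close>
  define z where "z = 2 * \<beta> / real k + 2 * C + 1"
  define \<rho>0 where "\<rho>0 = Q0 / (2 * z)"
  have z: "0 < z" unfolding z_def using \<beta> C(1) by (intro add_nonneg_pos add_nonneg_nonneg) auto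
  have \<rho>0: "0 < \<rho>0" using Q0 z by (simp add: \<rho>0_def)
  have \<rho>0Q: "(2 * \<beta> / real k + 2 * C) * \<rho>0 \<le> Q0 / 2"
  proof -
    have "(2 * \<beta> / real k + 2 * C) * \<rho>0 \<le> z * \<rho>0" using \<rho>0 by (intro mult_right_mono) (auto simp: z_def)
    also have "\<dots> = Q0 / 2" using z by (simp add: \<rho>0_def)
    finally show ?thesis .
  qed
  \<comment> \<open>The solution of \<open>real k * (P2 / 2) + Tk = \<rho>0\<close>. Next,
    \<open>c2\<close> is solved from the requirement that \<open>\<phi>\<close> has integral
    \<open>P2\<close> against \<open>D\<close>.\<close>
  define P2 where "P2 = 2 * (\<rho>0 - Tk) / real k"
  define c2 where "c2 = (P2 + m * T1) / V"
  define \<phi> where "\<phi> r = - T1 + c2 * (D r - m)" for r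
  have b\<phi>: "bm squareM \<phi>" unfolding \<phi>_def by (intro bm_add bm_mult bm_const bDm)
  have iDm: "(\<integral>r. D r - m \<partial>squareM) = 0" using I2[OF bD] by (simp add: m_def)
  have i\<phi>: "(\<integral>r. \<phi> r \<partial>squareM) = - T1" unfolding \<phi>_def using I2[OF bDm] iDm by simp
  have i\<phi>D: "(\<integral>r. \<phi> r * D r \<partial>squareM) = P2"
  proof -
    have "(\<integral>r. \<phi> r * D r \<partial>squareM) = (\<integral>r. - T1 * D r + c2 * ((D r - m) * (D r - m)) + (c2 * m) * (D r - m) \<partial>squareM)"
      by (simp add: \<phi>_def algebra_simps)
    also have "\<dots> = - T1 * m + c2 * V"
      using I2[OF bD] I2[OF bm_mult[OF bDm bDm]] I2[OF bDm] iDm by (simp add: m_def[symmetric] V_def[symmetric])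
    also have "\<dots> = P2" using V by (simp add: c2_def)
    finally show ?thesis .
  qed
  have \<phi>sym: "\<phi> (x, y) = \<phi> (y, x)" for x y by (simp add: \<phi>_def D_def add.commute)
  have i\<phi>a: "(\<integral>r. a (fst r) * \<phi> r \<partial>squareM) = P2 / 2"
  proof -
    have "(\<integral>r. a (snd r) * \<phi> r \<partial>squareM) = (\<integral>r. a (fst r) * \<phi> (snd r, fst r) \<partial>squareM)"
      using squareM_swap[OF bm_mult[OF bm_snd[OF ba] b\<phi>]] by simp
    also have "\<dots> = (\<integral>r. a (fst r) * \<phi> r \<partial>squareM)" using \<phi>sym by (intro Bochner_Integration.integral_cong) auto
    finally have "(\<integral>r. a (snd r) * \<phi> r \<partial>squareM) = (\<integral>r. a (fst r) * \<phi> r \<partial>squareM)" .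
    moreover have "P2 = (\<integral>r. a (fst r) * \<phi> r + a (snd r) * \<phi> r \<partial>squareM)"
      unfolding i\<phi>D[symmetric] by (simp add: D_def algebra_simps)
    ultimately show ?thesis
      using I2[OF bm_mult[OF bm_fst[OF ba] b\<phi>]] I2[OF bm_mult[OF bm_snd[OF ba] b\<phi>]] by simp
  qed
  define \<psi> where "\<psi> x = (\<integral>y. \<phi> (x, y) \<partial>unitM)" for x
  define \<sigma> where "\<sigma> x = (\<integral>y. v y * \<phi> (x, y) \<partial>unitM)" for x
  have b\<psi>: "bm unitM \<psi>" unfolding \<psi>_def by (rule bm_integral_snd[OF b\<phi>])
  have b\<sigma>: "bm unitM \<sigma>" unfolding \<sigma>_def using bm_integral_snd[OF bm_mult[OF bm_snd[OF bv] b\<phi>]] by simp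
  have i\<psi>: "(\<integral>x. \<psi> x \<partial>unitM) = - T1"
    using squareM_iterate[OF b\<phi>] i\<phi> by (simp add: \<psi>_def)
  have i\<psi>d: "(\<integral>x. d x ^ (k - 1) * \<psi> x \<partial>unitM) = P2 / 2"
  proof -
    have "(\<integral>x. d x ^ (k - 1) * \<psi> x \<partial>unitM) = (\<integral>x. a x * \<psi> x \<partial>unitM)"
    proof (rule integral_cong_AE)
      show "AE x in unitM. d x ^ (k - 1) * \<psi> x = a x * \<psi> x" using a by eventually_elim (simp add: d_def)
    qed (intro bm_measurable bm_mult ba b\<psi> b\<^sub>p)+
    then show ?thesis using squareM_integral_fst[OF ba b\<phi>] i\<phi>a by (simp add: \<psi>_def)
  qed
  obtain K1 where K1: "\<And>x. x \<in> space unitM \<Longrightarrow> \<bar>v x\<bar> \<le> K1" using bm_bound[OF bv] by blast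
  obtain K2 where K2: "\<And>x. x \<in> space unitM \<Longrightarrow> \<bar>q x\<bar> \<le> K2" using bm_bound[OF bq] by blast
  obtain K3 where K3: "\<And>x. x \<in> space unitM \<Longrightarrow> \<bar>\<psi> x\<bar> \<le> K3" using bm_bound[OF b\<psi>] by blast
  obtain K4 where K4: "\<And>x. x \<in> space unitM \<Longrightarrow> \<bar>\<sigma> x\<bar> \<le> K4" using bm_bound[OF b\<sigma>] by blast
  obtain K5 where K5: "\<And>r. r \<in> space squareM \<Longrightarrow> \<bar>\<phi> r\<bar> \<le> K5" using bm_bound[OF b\<phi>] by blast
  obtain K6 where K6: "\<And>r. r \<in> space squareM \<Longrightarrow> \<bar>A r\<bar> \<le> K6" using bm_bound[OF bA] by blast
  define K where "K = 1 + \<bar>K1\<bar> + \<bar>K2\<bar> + \<bar>K3\<bar> + \<bar>K4\<bar> + \<bar>K5\<bar> + \<bar>K6\<bar>"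
  have K: "1 \<le> K" by (simp add: K_def)
  have vK: "\<bar>v x\<bar> \<le> K" if "x \<in> {0..1}" for x
    using K1[of x] that unfolding space_unitM K_def by linarith
  have qK: "\<bar>q x\<bar> \<le> K" if "x \<in> {0..1}" for x
    using K2[of x] that unfolding space_unitM K_def by linarith
  have \<psi>K: "\<bar>\<psi> x\<bar> \<le> K" if "x \<in> {0..1}" for x
    using K3[of x] that unfolding space_unitM K_def by linarith
  have \<sigma>K: "\<bar>\<sigma> x\<bar> \<le> K" if "x \<in> {0..1}" for x
    using K4[of x] that unfolding space_unitM K_def by linarith
  have \<phi>K: "\<bar>\<phi> r\<bar> \<le> K" if "r \<in> space squareM" for r
    using K5[OF that] unfolding K_def by linarith
  have AK: "\<bar>A r\<bar> \<le> K" if "r \<in> space squareM" for r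
    using K6[OF that] unfolding K_def by linarith
  \<comment> \<open>A bounded exponent keeps \<open>g\<close> uniformly away from 0 and 1, so the
    entropy may be expanded everywhere.\<close>
  define \<eta> where "\<eta> = 1 / (1 + exp K)"
  have \<eta>: "0 < \<eta>" "\<eta> \<le> 1" by (auto simp: \<eta>_def add_pos_pos)
  have \<gamma>\<eta>: "\<eta> \<le> \<gamma> r" "\<eta> \<le> 1 - \<gamma> r" if r: "r \<in> space squareM" for r
  proof -
    have "- A r \<le> K" "A r \<le> K" using AK[OF r] by (auto simp: abs_le_iff)
    then have le: "1 + exp (- A r) \<le> 1 + exp K" "1 + exp (A r) \<le> 1 + exp K" by auto
    have pos: "0 < 1 + exp z" for z :: real by (simp add: add_pos_pos)
    show "\<eta> \<le> \<gamma> r" unfolding \<eta>_def \<gamma>A[OF r] using le pos by (intro divide_left_mono mult_pos_pos) auto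
    have "1 - \<gamma> r = 1 / (1 + exp (A r))"
      unfolding \<gamma>A[OF r] using pos[of "A r"] pos[of "- A r"] by (simp add: field_simps exp_minus)
    then show "\<eta> \<le> 1 - \<gamma> r" unfolding \<eta>_def using le pos by (simp add: divide_left_mono)
  qed
  obtain C5 where C5: "0 \<le> C5" "\<And>d q \<psi> r v \<epsilon> :: real. \<bar>d\<bar> \<le> 1 \<Longrightarrow> \<bar>q\<bar> \<le> K \<Longrightarrow> \<bar>\<psi>\<bar> \<le> K \<Longrightarrow> \<bar>r\<bar> \<le> K \<Longrightarrow> \<bar>v\<bar> \<le> K \<Longrightarrow> 0 < \<epsilon> \<Longrightarrow> \<epsilon> \<le> 1 / (3 * K) \<Longrightarrow>
    \<bar>(1 + \<epsilon> * v) * (d + \<epsilon> * q + \<epsilon>\<^sup>2 * \<psi> + \<epsilon> ^ 3 * r) ^ k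
      - (d ^ k + \<epsilon> * (v * d ^ k + real k * d ^ (k - 1) * q)
         + \<epsilon>\<^sup>2 * (real k * d ^ (k - 1) * \<psi> + c * d ^ (k - 2) * q\<^sup>2 + real k * v * d ^ (k - 1) * q))\<bar> \<le> C5 * \<epsilon> ^ 3"
    using second_order_expansion[OF K, of k] unfolding c_def by blast
  define C1 where "C1 = \<bar>\<integral>x. v x * \<psi> x + \<sigma> x \<partial>unitM\<bar> + \<bar>\<integral>x. v x * \<sigma> x \<partial>unitM\<bar>"
  define C6 where "C6 = 3 * K ^ 4 + 8 * K\<^sup>2 / \<eta>\<^sup>2"
  define \<epsilon>0 where "\<epsilon>0 = min (1 / (3 * K)) (\<eta> / (2 * K))"
  have \<epsilon>0: "0 < \<epsilon>0" using K \<eta> by (simp add: \<epsilon>0_def)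
  \<comment> \<open>All error constants are fixed before \<open>\<epsilon>\<close>, so third-order
    errors lose against the second-order terms.\<close>
  have ex: "\<exists>h. graphon h \<and> \<bar>star_density 1 h - star_density 1 g\<bar> \<le> C1 * \<epsilon> ^ 3
      \<and> \<bar>star_density k h - star_density k g - \<epsilon>\<^sup>2 * \<rho>0\<bar> \<le> C5 * \<epsilon> ^ 3
      \<and> 2 * entropy g + \<epsilon>\<^sup>2 * (Q0 - 2 * \<beta> / real k * \<rho>0) - C6 * \<epsilon> ^ 3 \<le> 2 * entropy h"
    if \<epsilon>: "0 < \<epsilon>" "\<epsilon> \<le> \<epsilon>0" for \<epsilon>
  proof -
    have \<epsilon>K: "\<epsilon> * K \<le> 1 / 3" "\<epsilon> * K \<le> \<eta> / 2"
    proof -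
      have "\<epsilon> * K \<le> 1 / (3 * K) * K" "\<epsilon> * K \<le> \<eta> / (2 * K) * K"
        using \<epsilon>(2) K by (intro mult_right_mono; simp add: \<epsilon>0_def)+
      then show "\<epsilon> * K \<le> 1 / 3" "\<epsilon> * K \<le> \<eta> / 2" using K by simp_all
    qed
    have "\<epsilon> * 1 \<le> \<epsilon> * K" using K \<epsilon> by (intro mult_left_mono) auto
    then have \<epsilon>1: "\<epsilon> \<le> 1" using \<epsilon>K by linarith
    have \<epsilon>sq: "\<epsilon>\<^sup>2 \<le> \<epsilon>" using mult_left_mono[OF \<epsilon>1, of \<epsilon>] \<epsilon> by (simp add: power2_eq_square)
    define \<rho> where "\<rho> x = 1 + \<epsilon> * v x" for x
    have b\<rho>: "bm unitM \<rho>" unfolding \<rho>_def by (intro bm_add bm_mult bm_const bv)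
    have i\<rho>: "(\<integral>x. \<rho> x \<partial>unitM) = 1" unfolding \<rho>_def using I1[OF bv] v0 by simp
    have \<rho>r: "0 \<le> \<rho> x" "\<rho> x \<le> 2" if "x \<in> {0..1}" for x
    proof -
      have "\<bar>\<epsilon> * v x\<bar> \<le> \<epsilon> * K" unfolding abs_mult using vK[OF that] \<epsilon> by (intro mult_mono) auto
      then have "\<bar>\<epsilon> * v x\<bar> \<le> 1" using \<epsilon>K by linarith
      then show "0 \<le> \<rho> x" "\<rho> x \<le> 2" by (auto simp: \<rho>_def abs_le_iff)
    qed
    have small: "\<bar>\<epsilon>\<^sup>2 * \<phi> r\<bar> \<le> \<eta> / 2" if "r \<in> space squareM" for r
    proof -
      have "\<bar>\<epsilon>\<^sup>2 * \<phi> r\<bar> \<le> \<epsilon> * K" unfolding abs_mult using \<phi>K[OF that] \<epsilon> \<epsilon>sq by (intro mult_mono) auto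
      then show ?thesis using \<epsilon>K by linarith
    qed
    define G where "G = (\<lambda>x y. g x y + \<epsilon>\<^sup>2 * \<phi> (x, y))"
    have G: "graphon G"
      unfolding G_def
    proof (rule graphon_perturb[OF g, of "\<lambda>r. \<epsilon>\<^sup>2 * \<phi> r"])
      show "bm squareM (\<lambda>r. \<epsilon>\<^sup>2 * \<phi> r)" by (intro bm_mult bm_const b\<phi>)
      fix x y :: real assume xy: "x \<in> {0..1}" "y \<in> {0..1}"
      show "\<epsilon>\<^sup>2 * \<phi> (x, y) = \<epsilon>\<^sup>2 * \<phi> (y, x)" using \<phi>sym by simp
      have r: "(x, y) \<in> space squareM" using xy by simp
      show "0 \<le> g x y + \<epsilon>\<^sup>2 * \<phi> (x, y) \<and> g x y + \<epsilon>\<^sup>2 * \<phi> (x, y) \<le> 1"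
        using small[OF r] \<gamma>\<eta>[OF r] \<eta> by (auto simp: \<gamma>_def abs_le_iff)
    qed
    define H where "H x = d x + \<epsilon> * q x + \<epsilon>\<^sup>2 * \<psi> x + \<epsilon> ^ 3 * \<sigma> x" for x
    have sec: "(\<integral>y. \<rho> y * G x y \<partial>unitM) = H x" if x: "x \<in> {0..1}" for x
    proof -
      have "(\<integral>y. \<rho> y * G x y \<partial>unitM) = (\<integral>y. g x y + \<epsilon> * (v y * g x y) + \<epsilon>\<^sup>2 * \<phi> (x, y) + \<epsilon> ^ 3 * (v y * \<phi> (x, y)) \<partial>unitM)"
        by (intro Bochner_Integration.integral_cong refl) (simp add: \<rho>_def G_def algebra_simps power2_eq_square power3_eq_cube)
      also have "\<dots> = H x"
        using I1[OF graphon_section[OF g x]] I1[OF bm_mult[OF bv graphon_section[OF g x]]] I1[OF bm_section[OF b\<phi> x]] I1[OF bm_mult[OF bv bm_section[OF b\<phi> x]]]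
        by (simp add: H_def d_def degree_unitM q_def \<psi>_def \<sigma>_def)
      finally show ?thesis .
    qed
    obtain h where h: "graphon h"
      "\<And>j. star_density j h = (\<integral>x. \<rho> x * (\<integral>y. \<rho> y * G x y \<partial>unitM) ^ j \<partial>unitM)"
      "entropy h = 1 / 2 * (\<integral>r. \<rho> (fst r) * \<rho> (snd r) * S_ent (G (fst r) (snd r)) \<partial>squareM)"
      using weighted_graphon[OF G b\<rho> \<rho>r(1) i\<rho>] by blast
    have sd: "star_density j h = (\<integral>x. \<rho> x * H x ^ j \<partial>unitM)" for j
      unfolding h(2) using sec by (intro Bochner_Integration.integral_cong) auto
    have bH: "bm unitM H" unfolding H_def by (intro bm_add bm_mult bm_const bd bq b\<psi> b\<sigma>)
    have H1: "\<bar>star_density 1 h - star_density 1 g\<bar> \<le> C1 * \<epsilon> ^ 3"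
    proof -
      let ?X1 = "\<integral>x. v x * \<psi> x + \<sigma> x \<partial>unitM" and ?X2 = "\<integral>x. v x * \<sigma> x \<partial>unitM"
      have iq: "(\<integral>x. q x \<partial>unitM) = 0" using integral_weighted_section[OF g bv] v1 by (simp add: q_def)
      have "star_density 1 h = (\<integral>x. d x + \<epsilon> * (v x * d x + q x) + \<epsilon>\<^sup>2 * (v x * q x + \<psi> x) + \<epsilon> ^ 3 * (v x * \<psi> x + \<sigma> x) + \<epsilon> ^ 4 * (v x * \<sigma> x) \<partial>unitM)"
        unfolding sd by (intro Bochner_Integration.integral_cong refl)
          (simp add: \<rho>_def H_def algebra_simps power2_eq_square power3_eq_cube power4_eq_xxxx)
      also have "\<dots> = (\<integral>x. d x \<partial>unitM) + \<epsilon> * ((\<integral>x. v x * d x \<partial>unitM) + (\<integral>x. q x \<partial>unitM)) + \<epsilon>\<^sup>2 * (T1 + (\<integral>x. \<psi> x \<partial>unitM)) + \<epsilon> ^ 3 * ?X1 + \<epsilon> ^ 4 * ?X2"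
        using I1[OF bd] I1[OF bm_mult[OF bv bd]] I1[OF bq] I1[OF bm_mult[OF bv bq]] I1[OF b\<psi>] I1[OF b\<sigma>]
          I1[OF bm_mult[OF bv b\<psi>]] I1[OF bm_mult[OF bv b\<sigma>]] by (simp add: T1_def)
      also have "\<dots> = star_density 1 g + \<epsilon> ^ 3 * ?X1 + \<epsilon> ^ 4 * ?X2"
        using v1 iq i\<psi> by (simp add: star_density_unitM d_def)
      finally have "star_density 1 h - star_density 1 g = \<epsilon> ^ 3 * (?X1 + \<epsilon> * ?X2)" by (simp add: algebra_simps power3_eq_cube power4_eq_xxxx)
      moreover have "\<bar>?X1 + \<epsilon> * ?X2\<bar> \<le> C1"
      proof -
        have "\<bar>\<epsilon> * ?X2\<bar> \<le> 1 * \<bar>?X2\<bar>" unfolding abs_mult using \<epsilon> \<epsilon>1 by (intro mult_right_mono) auto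
        then show ?thesis unfolding C1_def by linarith
      qed
      ultimately show ?thesis using \<epsilon> by (simp add: abs_mult mult.commute mult_right_mono)
    qed
    have Hk: "\<bar>star_density k h - star_density k g - \<epsilon>\<^sup>2 * \<rho>0\<bar> \<le> C5 * \<epsilon> ^ 3"
    proof -
      define X where "X x = d x ^ k + \<epsilon> * (v x * d x ^ k + real k * d x ^ (k - 1) * q x)
         + \<epsilon>\<^sup>2 * (real k * d x ^ (k - 1) * \<psi> x + c * d x ^ (k - 2) * (q x)\<^sup>2 + real k * v x * d x ^ (k - 1) * q x)" for x
      have i: "integrable unitM (\<lambda>x. d x ^ k)" "integrable unitM (\<lambda>x. v x * d x ^ k)" "integrable unitM (\<lambda>x. d x ^ (k - 1) * q x)"
        "integrable unitM (\<lambda>x. d x ^ (k - 1) * \<psi> x)" "integrable unitM (\<lambda>x. d x ^ (k - 2) * (q x)\<^sup>2)"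
        "integrable unitM (\<lambda>x. v x * (d x ^ (k - 1) * q x))"
        by (intro I1 bm_mult b\<^sub>p bv bq b\<psi> bm_power)+
      have "(\<integral>x. X x \<partial>unitM) = (\<integral>x. d x ^ k + \<epsilon> * (v x * d x ^ k) + \<epsilon> * real k * (d x ^ (k - 1) * q x) + \<epsilon>\<^sup>2 * real k * (d x ^ (k - 1) * \<psi> x)
          + \<epsilon>\<^sup>2 * c * (d x ^ (k - 2) * (q x)\<^sup>2) + \<epsilon>\<^sup>2 * real k * (v x * (d x ^ (k - 1) * q x)) \<partial>unitM)"
        by (intro Bochner_Integration.integral_cong refl) (simp add: X_def algebra_simps)
      also have "\<dots> = (\<integral>x. d x ^ k \<partial>unitM) + \<epsilon> * ((\<integral>x. v x * d x ^ k \<partial>unitM) + real k * (\<integral>x. d x ^ (k - 1) * q x \<partial>unitM))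
          + \<epsilon>\<^sup>2 * (real k * (\<integral>x. d x ^ (k - 1) * \<psi> x \<partial>unitM) + c * J2 + real k * J)"
      proof -
        have "(\<integral>x. d x ^ k + \<epsilon> * (v x * d x ^ k) + \<epsilon> * real k * (d x ^ (k - 1) * q x) + \<epsilon>\<^sup>2 * real k * (d x ^ (k - 1) * \<psi> x)
          + \<epsilon>\<^sup>2 * c * (d x ^ (k - 2) * (q x)\<^sup>2) + \<epsilon>\<^sup>2 * real k * (v x * (d x ^ (k - 1) * q x)) \<partial>unitM)
          = (\<integral>x. d x ^ k \<partial>unitM) + \<epsilon> * (\<integral>x. v x * d x ^ k \<partial>unitM) + \<epsilon> * real k * (\<integral>x. d x ^ (k - 1) * q x \<partial>unitM)
          + \<epsilon>\<^sup>2 * real k * (\<integral>x. d x ^ (k - 1) * \<psi> x \<partial>unitM) + \<epsilon>\<^sup>2 * c * J2 + \<epsilon>\<^sup>2 * real k * J"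
        proof -
          have "(\<integral>x. f1 x + c2 * f2 x + c3 * f3 x + c4 * f4 x + c5 * f5 x + c6 * f6 x \<partial>unitM)
            = (\<integral>x. f1 x \<partial>unitM) + c2 * (\<integral>x. f2 x \<partial>unitM) + c3 * (\<integral>x. f3 x \<partial>unitM) + c4 * (\<integral>x. f4 x \<partial>unitM) + c5 * (\<integral>x. f5 x \<partial>unitM) + c6 * (\<integral>x. f6 x \<partial>unitM)"
            if "integrable unitM f1" "integrable unitM f2" "integrable unitM f3" "integrable unitM f4" "integrable unitM f5" "integrable unitM f6"
            for f1 f2 f3 f4 f5 f6 :: "real \<Rightarrow> real" and c2 c3 c4 c5 c6 :: real
            using that by simp
          from this[OF i, of \<epsilon> "\<epsilon> * real k" "\<epsilon>\<^sup>2 * real k" "\<epsilon>\<^sup>2 * c" "\<epsilon>\<^sup>2 * real k"]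
          show ?thesis unfolding J_def J2_def .
        qed
        then show ?thesis by (simp add: algebra_simps)
      qed
      also have "\<dots> = star_density k g + \<epsilon>\<^sup>2 * (real k * (P2 / 2) + Tk)"
        using vk i\<psi>d by (simp add: star_density_unitM[of k] d_def q_def Tk_def algebra_simps)
      also have "real k * (P2 / 2) + Tk = \<rho>0" using k by (simp add: P2_def field_simps)
      finally have iX: "(\<integral>x. X x \<partial>unitM) = star_density k g + \<epsilon>\<^sup>2 * \<rho>0" .
      have bX: "bm unitM X" unfolding X_def by (intro bm_add bm_mult bm_const b\<^sub>p bv bq b\<psi> bm_power)
      have b\<rho>H: "bm unitM (\<lambda>x. \<rho> x * H x ^ k)" by (intro bm_mult b\<rho> bm_power bH)
      have eq: "star_density k h - star_density k g - \<epsilon>\<^sup>2 * \<rho>0 = (\<integral>x. \<rho> x * H x ^ k - X x \<partial>unitM)"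
        using I1[OF b\<rho>H] I1[OF bX] iX sd[of k] by simp
      have "\<bar>\<integral>x. \<rho> x * H x ^ k - X x \<partial>unitM\<bar> \<le> (\<integral>x. \<bar>\<rho> x * H x ^ k - X x\<bar> \<partial>unitM)" by (rule integral_abs_bound)
      also have "\<dots> \<le> (\<integral>x. C5 * \<epsilon> ^ 3 \<partial>unitM)"
      proof (rule integral_mono)
        show "integrable unitM (\<lambda>x. \<bar>\<rho> x * H x ^ k - X x\<bar>)" using I1[OF bm_diff[OF b\<rho>H bX]] by (rule integrable_abs)
        fix x assume "x \<in> space unitM"
        then have x: "x \<in> {0..1}" by simp
        have "\<epsilon> \<le> 1 / (3 * K)" using \<epsilon>(2) by (simp add: \<epsilon>0_def)
        then show "\<bar>\<rho> x * H x ^ k - X x\<bar> \<le> C5 * \<epsilon> ^ 3"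
          unfolding \<rho>_def H_def X_def
          using d01[OF x] by (intro C5(2) qK[OF x] \<psi>K[OF x] \<sigma>K[OF x] vK[OF x] \<epsilon>(1)) auto
      qed simp
      also have "\<dots> = C5 * \<epsilon> ^ 3" by simp
      finally show ?thesis unfolding eq .
    qed
    have HS: "2 * entropy g + \<epsilon>\<^sup>2 * (Q0 - 2 * \<beta> / real k * \<rho>0) - C6 * \<epsilon> ^ 3 \<le> 2 * entropy h"
    proof -
      let ?v = "\<lambda>r. v (fst r) + v (snd r)"
      have bv2: "bm squareM ?v" by (intro bm_add bm_fst[OF bv] bm_snd[OF bv])
      \<comment> \<open>A pointwise minorant of the competitor's entropy integrand, up to a uniform
        third-order error, whose integral is explicit.\<close>
      define X where "X r = S r + \<epsilon> * (S r * ?v r) + \<epsilon>\<^sup>2 * (vv r * S r) - \<epsilon>\<^sup>2 * (A r * \<phi> r) - C6 * \<epsilon> ^ 3" for r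
      have iS: "(\<integral>r. S r * ?v r \<partial>squareM) = 0"
      proof -
        have b1: "bm squareM (\<lambda>r. v (fst r) * S r)" and b2: "bm squareM (\<lambda>r. v (snd r) * S r)"
          by (intro bm_mult bm_fst[OF bv] bm_snd[OF bv] bS)+
        have "(\<integral>r. v (snd r) * S r \<partial>squareM) = (\<integral>r. v (fst r) * S (snd r, fst r) \<partial>squareM)"
          using squareM_swap[OF b2] by simp
        also have "\<dots> = (\<integral>r. v (fst r) * S r \<partial>squareM)"
          using graphonD(2)[OF g] by (intro Bochner_Integration.integral_cong) (auto simp: S_def \<gamma>_def)
        finally have "(\<integral>r. v (snd r) * S r \<partial>squareM) = 0" using vS by (simp add: S_def \<gamma>_def)
        moreover have "(\<integral>r. v (fst r) * S r \<partial>squareM) = 0" using vS by (simp add: S_def \<gamma>_def)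
        moreover have "(\<integral>r. S r * ?v r \<partial>squareM) = (\<integral>r. v (fst r) * S r + v (snd r) * S r \<partial>squareM)"
          by (simp add: algebra_simps)
        ultimately show ?thesis using I2[OF b1] I2[OF b2] by simp
      qed
      have iA: "(\<integral>r. A r * \<phi> r \<partial>squareM) = - \<alpha> * T1 + \<beta> * P2"
      proof -
        have "(\<integral>r. A r * \<phi> r \<partial>squareM) = (\<integral>r. \<alpha> * \<phi> r + \<beta> * (\<phi> r * D r) \<partial>squareM)"
          by (simp add: A_D algebra_simps)
        then show ?thesis using I2[OF b\<phi>] I2[OF bm_mult[OF b\<phi> bD]] i\<phi> i\<phi>D by simp
      qed
      have iX: "(\<integral>r. X r \<partial>squareM) = 2 * entropy g + \<epsilon>\<^sup>2 * ((\<integral>r. vv r * S r \<partial>squareM) + \<alpha> * T1 - \<beta> * P2) - C6 * \<epsilon> ^ 3"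
      proof -
        have "(\<integral>r. X r \<partial>squareM) = (\<integral>r. S r \<partial>squareM) + \<epsilon> * (\<integral>r. S r * ?v r \<partial>squareM) + \<epsilon>\<^sup>2 * (\<integral>r. vv r * S r \<partial>squareM)
            - \<epsilon>\<^sup>2 * (\<integral>r. A r * \<phi> r \<partial>squareM) - C6 * \<epsilon> ^ 3"
          unfolding X_def using I2[OF bS] I2[OF bm_mult[OF bS bv2]] I2[OF bm_mult[OF bvv bS]] I2[OF bm_mult[OF bA b\<phi>]] by simp
        also have "(\<integral>r. S r \<partial>squareM) = 2 * entropy g" by (simp add: entropy_squareM S_def \<gamma>_def)
        finally show ?thesis unfolding iS iA by (simp add: algebra_simps)
      qed
      have "Q0 - 2 * \<beta> / real k * \<rho>0 \<le> (\<integral>r. vv r * S r \<partial>squareM) + \<alpha> * T1 - \<beta> * P2"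
      proof -
        \<comment> \<open>This matches the multiplier part of \<open>Q0\<close>. The leftover term
          in \<open>J2\<close> has the favourable sign because \<open>\<beta> \<ge> 0\<close>:
          convexity of \<open>tk\<close> only helps.\<close>
        have "\<beta> * P2 = 2 * \<beta> / real k * \<rho>0 - 2 * \<beta> * J - 2 * \<beta> * (c * J2) / real k"
          using k by (simp add: P2_def Tk_def field_simps)
        moreover have "0 \<le> 2 * \<beta> * (c * J2) / real k" using \<beta> J2 by (simp add: c_def)
        ultimately show ?thesis using Q0_eq by linarith
      qed
      then have "\<epsilon>\<^sup>2 * (Q0 - 2 * \<beta> / real k * \<rho>0) \<le> \<epsilon>\<^sup>2 * ((\<integral>r. vv r * S r \<partial>squareM) + \<alpha> * T1 - \<beta> * P2)"
        by (intro mult_left_mono) auto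
      moreover have "(\<integral>r. X r \<partial>squareM) \<le> (\<integral>r. \<rho> (fst r) * \<rho> (snd r) * S_ent (G (fst r) (snd r)) \<partial>squareM)"
      proof (rule integral_mono)
        show "integrable squareM X" unfolding X_def
          by (intro I2 bm_diff bm_add bm_mult bm_const bS bv2 bvv bA b\<phi>)
        show "integrable squareM (\<lambda>r. \<rho> (fst r) * \<rho> (snd r) * S_ent (G (fst r) (snd r)))"
          by (intro I2 bm_mult bm_fst[OF b\<rho>] bm_snd[OF b\<rho>] S_ent_graphon_bm G)
        fix r assume r: "r \<in> space squareM"
        then have r': "fst r \<in> {0..1}" "snd r \<in> {0..1}" by auto
        have i: "0 < \<gamma> r" "\<gamma> r < 1" using \<gamma>\<eta>[OF r] \<eta> by auto
        have "S_ent (\<gamma> r) + (\<epsilon>\<^sup>2 * \<phi> r) * ln ((1 - \<gamma> r) / \<gamma> r) - 2 * (\<epsilon>\<^sup>2 * \<phi> r)\<^sup>2 / (\<gamma> r * (1 - \<gamma> r)) \<le> S_ent (\<gamma> r + \<epsilon>\<^sup>2 * \<phi> r)"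
          using small[OF r] \<gamma>\<eta>[OF r] i by (intro S_ent_taylor_lower) auto
        moreover have "ln ((1 - \<gamma> r) / \<gamma> r) = - A r"
        proof -
          have "0 < 1 + exp (- A r)" by (simp add: add_pos_pos)
          then have "(1 - \<gamma> r) / \<gamma> r = exp (- A r)" unfolding \<gamma>A[OF r] by (simp add: field_simps)
          then show ?thesis by simp
        qed
        moreover have "2 * (\<epsilon>\<^sup>2 * \<phi> r)\<^sup>2 / (\<gamma> r * (1 - \<gamma> r)) \<le> 2 * (\<epsilon> ^ 3 * K\<^sup>2) / \<eta>\<^sup>2"
        proof (rule frac_le)
          have "(\<phi> r)\<^sup>2 \<le> K\<^sup>2" using \<phi>K[OF r] K abs_le_square_iff[of "\<phi> r" K] by simp
          moreover have "\<epsilon> ^ 4 \<le> \<epsilon> ^ 3" using \<epsilon> \<epsilon>1 by (intro power_decreasing) auto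
          ultimately have "\<epsilon> ^ 4 * (\<phi> r)\<^sup>2 \<le> \<epsilon> ^ 3 * K\<^sup>2" using \<epsilon> by (intro mult_mono) auto
          then show "2 * (\<epsilon>\<^sup>2 * \<phi> r)\<^sup>2 \<le> 2 * (\<epsilon> ^ 3 * K\<^sup>2)" by (simp add: power_mult_distrib)
          show "\<eta>\<^sup>2 \<le> \<gamma> r * (1 - \<gamma> r)" unfolding power2_eq_square using \<gamma>\<eta>[OF r] \<eta> by (intro mult_mono) auto
        qed (use \<eta> \<epsilon> in auto)
        ultimately have low: "S r - \<epsilon>\<^sup>2 * (A r * \<phi> r) - 2 * (\<epsilon> ^ 3 * K\<^sup>2) / \<eta>\<^sup>2 \<le> S_ent (G (fst r) (snd r))"
          by (simp add: S_def G_def \<gamma>_def mult_ac)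
        have \<rho>\<rho>: "0 \<le> \<rho> (fst r) * \<rho> (snd r)" "\<rho> (fst r) * \<rho> (snd r) \<le> 2 * 2"
          using \<rho>r[OF r'(1)] \<rho>r[OF r'(2)] by (intro mult_nonneg_nonneg mult_mono; simp)+
        define Z where "Z = A r * \<phi> r"
        have Z: "\<bar>Z\<bar> \<le> K * K" unfolding Z_def abs_mult using AK[OF r] \<phi>K[OF r] by (intro mult_mono) auto
        have expand: "\<rho> (fst r) * \<rho> (snd r) * (S r - \<epsilon>\<^sup>2 * Z)
            = S r + \<epsilon> * (S r * ?v r) + \<epsilon>\<^sup>2 * (vv r * S r) - \<epsilon>\<^sup>2 * Z - \<epsilon> ^ 3 * (Z * ?v r + \<epsilon> * (Z * vv r))"
          unfolding \<rho>_def vv_def by (simp add: algebra_simps power2_eq_square power3_eq_cube)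
        have "\<bar>Z * ?v r + \<epsilon> * (Z * vv r)\<bar> \<le> 3 * K ^ 4"
        proof -
          have "\<bar>?v r\<bar> \<le> 2 * K" using vK[OF r'(1)] vK[OF r'(2)] by linarith
          then have "\<bar>Z * ?v r\<bar> \<le> (K * K) * (2 * K)" unfolding abs_mult using Z K by (intro mult_mono) auto
          moreover have "\<bar>vv r\<bar> \<le> K * K" unfolding vv_def abs_mult using vK[OF r'(1)] vK[OF r'(2)] K by (intro mult_mono) auto
          then have "\<bar>\<epsilon> * (Z * vv r)\<bar> \<le> 1 * ((K * K) * (K * K))" unfolding abs_mult using Z K \<epsilon> \<epsilon>1 by (intro mult_mono) auto
          moreover have "(K * K) * (2 * K) \<le> 2 * K ^ 4"
            using power_increasing[of 3 4 K] K by (simp add: power3_eq_cube power4_eq_xxxx)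
          ultimately show ?thesis by (simp add: power4_eq_xxxx)
        qed
        then have "\<epsilon> ^ 3 * (Z * ?v r + \<epsilon> * (Z * vv r)) \<le> \<epsilon> ^ 3 * (3 * K ^ 4)" using \<epsilon> by (intro mult_left_mono) (auto simp: abs_le_iff)
        moreover have "\<rho> (fst r) * \<rho> (snd r) * (2 * (\<epsilon> ^ 3 * K\<^sup>2) / \<eta>\<^sup>2) \<le> (2 * 2) * (2 * (\<epsilon> ^ 3 * K\<^sup>2) / \<eta>\<^sup>2)"
          using \<rho>\<rho> \<epsilon> by (intro mult_right_mono) auto
        moreover have "C6 * \<epsilon> ^ 3 = \<epsilon> ^ 3 * (3 * K ^ 4) + (2 * 2) * (2 * (\<epsilon> ^ 3 * K\<^sup>2) / \<eta>\<^sup>2)"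
          by (simp add: C6_def algebra_simps)
        ultimately have "X r \<le> \<rho> (fst r) * \<rho> (snd r) * (S r - \<epsilon>\<^sup>2 * Z) - \<rho> (fst r) * \<rho> (snd r) * (2 * (\<epsilon> ^ 3 * K\<^sup>2) / \<eta>\<^sup>2)"
          unfolding expand unfolding X_def Z_def[symmetric] by linarith
        also have "\<dots> = \<rho> (fst r) * \<rho> (snd r) * (S r - \<epsilon>\<^sup>2 * (A r * \<phi> r) - 2 * (\<epsilon> ^ 3 * K\<^sup>2) / \<eta>\<^sup>2)"
          unfolding Z_def by (simp only: right_diff_distrib)
        also have "\<dots> \<le> \<rho> (fst r) * \<rho> (snd r) * S_ent (G (fst r) (snd r))"
          using low \<rho>\<rho>(1) by (rule mult_left_mono)
        finally show "X r \<le> \<rho> (fst r) * \<rho> (snd r) * S_ent (G (fst r) (snd r))" .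
      qed
      ultimately show ?thesis using iX h(3) by simp
    qed
    show ?thesis using h(1) H1 Hk HS by blast
  qed
  show False
  proof -
    \<comment> \<open>A common majorant of the error constants.
      \<open>Y * \<epsilon> \<le> \<rho>0\<close> secures the penalty condition, and
      \<open>Y * \<epsilon> \<le> Q0 / 4\<close> leaves the contradiction
      \<open>Q0 \<le> Q0 / 2 + Q0 / 4\<close>.\<close>
    define Y where "Y = C5 + C * C1 + C6 + 2 * C * C5 + 1"
    have Y: "0 < Y" unfolding Y_def using C C5 K \<eta> by (simp add: C6_def C1_def add_nonneg_pos)
    define \<epsilon> where "\<epsilon> = min \<epsilon>0 (min (\<rho>0 / Y) (Q0 / (4 * Y)))"
    have \<epsilon>: "0 < \<epsilon>" "\<epsilon> \<le> \<epsilon>0" "\<epsilon> \<le> \<rho>0 / Y" "\<epsilon> \<le> Q0 / (4 * Y)" using \<epsilon>0 \<rho>0 Q0 Y by (auto simp: \<epsilon>_def)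
    have Y\<epsilon>: "Y * \<epsilon> \<le> \<rho>0" "Y * \<epsilon> \<le> Q0 / 4" using \<epsilon> Y by (auto simp: field_simps)
    obtain h where h: "graphon h" "\<bar>star_density 1 h - star_density 1 g\<bar> \<le> C1 * \<epsilon> ^ 3"
      "\<bar>star_density k h - star_density k g - \<epsilon>\<^sup>2 * \<rho>0\<bar> \<le> C5 * \<epsilon> ^ 3"
      "2 * entropy g + \<epsilon>\<^sup>2 * (Q0 - 2 * \<beta> / real k * \<rho>0) - C6 * \<epsilon> ^ 3 \<le> 2 * entropy h"
      using ex[OF \<epsilon>(1,2)] by blast
    have nn: "0 \<le> C1" "0 \<le> C6" using K \<eta> by (auto simp: C1_def C6_def)
    have e2: "0 < \<epsilon>\<^sup>2" using \<epsilon> by simp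
    have e3: "\<epsilon> ^ 3 = \<epsilon>\<^sup>2 * \<epsilon>" by (simp add: power2_eq_square power3_eq_cube)
    have lowk: "\<epsilon>\<^sup>2 * (\<rho>0 - C5 * \<epsilon>) \<le> star_density k h - star_density k g" and upk: "star_density k h - star_density k g \<le> \<epsilon>\<^sup>2 * (\<rho>0 + C5 * \<epsilon>)"
      using h(3) unfolding e3 by (auto simp: abs_le_iff algebra_simps)
    have "C * \<bar>star_density 1 h - star_density 1 g\<bar> \<le> C * (C1 * \<epsilon> ^ 3)" using h(2) C(1) by (intro mult_left_mono)
    also have "\<dots> = \<epsilon>\<^sup>2 * (C * C1 * \<epsilon>)" by (simp add: e3 mult_ac)
    also have "\<dots> \<le> \<epsilon>\<^sup>2 * (\<rho>0 - C5 * \<epsilon>)"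
    proof (intro mult_left_mono)
      have "(C * C1 + C5) * \<epsilon> \<le> Y * \<epsilon>" unfolding Y_def using \<epsilon>(1) nn C C5 by (intro mult_right_mono) auto
      then show "C * C1 * \<epsilon> \<le> \<rho>0 - C5 * \<epsilon>" using Y\<epsilon>(1) by (simp add: algebra_simps)
    qed (use e2 in simp)
    also note lowk
    finally have "entropy h \<le> entropy g + C * (star_density k h - star_density k g)" by (rule C(2)[OF h(1)])
    also have "\<dots> \<le> entropy g + C * (\<epsilon>\<^sup>2 * (\<rho>0 + C5 * \<epsilon>))" using upk C(1) by (intro add_left_mono mult_left_mono)
    finally have "\<epsilon>\<^sup>2 * (Q0 - 2 * \<beta> / real k * \<rho>0 - C6 * \<epsilon>) \<le> \<epsilon>\<^sup>2 * (2 * C * (\<rho>0 + C5 * \<epsilon>))"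
      using h(4) unfolding e3 by (simp add: algebra_simps)
    then have "Q0 - 2 * \<beta> / real k * \<rho>0 - C6 * \<epsilon> \<le> 2 * C * (\<rho>0 + C5 * \<epsilon>)" using e2 by (simp only: mult_le_cancel_left_pos)
    then have "Q0 \<le> (2 * \<beta> / real k + 2 * C) * \<rho>0 + (C6 + 2 * C * C5) * \<epsilon>" by (simp add: algebra_simps)
    also have "(C6 + 2 * C * C5) * \<epsilon> \<le> Y * \<epsilon>" unfolding Y_def using \<epsilon>(1) nn C C5 by (intro mult_right_mono) auto
    finally show False using \<rho>0Q Y\<epsilon>(2) Q0 by linarith
  qed
qed

section \<open>From kernel positivity to a bound on the number of degrees\<close>

lemma ln_1_exp_lipschitz: "\<bar>ln (1 + exp x) - ln (1 + exp y)\<bar> \<le> \<bar>x - y\<bar>" for x y :: real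
proof -
  have mono: "ln (1 + exp b) - ln (1 + exp a) \<le> b - a \<and> ln (1 + exp a) \<le> ln (1 + exp b)" if "a \<le> b" for a b :: real
  proof -
    have pos: "0 < 1 + exp a" "0 < 1 + exp b" by (auto intro: add_pos_pos)
    have "1 + exp b \<le> exp (b - a) * (1 + exp a)" using that by (simp add: distrib_left exp_diff)
    then have "ln (1 + exp b) \<le> ln (exp (b - a) * (1 + exp a))" using pos by (subst ln_le_cancel_iff) auto
    also have "\<dots> = b - a + ln (1 + exp a)" using pos by (subst ln_mult) auto
    finally show ?thesis using that pos by simp
  qed
  show ?thesis using mono[of x y] mono[of y x] by (cases "x \<le> y") auto
qed

lemma linear_functionals_common_kernel:
  fixes W :: "nat \<Rightarrow> 'i \<Rightarrow> real" and \<kappa> :: "nat \<Rightarrow> 'i \<Rightarrow> real"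
  assumes "m < n"
  shows "\<exists>c. (\<exists>j<n. c j \<noteq> 0) \<and> (\<forall>s<m. (\<Sum>i\<in>I. (\<Sum>j<n. c j * W j i) * \<kappa> s i) = 0)"
proof -
  obtain c where c: "\<exists>j<n. c j \<noteq> 0" "\<forall>s<m. (\<Sum>j<n. (\<Sum>i\<in>I. W j i * \<kappa> s i) * c j) = 0"
    using homogeneous_system_nontrivial[OF assms, of "\<lambda>s j. \<Sum>i\<in>I. W j i * \<kappa> s i"] by blast
  have "(\<Sum>i\<in>I. (\<Sum>j<n. c j * W j i) * \<kappa> s i) = (\<Sum>j<n. (\<Sum>i\<in>I. W j i * \<kappa> s i) * c j)" for s
    unfolding sum_distrib_right by (subst sum.swap) (simp add: mult_ac)
  then show ?thesis using c by metis
qed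

text \<open>Nine degrees leave, in a space of step functions on which the kernel \<open>ln (1 + exp A)\<close> is positive, five
  dimensions for the four linear constraints of the second variation.\<close>

lemma logistic_maximizer_degree_support:
  fixes \<alpha> \<beta> :: real
  assumes max: "entropy_maximizer k \<tau> g" and k: "2 \<le> k" and gap: "star_density 1 g ^ k < star_density k g"
    and ba: "bm unitM a" and a: "AE x in unitM. a x = degree g x ^ (k - 1)" and \<beta>: "0 < \<beta>"
    and gA: "\<And>x y. x \<in> {0..1} \<Longrightarrow> y \<in> {0..1} \<Longrightarrow> g x y = 1 / (1 + exp (- (\<alpha> + \<beta> * (a x + a y))))"
    and R: "finite R" "R \<subseteq> degree_support g"
  shows "card R \<le> 8"
proof (rule ccontr)
  assume card: "\<not> card R \<le> 8"
  have g: "graphon g" using max by (simp add: entropy_maximizer_def)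
  note gb = graphonD(1)[OF g]
  note I1 = unitM.bm_integrable and I2 = squareM.P.bm_integrable
  let ?l = "sorted_list_of_set R"
  define r where "r i = ?l ! i" for i
  have l: "length ?l = card R" "set ?l = R" "sorted_wrt (<) ?l"
    using R strict_sorted_list_of_set by auto
  have rR: "r i \<in> degree_support g" if "i \<le> 8" for i
    using nth_mem[of i ?l] l(1,2) that card R(2) by (auto simp: r_def)
  have rlt: "r i < r (Suc i)" if "i < 8" for i
    using sorted_wrt_nth_less[OF l(3), of i "Suc i"] l(1) that card by (simp add: r_def)
  have r01: "0 \<le> r i" "r i \<le> 1" if "i \<le> 8" for i using degree_support_range[OF g rR[OF that]] by auto
  let ?p = "k - 1"
  have p: "1 \<le> ?p" using k by simp
  \<comment> \<open>Splitting \<open>\<alpha>\<close> evenly gives \<open>exp A\<close> at the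
    degrees \<open>r i\<close>, \<open>r j\<close> the product form \<open>x i * x j\<close>. The
    nodes increase with the degrees because \<open>\<beta> > 0\<close>.\<close>
  define x where "x i = exp (\<alpha> / 2 + \<beta> * r i ^ ?p)" for i
  have xlt: "x i < x (Suc i)" if "i < 8" for i
  proof -
    have "r i ^ ?p < r (Suc i) ^ ?p" using rlt[OF that] r01[of i] that p by (intro power_strict_mono) auto
    then show ?thesis using \<beta> by (simp add: x_def)
  qed
  have xx: "1 + x i * x j = 1 + exp (\<alpha> + \<beta> * (r i ^ ?p + r j ^ ?p))" for i j
    by (simp add: x_def exp_add[symmetric] algebra_simps)
  obtain W :: "nat \<Rightarrow> nat \<Rightarrow> real" and z where z: "0 < z" and
    W: "\<And>c :: nat \<Rightarrow> real. z * (\<Sum>j\<le>4. (c j)\<^sup>2) \<le> (\<Sum>i\<le>8. \<Sum>j\<le>8. (\<Sum>s\<le>4. c s * W s i) * (\<Sum>s\<le>4. c s * W s j) * ln (1 + x i * x j))"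
    using log_kernel_positive_subspace[of x 4] xlt by (auto simp: x_def)
  define Wb where "Wb = (\<Sum>s\<le>4. \<Sum>i\<le>8. \<bar>W s i\<bar>)"
  have Wb: "0 \<le> Wb" unfolding Wb_def by (intro sum_nonneg) auto
  \<comment> \<open>Replacing nine points by neighbourhoods of radius \<open>\<eta>\<close> moves
    each kernel entry by at most \<open>\<mu>\<close>, and hence the form by at most
    \<open>\<mu> * Wb\<^sup>2 * 5\<close> times the squared norm of \<open>c\<close>. The choice
    keeps this below the positivity constant \<open>z\<close>.\<close>
  define \<eta> where "\<eta> = z / (2 * (2 * \<beta> * real ?p * Wb\<^sup>2 * 5 + 1))"
  have den: "0 < 2 * \<beta> * real ?p * Wb\<^sup>2 * 5 + 1" using \<beta> by (intro add_nonneg_pos) auto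
  have \<eta>: "0 < \<eta>" using z den by (simp add: \<eta>_def)
  define \<mu> where "\<mu> = 2 * \<beta> * real ?p * \<eta>"
  have \<mu>: "\<mu> * Wb\<^sup>2 * 5 < z"
  proof -
    have "\<mu> * Wb\<^sup>2 * 5 \<le> (2 * \<beta> * real ?p * Wb\<^sup>2 * 5 + 1) * \<eta>" using \<eta> by (simp add: \<mu>_def algebra_simps)
    also have "\<dots> = z / 2" using den by (simp add: \<eta>_def field_simps)
    also have "\<dots> < z" using z by simp
    finally show ?thesis .
  qed
  have \<mu>0: "0 \<le> \<mu>" using \<beta> \<eta> by (simp add: \<mu>_def)
  define N where "N i = {y \<in> {0..1}. \<bar>degree g y - r i\<bar> < \<eta>}" for i
  have Ns: "N i \<in> sets unitM" for i unfolding N_def by (rule degree_near_sets[OF g])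
  have Npos: "0 < measure unitM (N i)" if "i \<le> 8" for i
    using rR[OF that] \<eta> by (auto simp: degree_support_def N_def)
  define b where "b i y = indicator (N i) y / measure unitM (N i)" for i y
  have bb: "bm unitM (b i)" for i unfolding b_def by (intro bm_divide bm_indicator Ns)
  have b1: "(\<integral>y. b i y \<partial>unitM) = 1" if "i \<le> 8" for i
    unfolding b_def using Npos[OF that] sets.sets_into_space[OF Ns[of i]] by (simp add: Int_absorb2)
  have b0: "0 \<le> b i y" for i y by (simp add: b_def)
  define S where "S q = S_ent (g (fst q) (snd q))" for q
  have bS: "bm squareM S" unfolding S_def by (rule S_ent_graphon_bm[OF g])
  \<comment> \<open>the four constraints as integrals of \<open>v\<close> against fixed functions\<close>
  define \<kappa> where "\<kappa> s y = (if s = 0 then 1 else if s = 1 then degree g y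
     else if s = 2 then degree g y ^ k + real k * (\<integral>x. degree g x ^ (k - 1) * g y x \<partial>unitM)
     else \<integral>x. S (y, x) \<partial>unitM)" for s :: nat and y
  have bdp: "bm unitM (\<lambda>x. degree g x ^ j)" for j by (rule star_density_bm[OF g])
  have b\<kappa>: "bm unitM (\<kappa> s)" for s
  proof -
    have "bm unitM (\<lambda>y. 1)" "bm unitM (degree g)"
      "bm unitM (\<lambda>y. degree g y ^ k + real k * (\<integral>x. degree g x ^ (k - 1) * g y x \<partial>unitM))"
      "bm unitM (\<lambda>y. \<integral>x. S (y, x) \<partial>unitM)"
      using degree_bm[OF g] bm_integral_snd[OF bS] weighted_section_bm[OF g bdp]
      by (auto intro!: bm_const bm_add bm_mult bdp)
    then show ?thesis unfolding \<kappa>_def by (cases "s = 0"; cases "s = 1"; cases "s = 2") auto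
  qed
  obtain c where c: "\<exists>j<5. c j \<noteq> 0"
    and c0: "\<forall>s<4. (\<Sum>i\<in>{..8}. (\<Sum>j<5. c j * W j i) * (\<integral>y. b i y * \<kappa> s y \<partial>unitM)) = 0"
    using linear_functionals_common_kernel[where m = 4 and n = 5 and I = "{..8}" and W = W and \<kappa> = "\<lambda>s i. \<integral>y. b i y * \<kappa> s y \<partial>unitM"]
    by auto
  have five: "{..<5} = {..4::nat}" by auto
  define u where "u i = (\<Sum>j\<le>4. c j * W j i)" for i
  define v where "v y = (\<Sum>i\<le>8. u i * b i y)" for y
  have bv: "bm unitM v" unfolding v_def by (intro bm_sum bm_mult bm_const bb)
  have v\<kappa>: "(\<integral>y. v y * \<kappa> s y \<partial>unitM) = 0" if "s < 4" for s
  proof -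
    have "(\<integral>y. v y * \<kappa> s y \<partial>unitM) = (\<integral>y. (\<Sum>i\<le>8. u i * (b i y * \<kappa> s y)) \<partial>unitM)"
      by (simp add: v_def sum_distrib_right mult.assoc)
    also have "\<dots> = (\<Sum>i\<le>8. \<integral>y. u i * (b i y * \<kappa> s y) \<partial>unitM)"
      by (intro Bochner_Integration.integral_sum I1 bm_mult bm_const bb b\<kappa>)
    also have "\<dots> = 0" using c0 that by (simp add: u_def five)
    finally show ?thesis .
  qed
  define A where "A = (\<lambda>q. \<alpha> + \<beta> * (a (fst q) + a (snd q)))"
  define \<Lambda> where "\<Lambda> q = ln (1 + exp (A q))" for q
  have bA: "bm squareM A" unfolding A_def by (intro bm_add bm_mult bm_const bm_fst[OF ba] bm_snd[OF ba])
  have b\<Lambda>: "bm squareM \<Lambda>"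
  proof -
    obtain C where C: "0 \<le> C" "\<And>q. q \<in> space squareM \<Longrightarrow> \<bar>A q\<bar> \<le> C" using bm_bound[OF bA] by blast
    have [measurable]: "A \<in> borel_measurable squareM" by (rule bm_measurable[OF bA])
    show ?thesis
    proof (rule bmI)
      show "\<Lambda> \<in> borel_measurable squareM" unfolding \<Lambda>_def by measurable
      show "\<bar>\<Lambda> q\<bar> \<le> \<bar>ln (1 + exp 0)\<bar> + C" if "q \<in> space squareM" for q
        using ln_1_exp_lipschitz[of "A q" 0] C(2)[OF that] unfolding \<Lambda>_def by linarith
    qed
  qed
  have nonpos: "(\<integral>q. v (fst q) * v (snd q) * \<Lambda> q \<partial>squareM) \<le> 0"
    unfolding \<Lambda>_def A_def
  proof (rule logistic_maximizer_second_variation[OF max k gap ba a less_imp_le[OF \<beta>] _ bv])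
    show "g x y = 1 / (1 + exp (- (\<alpha> + \<beta> * (a (fst (x, y)) + a (snd (x, y))))))" if "x \<in> {0..1}" "y \<in> {0..1}" for x y
      using gA[OF that] by simp
    show "(\<integral>x. v x \<partial>unitM) = 0" using v\<kappa>[of 0] by (simp add: \<kappa>_def)
    show "(\<integral>x. v x * degree g x \<partial>unitM) = 0" using v\<kappa>[of 1] by (simp add: \<kappa>_def)
    have "(\<integral>y. v y * \<kappa> 2 y \<partial>unitM) = (\<integral>y. v y * degree g y ^ k + real k * (v y * (\<integral>x. degree g x ^ (k - 1) * g y x \<partial>unitM)) \<partial>unitM)"
      by (simp add: \<kappa>_def algebra_simps)
    also have "\<dots> = (\<integral>y. v y * degree g y ^ k \<partial>unitM) + real k * (\<integral>y. v y * (\<integral>x. degree g x ^ (k - 1) * g y x \<partial>unitM) \<partial>unitM)"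
      using I1[OF bm_mult[OF bv bdp]] I1[OF bm_mult[OF bv weighted_section_bm[OF g bdp]]] by simp
    also have "(\<integral>y. v y * (\<integral>x. degree g x ^ (k - 1) * g y x \<partial>unitM) \<partial>unitM) = (\<integral>x. degree g x ^ (k - 1) * (\<integral>y. v y * g x y \<partial>unitM) \<partial>unitM)"
      by (rule selfadjoint_degree[OF g bv bdp])
    finally show "(\<integral>x. v x * degree g x ^ k \<partial>unitM) + real k * (\<integral>x. degree g x ^ (k - 1) * (\<integral>y. v y * g x y \<partial>unitM) \<partial>unitM) = 0"
      using v\<kappa>[of 2] by simp
    show "(\<integral>q. v (fst q) * S_ent (g (fst q) (snd q)) \<partial>squareM) = 0"
      using v\<kappa>[of 3] squareM_integral_fst[OF bv bS] by (simp add: \<kappa>_def S_def)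
  qed
  define Kb where "Kb i j = (\<integral>q. b i (fst q) * b j (snd q) * \<Lambda> q \<partial>squareM)" for i j
  have bbij: "bm squareM (\<lambda>q. b i (fst q) * b j (snd q))" for i j by (intro bm_mult bm_fst[OF bb] bm_snd[OF bb])
  have form: "(\<integral>q. v (fst q) * v (snd q) * \<Lambda> q \<partial>squareM) = (\<Sum>i\<le>8. \<Sum>j\<le>8. u i * u j * Kb i j)"
  proof -
    have "(\<integral>q. v (fst q) * v (snd q) * \<Lambda> q \<partial>squareM) = (\<integral>q. (\<Sum>i\<le>8. \<Sum>j\<le>8. (u i * u j) * (b i (fst q) * b j (snd q) * \<Lambda> q)) \<partial>squareM)"
      unfolding v_def sum_product unfolding sum_distrib_right by (simp only: mult_ac)
    also have "\<dots> = (\<Sum>i\<le>8. \<integral>q. (\<Sum>j\<le>8. (u i * u j) * (b i (fst q) * b j (snd q) * \<Lambda> q)) \<partial>squareM)"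
      by (intro Bochner_Integration.integral_sum I2 bm_sum bm_mult[OF bm_const] bm_mult[OF bbij b\<Lambda>])
    also have "\<dots> = (\<Sum>i\<le>8. \<Sum>j\<le>8. \<integral>q. (u i * u j) * (b i (fst q) * b j (snd q) * \<Lambda> q) \<partial>squareM)"
      by (intro sum.cong refl Bochner_Integration.integral_sum I2 bm_mult[OF bm_const] bm_mult[OF bbij b\<Lambda>])
    finally show ?thesis by (simp add: Kb_def)
  qed
  \<comment> \<open>\<open>Kb i j\<close> averages \<open>ln (1 + exp A)\<close> over two classes.
    That function is 1-Lipschitz in \<open>A\<close>, and each of the two degrees shifts
    \<open>A\<close> by at most \<open>\<beta> * real ?p * \<eta>\<close>, half of
    \<open>\<mu>\<close>.\<close>
  have close: "\<bar>Kb i j - ln (1 + x i * x j)\<bar> \<le> \<mu>" if ij: "i \<le> 8" "j \<le> 8" for i j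
  proof -
    let ?L = "ln (1 + x i * x j)"
    have one: "(\<integral>q. b i (fst q) * b j (snd q) \<partial>squareM) = 1"
      using squareM_integral_fst[OF bb bm_snd[OF bb], of i j] b1 ij by simp
    have "Kb i j - ?L = (\<integral>q. b i (fst q) * b j (snd q) * (\<Lambda> q - ?L) \<partial>squareM)"
      using I2[OF bm_mult[OF bbij b\<Lambda>]] I2[OF bbij] one by (simp add: Kb_def right_diff_distrib)
    moreover have "\<bar>\<integral>q. b i (fst q) * b j (snd q) * (\<Lambda> q - ?L) \<partial>squareM\<bar> \<le> (\<integral>q. \<bar>b i (fst q) * b j (snd q) * (\<Lambda> q - ?L)\<bar> \<partial>squareM)"
      by (rule integral_abs_bound)
    moreover have "(\<integral>q. \<bar>b i (fst q) * b j (snd q) * (\<Lambda> q - ?L)\<bar> \<partial>squareM) \<le> (\<integral>q. \<mu> * (b i (fst q) * b j (snd q)) \<partial>squareM)"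
    proof (rule integral_mono_AE)
      have "bm squareM (\<lambda>q. b i (fst q) * b j (snd q) * (\<Lambda> q - ?L))" by (intro bm_mult[OF bbij] bm_diff b\<Lambda> bm_const)
      then show "integrable squareM (\<lambda>q. \<bar>b i (fst q) * b j (snd q) * (\<Lambda> q - ?L)\<bar>)" by (intro integrable_abs I2)
      show "integrable squareM (\<lambda>q. \<mu> * (b i (fst q) * b j (snd q)))" by (intro I2 bm_mult[OF bm_const bbij])
      have "AE x in unitM. AE y in unitM. a x = degree g x ^ ?p \<and> a y = degree g y ^ ?p"
        using a
      proof eventually_elim
        case (elim x)
        show ?case using a by eventually_elim (use elim in simp)
      qed
      moreover have "{q \<in> space squareM. a (fst q) = degree g (fst q) ^ ?p \<and> a (snd q) = degree g (snd q) ^ ?p} \<in> sets squareM"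
      proof -
        have [measurable]: "a \<in> borel_measurable unitM" "degree g \<in> borel_measurable unitM"
          by (intro bm_measurable ba degree_bm g)+
        show ?thesis by measurable
      qed
      ultimately have "AE q in squareM. a (fst q) = degree g (fst q) ^ ?p \<and> a (snd q) = degree g (snd q) ^ ?p"
        by (intro squareM.AE_pair_measure) auto
      then show "AE q in squareM. \<bar>b i (fst q) * b j (snd q) * (\<Lambda> q - ?L)\<bar> \<le> \<mu> * (b i (fst q) * b j (snd q))"
      proof eventually_elim
        case (elim q)
        show ?case
        proof (cases "fst q \<in> N i \<and> snd q \<in> N j")
          case False
          then have "b i (fst q) = 0 \<or> b j (snd q) = 0" by (auto simp: b_def)
          then show ?thesis by auto
        next
          case True
          have near: "\<bar>degree g y ^ ?p - r s ^ ?p\<bar> \<le> real ?p * \<eta>" if "y \<in> N s" "s \<le> 8" for y s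
          proof -
            have "\<bar>degree g y ^ ?p - r s ^ ?p\<bar> \<le> real ?p * \<bar>degree g y - r s\<bar>"
              using that degree_range[OF g, of y] r01[OF that(2)] by (intro power_lipschitz_unit) (auto simp: N_def)
            also have "\<dots> \<le> real ?p * \<eta>" using that by (intro mult_left_mono) (auto simp: N_def)
            finally show ?thesis .
          qed
          have "\<bar>\<Lambda> q - ?L\<bar> \<le> \<bar>A q - (\<alpha> + \<beta> * (r i ^ ?p + r j ^ ?p))\<bar>"
            unfolding \<Lambda>_def xx by (rule ln_1_exp_lipschitz)
          also have "A q - (\<alpha> + \<beta> * (r i ^ ?p + r j ^ ?p)) = \<beta> * ((degree g (fst q) ^ ?p - r i ^ ?p) + (degree g (snd q) ^ ?p - r j ^ ?p))"
            using elim by (simp add: A_def algebra_simps)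
          also have "\<bar>\<dots>\<bar> \<le> \<beta> * (real ?p * \<eta> + real ?p * \<eta>)"
          proof -
            have "\<bar>(degree g (fst q) ^ ?p - r i ^ ?p) + (degree g (snd q) ^ ?p - r j ^ ?p)\<bar> \<le> real ?p * \<eta> + real ?p * \<eta>"
              using True ij by (intro order_trans[OF abs_triangle_ineq add_mono] near) auto
            then show ?thesis unfolding abs_mult[of \<beta>] using \<beta> by (intro mult_mono) auto
          qed
          also have "\<dots> = \<mu>" by (simp add: \<mu>_def algebra_simps)
          finally have "\<bar>\<Lambda> q - ?L\<bar> \<le> \<mu>" .
          then have "b i (fst q) * b j (snd q) * \<bar>\<Lambda> q - ?L\<bar> \<le> b i (fst q) * b j (snd q) * \<mu>"
            using b0 by (intro mult_left_mono mult_nonneg_nonneg) auto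
          then show ?thesis using b0 by (simp add: abs_mult mult_ac)
        qed
      qed
    qed
    moreover have "(\<integral>q. \<mu> * (b i (fst q) * b j (snd q)) \<partial>squareM) = \<mu>" using one by simp
    ultimately show ?thesis by linarith
  qed
  let ?c2 = "\<Sum>j\<le>4. (c j)\<^sup>2"
  have c2: "0 < ?c2"
  proof -
    obtain j where "j < 5" "c j \<noteq> 0" using c by blast
    then show ?thesis by (intro sum_pos2[of _ j]) auto
  qed
  have u1: "(\<Sum>i\<le>8. \<bar>u i\<bar>) \<le> Wb * (\<Sum>j\<le>4. \<bar>c j\<bar>)"
  proof -
    have "(\<Sum>i\<le>8. \<bar>u i\<bar>) \<le> (\<Sum>i\<le>8. \<Sum>j\<le>4. \<bar>c j\<bar> * \<bar>W j i\<bar>)"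
      unfolding u_def by (intro sum_mono order_trans[OF sum_abs]) (simp add: abs_mult)
    also have "\<dots> = (\<Sum>j\<le>4. \<bar>c j\<bar> * (\<Sum>i\<le>8. \<bar>W j i\<bar>))" by (subst sum.swap) (simp add: sum_distrib_left)
    also have "\<dots> \<le> (\<Sum>j\<le>4. \<bar>c j\<bar> * Wb)"
    proof (intro sum_mono mult_left_mono)
      fix j :: nat assume "j \<in> {..4}"
      then show "(\<Sum>i\<le>8. \<bar>W j i\<bar>) \<le> Wb" unfolding Wb_def
        by (intro member_le_sum[of j "{..4}" "\<lambda>s. \<Sum>i\<le>8. \<bar>W s i\<bar>"] sum_nonneg) auto
    qed auto
    also have "\<dots> = Wb * (\<Sum>j\<le>4. \<bar>c j\<bar>)" by (simp add: sum_distrib_left mult.commute)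
    finally show ?thesis .
  qed
  \<comment> \<open>Cauchy-Schwarz over the five coefficients; this is the origin of the factor
    5.\<close>
  have u2: "(\<Sum>i\<le>8. \<bar>u i\<bar>)\<^sup>2 \<le> Wb\<^sup>2 * 5 * ?c2"
  proof -
    have "(\<Sum>i\<le>8. \<bar>u i\<bar>)\<^sup>2 \<le> (Wb * (\<Sum>j\<le>4. \<bar>c j\<bar>))\<^sup>2" by (intro power_mono u1 sum_nonneg) auto
    also have "\<dots> = Wb\<^sup>2 * (\<Sum>j\<le>4. \<bar>c j\<bar>)\<^sup>2" by (simp add: power_mult_distrib)
    also have "\<dots> \<le> Wb\<^sup>2 * ((\<Sum>j\<le>4. \<bar>c j\<bar>\<^sup>2) * real (card {..4::nat}))"
      by (intro mult_left_mono sum_squared_le_sum_of_squares) simp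
    finally show ?thesis by (simp add: mult_ac)
  qed
  have "(\<Sum>i\<le>8. \<Sum>j\<le>8. u i * u j * ln (1 + x i * x j)) - \<mu> * (\<Sum>i\<le>8. \<bar>u i\<bar>)\<^sup>2 \<le> (\<Sum>i\<le>8. \<Sum>j\<le>8. u i * u j * Kb i j)"
  proof -
    have "(\<Sum>i\<le>8. \<Sum>j\<le>8. u i * u j * ln (1 + x i * x j)) - \<mu> * (\<Sum>i\<le>8. \<bar>u i\<bar>)\<^sup>2
        = (\<Sum>i\<le>8. \<Sum>j\<le>8. u i * u j * ln (1 + x i * x j) - \<mu> * (\<bar>u i\<bar> * \<bar>u j\<bar>))"
      unfolding power2_eq_square sum_product unfolding sum_distrib_left sum_subtractf ..
    also have "\<dots> \<le> (\<Sum>i\<le>8. \<Sum>j\<le>8. u i * u j * Kb i j)"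
    proof (intro sum_mono)
      fix i j :: nat assume "i \<in> {..8}" "j \<in> {..8}"
      then have "\<bar>Kb i j - ln (1 + x i * x j)\<bar> \<le> \<mu>" by (intro close) auto
      then have "\<bar>u i * u j\<bar> * \<bar>Kb i j - ln (1 + x i * x j)\<bar> \<le> \<bar>u i * u j\<bar> * \<mu>" by (rule mult_left_mono) simp
      then have "\<bar>u i * u j * (Kb i j - ln (1 + x i * x j))\<bar> \<le> \<mu> * (\<bar>u i\<bar> * \<bar>u j\<bar>)" by (simp add: abs_mult mult_ac)
      then have "- (\<mu> * (\<bar>u i\<bar> * \<bar>u j\<bar>)) \<le> u i * u j * (Kb i j - ln (1 + x i * x j))" by (simp only: abs_le_iff) linarith
      then show "u i * u j * ln (1 + x i * x j) - \<mu> * (\<bar>u i\<bar> * \<bar>u j\<bar>) \<le> u i * u j * Kb i j"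
        unfolding right_diff_distrib by linarith
    qed
    finally show ?thesis .
  qed
  moreover have "z * ?c2 \<le> (\<Sum>i\<le>8. \<Sum>j\<le>8. u i * u j * ln (1 + x i * x j))" using W[of c] by (simp add: u_def)
  moreover have "\<mu> * (\<Sum>i\<le>8. \<bar>u i\<bar>)\<^sup>2 \<le> \<mu> * (Wb\<^sup>2 * 5 * ?c2)" by (rule mult_left_mono[OF u2 \<mu>0])
  moreover have "\<mu> * (Wb\<^sup>2 * 5 * ?c2) < z * ?c2" using mult_strict_right_mono[OF \<mu> c2] by (simp add: mult.assoc)
  ultimately show False using nonpos form by linarith
qed

text \<open>The Euler-Lagrange equation holds only almost everywhere, while the second variation
  wants it pointwise. So \<open>g\<close> is exchanged for its logistic formula \<open>h\<close>, a
  maximizer at the same \<open>\<tau>\<close> with the same degrees almost everywhere;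
  \<open>a\<close> remains the power of the old degree.\<close>

lemma interior_maximizer_degree_support:
  assumes max: "entropy_maximizer k \<tau> g" and k: "2 \<le> k" and gap: "star_density 1 g ^ k < star_density k g"
    and int: "measure squareM (pure_set g) = 0" and R: "finite R" "R \<subseteq> degree_support g"
  shows "card R \<le> 8"
proof -
  have g: "graphon g" using max by (simp add: entropy_maximizer_def)
  have k1: "1 \<le> k - 1" using k by simp
  obtain \<alpha> \<beta> where EL: "AE q in squareM. g (fst q) (snd q) =
    1 / (1 + exp (- (\<alpha> + \<beta> * (degree g (fst q) ^ (k - 1) + degree g (snd q) ^ (k - 1)))))"
    using interior_maximizer_euler_lagrange[OF max k gap int] by blast
  have \<beta>: "0 < \<beta>"
  proof (rule ccontr)
    assume "\<not> 0 < \<beta>"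
    then obtain c where c: "AE x in unitM. degree g x = c"
      using logistic_nonpos_degree_const[OF g k1 _ EL] by auto
    show False using gap degree_const_no_gap[OF g c] by simp
  qed
  define a where "a x = degree g x ^ (k - 1)" for x
  have ba: "bm unitM a" unfolding a_def by (rule star_density_bm[OF g])
  define h where "h x y = 1 / (1 + exp (- (\<alpha> + \<beta> * (a x + a y))))" for x y
  have h: "graphon h"
  proof (rule graphonI)
    have [measurable]: "a \<in> borel_measurable unitM" by (rule bm_measurable[OF ba])
    show "(\<lambda>p. h (fst p) (snd p)) \<in> borel_measurable squareM" unfolding h_def by measurable
    fix x y :: real
    have "0 < exp z" for z :: real by simp
    then have "0 \<le> 1 / (1 + exp z) \<and> 1 / (1 + exp z) \<le> 1" for z :: real by (simp add: add_pos_pos less_imp_le)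
    then show "h x y = h y x \<and> 0 \<le> h x y \<and> h x y \<le> 1" unfolding h_def by (simp add: add.commute)
  qed
  have gh: "AE q in squareM. g (fst q) (snd q) = h (fst q) (snd q)" using EL by (simp add: h_def a_def)
  have "AE x in unitM. AE y in unitM. g x y = h x y" using squareM.AE_pair[OF gh] by simp
  with AE_space[of unitM] have deg: "AE x in unitM. degree h x = degree g x"
  proof eventually_elim
    case (elim x)
    then have x: "x \<in> {0..1}" by simp
    show ?case unfolding degree_unitM
    proof (rule integral_cong_AE)
      show "AE y in unitM. h x y = g x y" using elim(2) by eventually_elim simp
    qed (intro bm_measurable graphon_section g h x)+
  qed
  have dens: "star_density j h = star_density j g" for j
    unfolding star_density_unitM
  proof (rule integral_cong_AE)
    show "AE x in unitM. degree h x ^ j = degree g x ^ j" using deg by eventually_elim simp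
  qed (intro bm_measurable star_density_bm g h)+
  have "entropy h = entropy g"
    unfolding entropy_squareM
  proof (intro arg_cong[where f = "\<lambda>z. 1 / 2 * z"] integral_cong_AE)
    show "AE q in squareM. S_ent (h (fst q) (snd q)) = S_ent (g (fst q) (snd q))" using gh by eventually_elim simp
  qed (intro bm_measurable S_ent_graphon_bm g h)+
  then have maxh: "entropy_maximizer k \<tau> h" using max h dens by (simp add: entropy_maximizer_def)
  have supp: "degree_support g \<subseteq> degree_support h"
  proof
    fix r assume r: "r \<in> degree_support g"
    have "measure unitM {x \<in> {0..1}. \<bar>degree h x - r\<bar> < \<eta>} = measure unitM {x \<in> {0..1}. \<bar>degree g x - r\<bar> < \<eta>}" for \<eta>
    proof (rule unitM.finite_measure_eq_AE[OF _ degree_near_sets[OF h] degree_near_sets[OF g]])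
      show "AE x in unitM. (x \<in> {x \<in> {0..1}. \<bar>degree h x - r\<bar> < \<eta>}) = (x \<in> {x \<in> {0..1}. \<bar>degree g x - r\<bar> < \<eta>})"
        using deg by eventually_elim simp
    qed
    then show "r \<in> degree_support h" using r by (simp add: degree_support_def)
  qed
  show ?thesis
  proof (rule logistic_maximizer_degree_support[OF maxh k _ ba _ \<beta> _ R(1)])
    show "star_density 1 h ^ k < star_density k h" using gap dens by simp
    show "AE x in unitM. a x = degree h x ^ (k - 1)" using deg by eventually_elim (simp add: a_def)
    show "h x y = 1 / (1 + exp (- (\<alpha> + \<beta> * (a x + a y))))" for x y by (simp add: h_def)
    show "R \<subseteq> degree_support h" using R(2) supp by blast
  qed
qed

text \<open>A bound on all finite subsets of the degree support yields its finiteness and its size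
  at once. The zero-one case gives 7, the interior case 8, and equality in Jensen's inequality a
  single class.\<close>

lemma maximizer_podal:
  assumes max: "entropy_maximizer k \<tau> g" and k: "2 \<le> k"
  shows "\<exists>m\<le>8. podal m g"
proof (cases "star_density 1 g ^ k < star_density k g")
  case gap: True
  have g: "graphon g" using max by (simp add: entropy_maximizer_def)
  have bound: "card R \<le> 8" if R: "finite R" "R \<subseteq> degree_support g" for R
  proof (cases "measure squareM (pure_set g) = 0")
    case True
    then show ?thesis using interior_maximizer_degree_support[OF max k gap _ R] by simp
  next
    case False
    then have "0 < measure squareM (pure_set g)" using measure_nonneg[of squareM "pure_set g"] by linarith
    then show ?thesis using pure_maximizer_degree_support[OF max k gap _ R] by simp
  qed
  have fin: "finite (degree_support g)"
  proof (rule ccontr)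
    assume "infinite (degree_support g)"
    then obtain R where "R \<subseteq> degree_support g" "finite R" "card R = 9" using infinite_arbitrarily_large by blast
    then show False using bound[of R] by simp
  qed
  have "podal (card (degree_support g)) g"
    by (rule maximizer_finite_degrees_podal[OF max fin AE_degree_support[OF g]])
  then show ?thesis using bound[OF fin] by blast
next
  case False
  have g: "graphon g" using max by (simp add: entropy_maximizer_def)
  have "star_density k g = star_density 1 g ^ k" using False star_density_ge_power[OF g, of k] by simp
  from star_density_eq_power_imp_const[OF g k this]
  have "AE x in unitM. degree g x \<in> {star_density 1 g}" by simp
  from maximizer_finite_degrees_podal[OF max _ this] have "podal 1 g" by simp
  then show ?thesis by (intro exI[of _ 1]) simp
qed

theorem theorem3p6:
  fixes k :: nat
  assumes "k \<ge> 2"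
  shows "\<exists>M::nat. \<forall>\<tau>\<in>Gamma k. \<forall>g. entropy_maximizer k \<tau> g \<longrightarrow> (\<exists>m\<le>M. podal m g)"
  using maximizer_podal[OF _ assms] by blast

end
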